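(* Let $r\ge1$ and let $m_1,\dots,m_r\ge1$ and $d\ge 2$ be integers. The generating function $F^{\pi0}_{\vec m,d}(x_1,\dots,x_r,u)=\sum_{\vec s,t\ge0}\chi\bigl(\mathcal E^{\vec m,d}_{\pi0,\vec s,t}\bigr)x_1^{s_1}\cdots x_r^{s_r}u^t$ of the Euler characteristics of the Hodge summands of the complex $\mathcal E^{\vec m,d}_{\pi0}$ of hairy graphs of genus zero is $$F^{\pi0}_{\vec m,d}(x_1,\dots,x_r,u)=-\sum_{i=1}^r(-1)^{m_i}x_i+\Bigl(\sum_{i=1}^r(-1)^{m_i}x_i-\frac{(-1)^d}u\Bigr)\sum_{l=1}^{+\infty}\frac{\mu(l)\ln\bigl(1-(-1)^du^l\sum_{i=1}^r(-1)^{m_i}x_i^l\bigr)}l.$$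
   Context: $\mu$ is the Möbius function; logarithms are expanded as formal power series in $u$. Hairy graph-complex $\mathcal E_\pi^{\vec m,d}$: the graded $\mathbb Q$-vector space spanned by hairy graphs, i.e. finite connected graphs with a non-empty finite set of external vertices (hairs), which have valence $1$ and are colored by $\{1,\dots,r\}$, and a finite (possibly empty) set of non-labeled internal vertices of valence $\ge3$; multiple edges and tadpoles (self-loops) are allowed. Every edge is oriented, and each graph comes with an ordering of its orientation set, which consists of the edges (each of degree $d-1$), the internal vertices (each of degree $-d$) and the external vertices (of degree $-m_i$ if colored by $i$). Isomorphic such graphs are identified, changing the orientation of an edge produces the sign $(-1)^d$, and reordering the orientation set produces the Koszul sign of the permutation. The homological degree of a graph is the sum of degrees of the elements of its orientation set. The differential (of degree $-1$) is the sum over internal vertices of all their expansions into two internal vertices of valence $\ge3$ connected by a new edge. The Hodge multi-degree of a graph is $\vec s=(s_1,\dots,s_r)$, with $s_i$ the number of external vertices of color $i$; its complexity $t$ is the first Betti number of the graph obtained by gluing together all external vertices; its genus $g$ is its first Betti number. The differential preserves all three, and $\mathcal E^{\vec m,d}_{\pi g,\vec s,t}$ denotes the (finite-dimensional) subcomplex spanned by graphs of genus $g$, Hodge multi-degree $\vec s$ and complexity $t$; $\mathcal E^{\vec m,d}_{\pi g}=\bigoplus_{\vec s,t}\mathcal E^{\vec m,d}_{\pi g,\vec s,t}$ is the Hodge splitting. $\chi$ is the Euler characteristic $\sum_j(-1)^j\dim$ with respect to homological degree. *)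

theory Defs
  imports
    "HOL-Analysis.Analysis"
    "HOL-Library.Poly_Mapping"
    "HOL-Combinatorics.List_Permutation"
    "HOL-Computational_Algebra.Computational_Algebra"
begin

section \<open>Oriented hairy graphs\<close>

text \<open>
  The elements of the orientation set of a hairy graph. \<open>Edge v w\<close> is an edge oriented from
  \<open>v\<close> to \<open>w\<close>, \<open>Internal v\<close> is an internal vertex, and \<open>External v i\<close> is an external vertex
  of colour \<open>i\<close>. The \<open>'v\<close>-components are the names of vertices.

  An oriented hairy graph, that is, a graph together with an ordering of its orientation set,
  is recorded as the list of the elements of the orientation set in this order.
  Edges are identified by their positions in the list, so that \<open>Edge v w\<close> may occur
  repeatedly (multiple edges), and \<open>v = w\<close> is allowed (tadpoles).
\<close>

datatype 'v cell = Edge 'v 'v | Internal 'v | External 'v nat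

type_synonym ograph = "nat cell list"

definition edges :: "'v cell list \<Rightarrow> ('v \<times> 'v) list" where
  "edges G = [(v, w). Edge v w \<leftarrow> G]"

definition internals :: "'v cell list \<Rightarrow> 'v list" where
  "internals G = [v. Internal v \<leftarrow> G]"

definition externals :: "'v cell list \<Rightarrow> 'v list" where
  "externals G = [v. External v i \<leftarrow> G]"

definition hair_colours :: "'v cell list \<Rightarrow> nat list" where
  "hair_colours G = [i. External v i \<leftarrow> G]"

definition vertices :: "'v cell list \<Rightarrow> 'v set" where
  "vertices G = set (internals G) \<union> set (externals G)"

text \<open>A tadpole contributes 2 to the valence of its vertex.\<close>

definition valence :: "'v cell list \<Rightarrow> 'v \<Rightarrow> nat" where
  "valence G v = count_list (map fst (edges G)) v + count_list (map snd (edges G)) v"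

definition graph_components :: "'v set \<Rightarrow> ('v \<times> 'v) list \<Rightarrow> 'v set set" where
  "graph_components V es = V // {(v, w). v \<in> V \<and> w \<in> V \<and> (v, w) \<in> (set es \<union> (set es)\<inverse>)\<^sup>*}"

text \<open>
  The first Betti number (cyclomatic number) of the finite multigraph with vertex set \<open>V\<close> and
  list of edges \<open>es\<close>.
\<close>

definition first_betti :: "'v set \<Rightarrow> ('v \<times> 'v) list \<Rightarrow> int" where
  "first_betti V es = int (length es) - int (card V) + int (card (graph_components V es))"

definition hairy_graph :: "nat \<Rightarrow> 'v cell list \<Rightarrow> bool" where
  "hairy_graph r G \<longleftrightarrow>
     distinct (internals G @ externals G) \<and>
     (\<forall>(v, w) \<in> set (edges G). v \<in> vertices G \<and> w \<in> vertices G) \<and>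
     card (graph_components (vertices G) (edges G)) = 1 \<and>
     externals G \<noteq> [] \<and>
     set (hair_colours G) \<subseteq> {1..r} \<and>
     (\<forall>v \<in> set (externals G). valence G v = 1) \<and>
     (\<forall>v \<in> set (internals G). valence G v \<ge> 3)"

definition genus :: "'v cell list \<Rightarrow> int" where
  "genus G = first_betti (vertices G) (edges G)"

text \<open>
  For the complexity all external vertices are glued together: they are all sent to \<open>None\<close>,
  while an internal vertex \<open>v\<close> becomes \<open>Some v\<close>.
\<close>

definition glue :: "'v cell list \<Rightarrow> 'v \<Rightarrow> 'v option" where
  "glue G v = (if v \<in> set (externals G) then None else Some v)"

definition complexity :: "'v cell list \<Rightarrow> int" where
  "complexity G =
     first_betti (glue G ` vertices G) (map (map_prod (glue G) (glue G)) (edges G))"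

definition hodge_degree :: "'v cell list \<Rightarrow> nat \<Rightarrow> nat" where
  "hodge_degree G i = count_list (hair_colours G) i"

fun cell_degree :: "(nat \<Rightarrow> nat) \<Rightarrow> nat \<Rightarrow> 'v cell \<Rightarrow> int" where
  "cell_degree m d (Edge v w) = int d - 1"
| "cell_degree m d (Internal v) = - int d"
| "cell_degree m d (External v i) = - int (m i)"

definition graph_degree :: "(nat \<Rightarrow> nat) \<Rightarrow> nat \<Rightarrow> 'v cell list \<Rightarrow> int" where
  "graph_degree m d G = (\<Sum>c\<leftarrow>G. cell_degree m d c)"

text \<open>
  The Koszul sign of the reordering \<open>permute_list \<pi> G\<close> of \<open>G\<close>: each pair of elements whose
  order gets reversed contributes \<open>(-1)\<close> to the product of their degrees. (The element at
  position \<open>i\<close> of \<open>permute_list \<pi> G\<close> is \<open>G ! \<pi> i\<close>.)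
\<close>

definition koszul_sign :: "(nat \<Rightarrow> nat) \<Rightarrow> nat \<Rightarrow> 'v cell list \<Rightarrow> (nat \<Rightarrow> nat) \<Rightarrow> rat" where
  "koszul_sign m d G \<pi> =
     (\<Prod>(i, j) \<in> {(i, j). i < j \<and> j < length G \<and> \<pi> j < \<pi> i}.
        (- 1) powi (cell_degree m d (G ! \<pi> i) * cell_degree m d (G ! \<pi> j)))"

section \<open>The hairy graph-complex as a graded vector space\<close>

text \<open>
  \<open>'a \<Rightarrow>\<^sub>0 rat\<close> is the free vector space over the rationals on \<open>'a\<close>, with
  \<open>Poly_Mapping.single a 1\<close> the basis vector given by \<open>a\<close>.
\<close>

definition qscale :: "rat \<Rightarrow> ('a \<Rightarrow>\<^sub>0 rat) \<Rightarrow> ('a \<Rightarrow>\<^sub>0 rat)" where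
  "qscale c f = Poly_Mapping.map ((*) c) f"

lemma lookup_qscale [simp]: "Poly_Mapping.lookup (qscale c f) k = c * Poly_Mapping.lookup f k"
  by (simp add: qscale_def Poly_Mapping.map.rep_eq when_def)

global_interpretation free_rat: vector_space qscale
  by unfold_locales (auto intro!: poly_mapping_eqI simp: lookup_add algebra_simps)

abbreviation gen :: "'a \<Rightarrow> ('a \<Rightarrow>\<^sub>0 rat)" where
  "gen a \<equiv> Poly_Mapping.single a 1"

text \<open>
  The relations: isomorphic oriented graphs (matching also the orderings) are identified,
  changing the orientation of an edge produces \<open>(-1) ^ d\<close>, and reordering the orientation
  set produces the Koszul sign.
\<close>

definition graph_relations :: "nat \<Rightarrow> (nat \<Rightarrow> nat) \<Rightarrow> nat \<Rightarrow> (ograph \<Rightarrow>\<^sub>0 rat) set" where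
  "graph_relations r m d =
     {gen (map (map_cell f) G) - gen G | G f. hairy_graph r G \<and> inj_on f (vertices G)} \<union>
     {gen (G[k := Edge w v]) - qscale ((- 1) ^ d) (gen G) | G k v w.
        hairy_graph r G \<and> k < length G \<and> G ! k = Edge v w} \<union>
     {gen (permute_list \<pi> G) - qscale (koszul_sign m d G \<pi>) (gen G) | G \<pi>.
        hairy_graph r G \<and> \<pi> permutes {..<length G}}"

text \<open>
  The dimension of the image of \<open>span U\<close> in the quotient of the ambient space by \<open>span R\<close>:
  the number of elements of a set \<open>B\<close> of vectors of \<open>span U\<close> whose residue classes form a basis
  of this image. As for \<open>vector_space.dim\<close>, the value is 0 if the dimension is infinite.
\<close>

definition quotient_dim :: "('a \<Rightarrow>\<^sub>0 rat) set \<Rightarrow> ('a \<Rightarrow>\<^sub>0 rat) set \<Rightarrow> nat" where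
  "quotient_dim U R =
     card (SOME B. B \<subseteq> free_rat.span U \<and>
                   free_rat.independent B \<and> free_rat.span B \<inter> free_rat.span R = {0} \<and>
                   free_rat.span U \<subseteq> free_rat.span (B \<union> R))"

text \<open>
  \<open>complex_dim r m d g s t j\<close> is the dimension of the part of homological degree \<open>j\<close> of the
  summand of genus \<open>g\<close>, Hodge multi-degree \<open>s\<close> and complexity \<open>t\<close>.
  The differential does not enter the Euler characteristic, which is the alternating sum of
  these dimensions.
\<close>

definition complex_dim ::
  "nat \<Rightarrow> (nat \<Rightarrow> nat) \<Rightarrow> nat \<Rightarrow> nat \<Rightarrow> (nat \<Rightarrow>\<^sub>0 nat) \<Rightarrow> nat \<Rightarrow> int \<Rightarrow> nat" where
  "complex_dim r m d g s t j =
     quotient_dim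
       {gen G | G :: ograph. hairy_graph r G \<and> genus G = int g \<and>
          hodge_degree G = Poly_Mapping.lookup s \<and> complexity G = int t \<and>
          graph_degree m d G = j}
       (graph_relations r m d)"

definition euler_char ::
  "nat \<Rightarrow> (nat \<Rightarrow> nat) \<Rightarrow> nat \<Rightarrow> nat \<Rightarrow> (nat \<Rightarrow>\<^sub>0 nat) \<Rightarrow> nat \<Rightarrow> rat" where
  "euler_char r m d g s t =
     (\<Sum>j | complex_dim r m d g s t j \<noteq> 0. (- 1) powi j * of_nat (complex_dim r m d g s t j))"

section \<open>Power series\<close>

text \<open>
  Polynomials with rational coefficients in the variables \<open>x i\<close>. Power series in the variables
  \<open>x i\<close> and \<open>u\<close> all of whose coefficients in \<open>u\<close> are polynomials are elements of \<open>xpoly fps\<close>.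
\<close>

type_synonym xpoly = "(nat \<Rightarrow>\<^sub>0 nat) \<Rightarrow>\<^sub>0 rat"

abbreviation const_poly :: "rat \<Rightarrow> xpoly" where
  "const_poly c \<equiv> Poly_Mapping.single 0 c"

definition xvar :: "nat \<Rightarrow> xpoly" where
  "xvar i = Poly_Mapping.single (Poly_Mapping.single i 1) 1"

definition signed_power_sum :: "nat \<Rightarrow> (nat \<Rightarrow> nat) \<Rightarrow> nat \<Rightarrow> xpoly" where
  "signed_power_sum r m l = (\<Sum>i = 1..r. (- 1) ^ m i * xvar i ^ l)"

text \<open>
  \<open>ln (1 + f)\<close> for a power series \<open>f\<close> with zero constant term: \<open>fps_ln 1\<close> is the series of
  \<open>ln (1 + X)\<close>, into which \<open>f\<close> is substituted.
\<close>

definition ln_one_plus :: "xpoly fps \<Rightarrow> xpoly fps" where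
  "ln_one_plus f = Abs_fps (\<lambda>n. const_poly (fps_nth (fps_ln 1) n)) oo f"

definition moebius_mu :: "nat \<Rightarrow> rat" where
  "moebius_mu n = (if squarefree n then (- 1) ^ card (prime_factors n) else 0)"

text \<open>The sum over \<open>l \<ge> 1\<close>; it converges in the \<open>u\<close>-adic topology of formal power series.\<close>

definition log_series :: "nat \<Rightarrow> (nat \<Rightarrow> nat) \<Rightarrow> nat \<Rightarrow> xpoly fps" where
  "log_series r m d =
     suminf (\<lambda>n. let l = Suc n in
        fps_const (const_poly (moebius_mu l / of_nat l)) *
        ln_one_plus (- ((- 1) ^ d * fps_X ^ l * fps_const (signed_power_sum r m l))))"

end

theory Submission
  imports Defs
begin

text \<open>
  A graph of genus zero is a tree, and its isomorphism class is recorded by the tree rooted at its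
  centre, which is a vertex or an edge. The class survives in the complex unless exchanging two
  equal subtrees is an odd automorphism. So the Euler characteristics are signed counts of centred
  trees.

  Let \<open>f h\<close> be the signed generating function of the surviving planted trees of height less than
  \<open>h\<close>, and let \<open>S h\<close> be that of the multisets of such trees in which odd trees are not
  repeated. An internal vertex together with its stem is odd, so
  \<open>f (h + 1) = \<ell> - (S h - 1 - f h)\<close>, where \<open>\<ell> = - (-1)^d u (\<Sum>i. (-1)^(m i) x i)\<close> comes from the
  leaves. In the limit \<open>S = 1 + \<ell>\<close>. Since \<open>S\<close> is the plethystic exponential of \<open>f\<close>, Moebius inversion
  turns \<open>ln S\<close> into \<open>f\<close>, which is the series in the theorem. With \<open>\<delta> = f (h + 1) - f h\<close>,
  the trees whose centre sees the height \<open>h\<close> contribute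
  \<open>(-1)^d (S (h + 1) - S h - \<delta> S h - \<delta>^2)\<close>, and this sum telescopes to
  \<open>(-1)^d (\<ell> - f - \<ell> f)\<close>.
\<close>

section \<open>Signs of reorderings\<close>

text \<open>An odd automorphism identifies a graph with its negative, so its class vanishes. That
  the other classes survive is the harder half: it needs linear functionals that respect all
  relations, hence a sign for every way of writing a labelled graph as a centred ordered tree that
  does not depend on this way. The sign comes from sorting siblings by shape. Equal siblings leave
  the sorting ambiguous, but harmlessly so, because in a surviving tree they are even; the centre
  makes the root canonical.

  The term \<open>\<delta>^2\<close> of the overview joins two corrections. A vertex centre has
  valence at least three, so pairs of branches of equal height must be removed from the multisets.
  Edge centres are such pairs too; they count with the opposite sign, because the central edge is
  contained in both stems, and with the opposite parity rule for equal halves. Unordered pairs of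
  distinct trees occur in both corrections and each repeated pair in exactly one, which makes a
  square.

  The factor \<open>1 / u\<close> arises because the complexity of a tree is its number of leaves
  minus one.\<close>

definition kz :: "('a \<Rightarrow> bool) \<Rightarrow> 'a \<Rightarrow> 'a \<Rightarrow> rat" where
  "kz od x y = (if od x \<and> od y then - 1 else 1)"

lemma kz_commute: "kz od x y = kz od y x"
  by (auto simp: kz_def)

lemma kz_square [simp]: "kz od x y * kz od x y = 1" "kz od x y * (kz od x y * c) = c"
  by (auto simp: kz_def)

text \<open>Rearrangement by exchanges of neighbours, with the product of their signs. The sign is
  not a function of the two lists in general: exchanging two equal odd entries leads from a list to
  itself with sign -1.\<close>

inductive kperm :: "('a \<Rightarrow> bool) \<Rightarrow> 'a list \<Rightarrow> rat \<Rightarrow> 'a list \<Rightarrow> bool" for od where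
  start: "kperm od L 1 L"
| swap: "kperm od L e (A @ x # y # B) \<Longrightarrow> kperm od L (e * kz od x y) (A @ y # x # B)"

lemma kperm_trans: "kperm od M e' N \<Longrightarrow> kperm od L e M \<Longrightarrow> kperm od L (e * e') N"
  by (induction rule: kperm.induct) (auto intro: kperm.intros simp flip: mult.assoc)

lemma kperm_context: "kperm od L e M \<Longrightarrow> kperm od (A @ L @ B) e (A @ M @ B)"
proof (induction rule: kperm.induct)
  case (swap L e C x y D)
  show ?case using kperm.swap[of od "A @ L @ B" e "A @ C" x y "D @ B"] swap by simp
qed (rule kperm.start)

lemma kperm_Cons: "kperm od L e M \<Longrightarrow> kperm od (x # L) e (x # M)"
  using kperm_context[of od L e M "[x]" "[]"] by simp

lemma kperm_mset: "kperm od L e M \<Longrightarrow> mset M = mset L"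
  by (induction rule: kperm.induct) (auto simp: add_mset_commute)

lemma kperm_move: "\<exists>e. kperm od (x # A @ B) e (A @ x # B)"
proof (induction A)
  case (Cons a A)
  then obtain e where "kperm od (x # A @ B) e (A @ x # B)" by blast
  then have "kperm od (a # x # A @ B) e (a # A @ x # B)" by (rule kperm_Cons)
  moreover have "kperm od (x # a # A @ B) (1 * kz od x a) (a # x # A @ B)"
    using kperm.swap[of od _ 1 "[]"] kperm.start by fastforce
  ultimately show ?case using kperm_trans by fastforce
qed (auto intro: kperm.start)

lemma mset_eq_kperm: "mset L = mset M \<Longrightarrow> \<exists>e. kperm od L e M"
proof (induction L arbitrary: M)
  case (Cons x L)
  then obtain A B where M: "M = A @ x # B"
    by (metis list.set_intros(1) set_mset_mset split_list)
  with Cons obtain e where "kperm od L e (A @ B)" by fastforce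
  then have "kperm od (x # L) e (x # A @ B)" by (rule kperm_Cons)
  then show ?case using kperm_move[of od x A B] kperm_trans M by fast
qed (auto intro: kperm.start)

lemma kperm_map:
  "kperm od L e M \<Longrightarrow> (\<And>x. x \<in> set L \<Longrightarrow> od' (f x) = od x) \<Longrightarrow> kperm od' (map f L) e (map f M)"
proof (induction rule: kperm.induct)
  case (swap L e A x y B)
  have "set (A @ x # y # B) = set L" using kperm_mset[OF swap.hyps] by (metis set_mset_mset)
  then have "kz od x y = kz od' (f x) (f y)" using swap.prems by (auto simp: kz_def)
  moreover have "kperm od' (map f L) e (map f A @ f x # f y # map f B)"
    using swap.IH swap.prems by simp
  ultimately show ?case using kperm.swap by fastforce
qed (auto intro: kperm.start)

primrec inversion_sign :: "('a \<Rightarrow> 'a \<Rightarrow> bool) \<Rightarrow> ('a \<Rightarrow> bool) \<Rightarrow> 'a list \<Rightarrow> rat" where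
  "inversion_sign lt od [] = 1"
| "inversion_sign lt od (x # xs) =
     (\<Prod>y\<leftarrow>xs. if lt y x then kz od x y else 1) * inversion_sign lt od xs"

text \<open>Transitivity is irrelevant for counting inversions, so a tournament may replace a linear order.\<close>

definition tournament :: "('a \<Rightarrow> 'a \<Rightarrow> bool) \<Rightarrow> bool" where
  "tournament lt \<longleftrightarrow> (\<forall>x y. x \<noteq> y \<longrightarrow> lt x y = (\<not> lt y x))"

lemma tournament_exists: "\<exists>lt :: 'a \<Rightarrow> 'a \<Rightarrow> bool. tournament lt"
proof -
  obtain r :: "'a rel" where "well_order_on UNIV r" using well_order_on by blast
  then have "total r" "antisym r"
    by (auto simp: well_order_on_def linear_order_on_def partial_order_on_def)
  then have "tournament (\<lambda>x y. (x, y) \<in> r)"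
    unfolding tournament_def total_on_def antisym_def by blast
  then show ?thesis by blast
qed

text \<open>An arbitrary fixed choice: the signs below depend on it, the dimensions do not.\<close>

definition lt0 :: "'a \<Rightarrow> 'a \<Rightarrow> bool" where
  "lt0 = (SOME lt. tournament lt)"

lemma tournament_lt0: "tournament lt0"
  unfolding lt0_def by (rule someI_ex[OF tournament_exists])

lemma inversion_sign_cases: "inversion_sign lt od xs = 1 \<or> inversion_sign lt od xs = - 1"
proof (induction xs)
  case (Cons x xs)
  have "(\<Prod>y\<leftarrow>ys. if lt y x then kz od x y else 1) \<in> {1, - 1}" for ys
    by (induction ys) (auto simp: kz_def)
  with Cons show ?case by fastforce
qed simp

lemma inversion_sign_square [simp]:
  "inversion_sign lt od xs * inversion_sign lt od xs = 1"
  "inversion_sign lt od xs * (inversion_sign lt od xs * c) = c"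
  using inversion_sign_cases[of lt od xs] by auto

text \<open>Only the inversion status of this one pair changes. The second assumption excludes equal
  odd entries, whose exchange leaves the list alone although \<open>kz\<close> is -1.\<close>

lemma inversion_sign_swap:
  assumes "tournament lt" "x = y \<Longrightarrow> \<not> od x"
  shows "inversion_sign lt od (A @ x # y # B) = kz od x y * inversion_sign lt od (A @ y # x # B)"
proof (induction A)
  case Nil
  consider "x = y" "\<not> od x" | "lt x y = (\<not> lt y x)"
    using assms by (auto simp: tournament_def)
  then show ?case
  proof cases
    case 1
    then show ?thesis unfolding 1(1)[symmetric] by (simp only: kz_def append.simps) simp
  next
    case 2
    then show ?thesis by (cases "lt y x") (simp_all add: kz_def)
  qed
qed (simp add: mult_ac)

definition no_odd_repeat :: "('a \<Rightarrow> bool) \<Rightarrow> 'a multiset \<Rightarrow> bool" where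
  "no_odd_repeat od M \<longleftrightarrow> (\<forall>x. od x \<longrightarrow> count M x \<le> 1)"

text \<open>Every exchange multiplies the inversion sign by its own sign, so the total sign is
  determined by the two ends. The map \<open>g\<close> will send a labelled tree to its shape: the
  trees differ by their labels, and what matters is whether odd shapes are repeated.\<close>

lemma kperm_inversion_sign:
  assumes "tournament lt" "kperm (\<lambda>x. od (g x)) L e M" "no_odd_repeat od (mset (map g L))"
  shows "e = inversion_sign lt od (map g L) * inversion_sign lt od (map g M)"
  using assms(2,3)
proof (induction rule: kperm.induct)
  case (swap L e A x y B)
  have m: "mset L = mset (A @ x # y # B)" using kperm_mset[OF swap.hyps] by simp
  have "mset (map g L) = mset (map g (A @ x # y # B))" using m by (metis mset_map)
  then have "g x = g y \<Longrightarrow> \<not> od (g x)"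
    using swap.prems by (auto simp: no_odd_repeat_def split: if_splits)
  from inversion_sign_swap[where lt = lt and x = "g x" and y = "g y" and od = od and A = "map g A" and B = "map g B", OF assms(1) this]
  have "inversion_sign lt od (map g (A @ x # y # B)) =
    kz od (g x) (g y) * inversion_sign lt od (map g (A @ y # x # B))" by simp
  moreover have "kz od (g x) (g y) = kz (\<lambda>x. od (g x)) x y" by (simp add: kz_def)
  ultimately show ?case using swap.IH[OF swap.prems] by (simp add: mult.assoc mult.left_commute[of _ "kz _ _ _"])
qed simp

lemma inversion_sign_strict_sorted:
  "sorted_wrt (\<lambda>x y. \<not> lt y x) xs \<Longrightarrow> inversion_sign lt od xs = 1"
proof (induction xs)
  case (Cons x xs)
  have "(\<forall>y\<in>set ys. \<not> lt y x) \<Longrightarrow> (\<Prod>y\<leftarrow>ys. if lt y x then kz od x y else 1) = 1" for ys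
    by (induction ys) auto
  then show ?case using Cons by simp
qed simp

text \<open>The form in which \<open>koszul_sign\<close> is given, a product over inverted pairs of
  positions.\<close>

lemma inversion_sign_conv_prod:
  "inversion_sign lt od xs =
     (\<Prod>(i, j) \<in> {(i, j). i < j \<and> j < length xs \<and> lt (xs ! j) (xs ! i)}. kz od (xs ! i) (xs ! j))"
proof (induction xs)
  case (Cons x xs)
  let ?S = "{(i, j). i < j \<and> j < length xs \<and> lt (xs ! j) (xs ! i)}"
  let ?J = "{j. j < length xs \<and> lt (xs ! j) x}"
  have fin: "finite ?S" by (rule finite_subset[of _ "{..<length xs} \<times> {..<length xs}"]) auto
  have eq: "{(i, j). i < j \<and> j < length (x # xs) \<and> lt ((x # xs) ! j) ((x # xs) ! i)} =
      (\<lambda>j. (0, Suc j)) ` ?J \<union> map_prod Suc Suc ` ?S" (is "?L = ?R")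
  proof (intro set_eqI iffI)
    fix p assume "p \<in> ?L"
    then obtain i j where p: "p = (i, j)" "i < j" "j < length (x # xs)" "lt ((x # xs) ! j) ((x # xs) ! i)"
      by auto
    then obtain j' where "j = Suc j'" by (cases j) auto
    then show "p \<in> ?R" using p by (cases i) (auto simp: image_iff)
  qed auto
  have "(\<Prod>y\<leftarrow>xs. if lt y x then kz od x y else 1) = (\<Prod>j<length xs. if lt (xs ! j) x then kz od x (xs ! j) else 1)"
    by (simp add: prod.list_conv_set_nth atLeast0LessThan)
  also have "\<dots> = (\<Prod>j\<in>?J. kz od x (xs ! j))"
    by (rule prod.mono_neutral_cong_right) auto
  finally have 1: "(\<Prod>y\<leftarrow>xs. if lt y x then kz od x y else 1) = (\<Prod>j\<in>?J. kz od x (xs ! j))" .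
  show ?case unfolding eq
    by (subst prod.union_disjoint)
       (auto simp: 1 Cons fin[unfolded case_prod_unfold] inj_on_def prod.reindex case_prod_unfold)
qed (simp add: case_prod_beta)

lemma permute_list_conv_map: "\<pi> permutes {..<length G} \<Longrightarrow> permute_list \<pi> G = map ((!) G) (map \<pi> [0..<length G])"
  by (simp add: permute_list_def o_def)

definition odd_cell :: "(nat \<Rightarrow> nat) \<Rightarrow> nat \<Rightarrow> 'v cell \<Rightarrow> bool" where
  "odd_cell m d c \<longleftrightarrow> odd (cell_degree m d c)"

lemma koszul_sign_conv_inversion_sign:
  assumes "\<pi> permutes {..<length G}"
  shows "koszul_sign m d G \<pi> =
     inversion_sign (<) (\<lambda>i. odd_cell m d (G ! i)) (map \<pi> [0..<length G])"
  unfolding koszul_sign_def inversion_sign_conv_prod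
  by (intro prod.cong) (auto simp: kz_def odd_cell_def power_int_minus_left)

text \<open>Cells of \<open>G\<close> may coincide, which would leave the sign undetermined. It is
  therefore computed for the list of positions, which are distinct, and then transported along
  \<open>(!) G\<close>.\<close>

lemma kperm_permute_list:
  assumes p: "\<pi> permutes {..<length G}"
  shows "kperm (odd_cell m d) G (koszul_sign m d G \<pi>) (permute_list \<pi> G)"
proof -
  let ?n = "length G" and ?od = "\<lambda>i. odd_cell m d (G ! i)"
  have dis: "distinct (map \<pi> [0..<?n])"
    using permutes_inj_on[OF p] by (simp add: distinct_map inj_on_subset)
  have "set (map \<pi> [0..<?n]) = set [0..<?n]"
    using permutes_image[OF p] by (simp add: atLeast0LessThan)
  then have "mset [0..<?n] = mset (map \<pi> [0..<?n])"
    using dis by (metis distinct_upt set_eq_iff_mset_eq_distinct)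
  then obtain e where e: "kperm ?od [0..<?n] e (map \<pi> [0..<?n])" using mset_eq_kperm by blast
  have "e = inversion_sign (<) ?od (map id [0..<?n]) * inversion_sign (<) ?od (map id (map \<pi> [0..<?n]))"
    by (rule kperm_inversion_sign) (use e in \<open>auto simp: tournament_def no_odd_repeat_def count_mset_set'\<close>)
  also have "inversion_sign (<) ?od (map id [0..<?n]) = 1"
    by (rule inversion_sign_strict_sorted) (simp add: sorted_wrt_upt sorted_wrt_iff_nth_less)
  finally have "e = koszul_sign m d G \<pi>" by (simp add: koszul_sign_conv_inversion_sign[OF p])
  with kperm_map[OF e, of "odd_cell m d" "(!) G"] show ?thesis
    by (simp add: permute_list_conv_map[OF p] map_nth)
qed

section \<open>Equality of oriented graphs up to sign\<close>

text \<open>The relations of the complex other than relabelling, generated by single steps and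
  carrying the accumulated sign. Relabelling stays separate because it has no sign and changes the
  vertices.\<close>

inductive orel :: "(nat \<Rightarrow> nat) \<Rightarrow> nat \<Rightarrow> 'v cell list \<Rightarrow> rat \<Rightarrow> 'v cell list \<Rightarrow> bool" for m d where
  start: "orel m d L 1 L"
| swap: "orel m d L e (A @ x # y # B) \<Longrightarrow> orel m d L (e * kz (odd_cell m d) x y) (A @ y # x # B)"
| flip: "orel m d L e (A @ Edge v w # B) \<Longrightarrow> orel m d L (e * (- 1) ^ d) (A @ Edge w v # B)"

lemma orel_trans: "orel m d M e' N \<Longrightarrow> orel m d L e M \<Longrightarrow> orel m d L (e * e') N"
  by (induction rule: orel.induct) (auto intro: orel.intros simp flip: mult.assoc)

lemma orel_swap1: "orel m d (A @ x # y # B) (kz (odd_cell m d) x y) (A @ y # x # B)"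
  using orel.swap[OF orel.start[of m d "A @ x # y # B"]] by simp

lemma orel_flip1: "orel m d (A @ Edge v w # B) ((- 1) ^ d) (A @ Edge w v # B)"
  using orel.flip[OF orel.start[of m d "A @ Edge v w # B"]] by simp

lemma orel_square: "orel m d L e M \<Longrightarrow> e * e = 1"
proof (induction rule: orel.induct)
  case (flip L e A v w B)
  have "e * (- 1) ^ d * (e * (- 1) ^ d) = (e * e) * ((- 1) ^ d * (- 1) ^ d)" by (simp only: mult_ac)
  then show ?case using flip by (simp flip: power_add)
next
  case (swap L e A x y B)
  have "e * kz (odd_cell m d) x y * (e * kz (odd_cell m d) x y) = (e * e) * (kz (odd_cell m d) x y * kz (odd_cell m d) x y)"
    by (simp only: mult_ac)
  then show ?case using swap by simp
qed simp

lemma orel_sym: "orel m d L e M \<Longrightarrow> orel m d M e L"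
proof (induction rule: orel.induct)
  case (swap L e A x y B)
  then show ?case using orel_trans[OF swap.IH orel_swap1[of m d A y x B]]
    by (simp add: mult.commute kz_commute)
next
  case (flip L e A v w B)
  then show ?case using orel_trans[OF flip.IH orel_flip1[of m d A w v B]]
    by (simp add: mult.commute)
qed (rule orel.start)

lemma orel_context: "orel m d L e M \<Longrightarrow> orel m d (A @ L @ B) e (A @ M @ B)"
proof (induction rule: orel.induct)
  case (swap L e C x y D)
  show ?case using orel.swap[of m d "A @ L @ B" e "A @ C" x y "D @ B"] swap by simp
next
  case (flip L e C x y D)
  show ?case using orel.flip[of m d "A @ L @ B" e "A @ C" x y "D @ B"] flip by simp
qed (rule orel.start)

lemma orel_append: "orel m d L e M \<Longrightarrow> orel m d L' e' M' \<Longrightarrow> orel m d (L @ L') (e * e') (M @ M')"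
  using orel_trans[of m d "M @ L'" e' "M @ M'" "L @ L'" e]
    orel_context[of m d L' e' M' M "[]"] orel_context[of m d L e M "[]" L'] by simp

lemma orel_Cons: "orel m d L e M \<Longrightarrow> orel m d (x # L) e (x # M)"
  using orel_context[of m d L e M "[x]" "[]"] by simp

lemma kperm_orel: "kperm (odd_cell m d) L e M \<Longrightarrow> orel m d L e M"
  by (induction rule: kperm.induct) (auto intro: orel.intros)

lemma orel_mset: "mset L = mset M \<Longrightarrow> \<exists>e. orel m d L e M"
  using mset_eq_kperm kperm_orel by metis

lemma orel_map: "orel m d L e M \<Longrightarrow> orel m d (map (map_cell f) L) e (map (map_cell f) M)"
proof (induction rule: orel.induct)
  case (swap L e A x y B)
  have "odd_cell m d (map_cell f c) = odd_cell m d c" for c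
    by (cases c) (simp_all add: odd_cell_def)
  then have "kz (odd_cell m d) x y = kz (odd_cell m d) (map_cell f x) (map_cell f y)"
    by (simp add: kz_def)
  then show ?case using swap.IH orel.swap by fastforce
next
  case (flip L e A v w B)
  then show ?case using orel.flip by fastforce
qed (rule orel.start)

definition odd_list :: "(nat \<Rightarrow> nat) \<Rightarrow> nat \<Rightarrow> 'v cell list \<Rightarrow> bool" where
  "odd_list m d L \<longleftrightarrow> odd (graph_degree m d L)"

lemma graph_degree_simps [simp]:
  "graph_degree m d [] = 0"
  "graph_degree m d (c # L) = cell_degree m d c + graph_degree m d L"
  "graph_degree m d (L @ M) = graph_degree m d L + graph_degree m d M"
  by (simp_all add: graph_degree_def)

lemma kz_Cons: "kz (odd_list m d) (x # A) B = kz (odd_list m d) [x] B * kz (odd_list m d) A B"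
  by (auto simp: kz_def odd_list_def)

lemma orel_move: "orel m d (x # A @ B) (kz (odd_list m d) [x] A) (A @ x # B)"
proof (induction A)
  case (Cons a A)
  have "kz (odd_list m d) [x] (a # A) = kz (odd_list m d) [x] A * kz (odd_cell m d) x a"
    by (auto simp: kz_def odd_list_def odd_cell_def)
  then show ?case
    using orel_trans[OF orel_Cons[OF Cons, of a]] orel_swap1[of m d "[]" x a "A @ B"]
    by (simp add: mult.commute)
qed (simp add: orel.start kz_def odd_list_def)

lemma orel_block_swap: "orel m d (A @ X @ Y @ B) (kz (odd_list m d) X Y) (A @ Y @ X @ B)"
proof -
  have "orel m d (X @ Y @ B) (kz (odd_list m d) X Y) (Y @ X @ B)"
  proof (induction X)
    case (Cons x X)
    show ?case
      using orel_trans[OF orel_move[of m d x Y "X @ B"]] orel_Cons[OF Cons, of x]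
      by (simp add: kz_Cons[of _ _ x X] mult.commute)
  qed (simp add: orel.start kz_def odd_list_def)
  then show ?thesis using orel_context[of m d "X @ Y @ B" _ "Y @ X @ B" A "[]"] by simp
qed

text \<open>Exchanging blocks costs the Koszul sign of their total degrees, so that a planted
  subtree can be handled as one odd or even element.\<close>

lemma kperm_orel_concat:
  assumes "kperm od L e M" "\<And>x. od x = odd_list m d (g x)"
  shows "orel m d (concat (map g L)) e (concat (map g M))"
  using assms(1)
proof (induction rule: kperm.induct)
  case (swap L e A x y B)
  have "kz od x y = kz (odd_list m d) (g x) (g y)" using assms(2) by (simp add: kz_def)
  then show ?case
    using orel_trans[OF orel_block_swap[of m d "concat (map g A)" "g x" "g y" "concat (map g B)"]] swap
    by simp
qed (rule orel.start)

text \<open>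
  For graphs without tadpoles and multiple edges the sign is determined by the two lists:
  orient each edge from the smaller to the larger vertex, then count the inversions of the list.
\<close>

fun normal_cell :: "nat cell \<Rightarrow> nat cell" where
  "normal_cell (Edge v w) = Edge (min v w) (max v w)"
| "normal_cell c = c"

fun flipped :: "nat cell \<Rightarrow> bool" where
  "flipped (Edge v w) = (w < v)"
| "flipped c = False"

definition simple_list :: "nat cell list \<Rightarrow> bool" where
  "simple_list L \<longleftrightarrow> distinct (map normal_cell L) \<and> (\<forall>v. Edge v v \<notin> set L)"

definition list_sign :: "(nat \<Rightarrow> nat) \<Rightarrow> nat \<Rightarrow> nat cell list \<Rightarrow> rat" where
  "list_sign m d L = inversion_sign lt0 (odd_cell m d) (map normal_cell L) *
     (- 1) ^ (d * length (filter flipped L))"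

lemma odd_normal_cell [simp]: "odd_cell m d (normal_cell c) = odd_cell m d c"
  by (cases c) (simp_all add: odd_cell_def)

lemma list_sign_square [simp]: "list_sign m d L * list_sign m d L = 1"
proof -
  have "list_sign m d L * list_sign m d L =
    (inversion_sign lt0 (odd_cell m d) (map normal_cell L) * inversion_sign lt0 (odd_cell m d) (map normal_cell L)) *
    ((- 1) ^ (d * length (filter flipped L)) * (- 1) ^ (d * length (filter flipped L)))"
    unfolding list_sign_def by (simp only: mult_ac)
  then show ?thesis by (simp flip: power_add)
qed

text \<open>\<open>list_sign\<close> is a potential: each generating step multiplies it by the sign
  of the step. Simplicity excludes the steps that change the sign but not the normalized list,
  namely flipping a tadpole and exchanging equal odd cells.\<close>

lemma orel_list_sign:
  "orel m d L e M \<Longrightarrow> simple_list L \<Longrightarrow> simple_list M \<and> list_sign m d M = e * list_sign m d L"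
proof (induction rule: orel.induct)
  case (swap L e A x y B)
  then have s: "simple_list (A @ x # y # B)" and
    eq: "list_sign m d (A @ x # y # B) = e * list_sign m d L" by auto
  from s have "normal_cell x \<noteq> normal_cell y" by (auto simp: simple_list_def)
  then have *: "inversion_sign lt0 (odd_cell m d) (map normal_cell A @ normal_cell y # normal_cell x # map normal_cell B)
    = kz (odd_cell m d) (normal_cell y) (normal_cell x) *
      inversion_sign lt0 (odd_cell m d) (map normal_cell A @ normal_cell x # normal_cell y # map normal_cell B)"
    by (intro inversion_sign_swap tournament_lt0) auto
  have "kz (odd_cell m d) (normal_cell y) (normal_cell x) = kz (odd_cell m d) x y"
    by (auto simp: kz_def)
  moreover have "length (filter flipped (A @ y # x # B)) = length (filter flipped (A @ x # y # B))"
    by simp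
  ultimately have "list_sign m d (A @ y # x # B) = kz (odd_cell m d) x y * list_sign m d (A @ x # y # B)"
    unfolding list_sign_def map_append list.map * by (simp only: mult.assoc)
  moreover have "simple_list (A @ y # x # B)" using s by (auto simp: simple_list_def)
  ultimately show ?case using eq by (simp add: mult_ac)
next
  case (flip L e A v w B)
  then have s: "simple_list (A @ Edge v w # B)" and
    eq: "list_sign m d (A @ Edge v w # B) = e * list_sign m d L" by auto
  from s have "v \<noteq> w" by (auto simp: simple_list_def)
  have n: "normal_cell (Edge w v) = normal_cell (Edge v w)" by auto
  have *: "(- 1) ^ (d * length (filter flipped (A @ Edge w v # B)))
      = (- 1 :: rat) ^ d * (- 1) ^ (d * length (filter flipped (A @ Edge v w # B)))"
  proof -
    define n where "n = length (filter flipped A) + length (filter flipped B)"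
    have sq: "(- 1 :: rat) ^ d * (- 1) ^ d = 1" by (simp flip: power_add)
    have "length (filter flipped (A @ Edge a b # B)) = (if b < a then Suc n else n)" for a b
      by (simp add: n_def)
    then show ?thesis
      using \<open>v \<noteq> w\<close> sq
      by (cases v w rule: linorder_cases) (simp_all add: power_add del: filter.simps flip: mult.assoc)
  qed
  have "list_sign m d (A @ Edge w v # B) = (- 1) ^ d * list_sign m d (A @ Edge v w # B)"
    unfolding list_sign_def * map_append list.map n by (simp only: mult_ac)
  moreover have "simple_list (A @ Edge w v # B)"
    using s \<open>v \<noteq> w\<close> unfolding simple_list_def map_append list.map n by auto
  ultimately show ?case using eq by (simp add: mult_ac)
qed simp

lemma orel_unique:
  assumes "orel m d L e M" "orel m d L e' M" "simple_list L"
  shows "e = e'"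
proof -
  have "e * list_sign m d L = e' * list_sign m d L"
    using orel_list_sign assms by metis
  then have "e * (list_sign m d L * list_sign m d L) = e' * (list_sign m d L * list_sign m d L)"
    by (metis mult.assoc)
  then show ?thesis by simp
qed

section \<open>Planted trees\<close>

text \<open>
  A planted tree is a tree with a half-edge, its stem, at the root. The degree of the stem is
  included in \<open>pdegree\<close>. The kind of a vertex is \<open>None\<close> if it is internal and \<open>Some i\<close> if it is
  external of colour \<open>i\<close>.
\<close>

datatype ptree = PN (pkind: "nat option") (pkids: "ptree multiset")

fun kind_degree :: "(nat \<Rightarrow> nat) \<Rightarrow> nat \<Rightarrow> nat option \<Rightarrow> int" where
  "kind_degree m d None = - int d"
| "kind_degree m d (Some i) = - int (m i)"

primrec pdegree :: "(nat \<Rightarrow> nat) \<Rightarrow> nat \<Rightarrow> ptree \<Rightarrow> int" where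
  "pdegree m d (PN k M) = int d - 1 + kind_degree m d k + (\<Sum>\<^sub># (image_mset (pdegree m d) M))"

abbreviation podd :: "(nat \<Rightarrow> nat) \<Rightarrow> nat \<Rightarrow> ptree \<Rightarrow> bool" where
  "podd m d T \<equiv> odd (pdegree m d T)"

primrec height :: "ptree \<Rightarrow> nat" where
  "height (PN k M) = Max (insert 0 (set_mset (image_mset Suc (image_mset height M))))"

lemma height_child: "T \<in># M \<Longrightarrow> height T < height (PN k M)"
  by (simp add: height.simps less_eq_Suc_le Max_ge)

lemma height_less_iff: "height (PN k M) < Suc n \<longleftrightarrow> (\<forall>T\<in>#M. height T < n)"
  by (simp add: height.simps less_Suc_eq_le Suc_le_eq)

lemma height_attained: "M \<noteq> {#} \<Longrightarrow> \<exists>T\<in>#M. height (PN k M) = Suc (height T)"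
proof -
  assume "M \<noteq> {#}"
  then obtain T0 where "T0 \<in># M" by blast
  have "height (PN k M) \<in> insert 0 (set_mset (image_mset Suc (image_mset height M)))"
    unfolding height.simps by (rule Max_in) auto
  with height_child[OF \<open>T0 \<in># M\<close>, of k] show ?thesis by auto
qed

declare height.simps [simp del]

text \<open>Failure of this condition produces an odd automorphism, see
  \<open>bad_odd_automorphism\<close>; under this condition the sign \<open>osign\<close> is well
  behaved, see \<open>treq\<close>.\<close>

inductive pgood :: "(nat \<Rightarrow> nat) \<Rightarrow> nat \<Rightarrow> ptree \<Rightarrow> bool" for m d where
  "(\<And>T. T \<in># M \<Longrightarrow> pgood m d T) \<Longrightarrow> no_odd_repeat (podd m d) M \<Longrightarrow> pgood m d (PN k M)"

lemma pgood_PN [simp]: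
  "pgood m d (PN k M) \<longleftrightarrow> (\<forall>T\<in>#M. pgood m d T) \<and> no_odd_repeat (podd m d) M"
  by (subst pgood.simps) auto

text \<open>The stem counts towards the valence of the root: two branches make an internal root
  trivalent, and an external root has no branch.\<close>

inductive pwf :: "nat \<Rightarrow> ptree \<Rightarrow> bool" for r where
  "i \<in> {1..r} \<Longrightarrow> pwf r (PN (Some i) {#})"
| "(\<And>T. T \<in># M \<Longrightarrow> pwf r T) \<Longrightarrow> size M \<ge> 2 \<Longrightarrow> pwf r (PN None M)"

lemma pwf_PN:
  "pwf r (PN (Some i) M) \<longleftrightarrow> i \<in> {1..r} \<and> M = {#}"
  "pwf r (PN None M) \<longleftrightarrow> (\<forall>T\<in>#M. pwf r T) \<and> size M \<ge> 2"
  by (subst pwf.simps; auto)+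

section \<open>Labelled ordered trees\<close>

datatype 'v ltree = LT (root: 'v) (kind: "nat option") (kids: "'v ltree list")

fun vcell :: "'v \<Rightarrow> nat option \<Rightarrow> 'v cell" where
  "vcell v None = Internal v"
| "vcell v (Some i) = External v i"

text \<open>Each child occupies one contiguous block, its stem followed by its body, of total degree
  \<open>pdegree\<close>. Reordering siblings is then an exchange of blocks.\<close>

fun body :: "'v ltree \<Rightarrow> 'v cell list" where
  "body (LT v k ts) = vcell v k # concat (map (\<lambda>t. Edge v (root t) # body t) ts)"

abbreviation stem :: "'v \<Rightarrow> 'v ltree \<Rightarrow> 'v cell list" where
  "stem v t \<equiv> Edge v (root t) # body t"

fun labs :: "'v ltree \<Rightarrow> 'v list" where
  "labs (LT v k ts) = v # concat (map labs ts)"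

fun shape :: "'v ltree \<Rightarrow> ptree" where
  "shape (LT v k ts) = PN k (mset (map shape ts))"

text \<open>The sign of sorting all lists of siblings by shape. Equal siblings in a good tree are
  even, so their relative order does not matter.\<close>

fun osign :: "(nat \<Rightarrow> nat) \<Rightarrow> nat \<Rightarrow> 'v ltree \<Rightarrow> rat" where
  "osign m d (LT v k ts) =
     inversion_sign lt0 (podd m d) (map shape ts) * prod_list (map (osign m d) ts)"

lemma set_labs: "set (labs t) = set_ltree t"
  by (induction t) auto

lemma root_in_labs [simp]: "root t \<in> set (labs t)"
  by (cases t) auto

lemma height_shape_child: "c \<in> set ts \<Longrightarrow> height (shape c) < height (shape (LT v k ts))"
  using height_child[of "shape c" "mset (map shape ts)" k] by simp

lemma labs_disjoint:
  "distinct (concat (map labs ts)) \<Longrightarrow> t \<in> set ts \<Longrightarrow> u \<in> set ts \<Longrightarrow> t \<noteq> u \<Longrightarrow>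
    set (labs t) \<inter> set (labs u) = {}"
  by (induction ts) auto

lemma distinct_roots: "distinct (concat (map labs ts)) \<Longrightarrow> distinct (map root ts)"
proof (induction ts)
  case (Cons t ts)
  have "root t \<noteq> root u" if "u \<in> set ts" for u
  proof -
    have "root u \<in> set (concat (map labs ts))" using that by (auto intro!: bexI[of _ u])
    moreover have "root t \<notin> set (concat (map labs ts))"
      using Cons.prems root_in_labs[of t] unfolding concat.simps list.map distinct_append by blast
    ultimately show ?thesis by metis
  qed
  then show ?case using Cons by auto
qed simp

lemma labs_map [simp]: "labs (map_ltree f t) = map f (labs t)"
  by (induction t) (auto simp: map_concat intro!: arg_cong[of _ _ concat])

lemma root_map [simp]: "root (map_ltree f t) = f (root t)"
  by (cases t) auto

lemma shape_map [simp]: "shape (map_ltree f t) = shape t"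
proof (induction t)
  case (LT v k ts)
  then have "map (shape \<circ> map_ltree f) ts = map shape ts" by (intro map_cong) auto
  then show ?case by (simp only: ltree.map shape.simps map_map)
qed

lemma osign_map [simp]: "osign m d (map_ltree f t) = osign m d t"
proof (induction t)
  case (LT v k ts)
  then have "map (osign m d \<circ> map_ltree f) ts = map (osign m d) ts" by (intro map_cong) auto
  moreover have "map (shape \<circ> map_ltree f) ts = map shape ts" by (intro map_cong) auto
  ultimately show ?case by (simp only: ltree.map osign.simps map_map)
qed

lemma map_vcell [simp]: "map_cell f (vcell v k) = vcell (f v) k"
  by (cases k) auto

lemma body_map [simp]: "body (map_ltree f t) = map (map_cell f) (body t)"
  by (induction t) (auto simp: map_concat intro!: arg_cong[of _ _ concat])

lemma map_ltree_cong: "(\<And>x. x \<in> set (labs t) \<Longrightarrow> f x = g x) \<Longrightarrow> map_ltree f t = map_ltree g t"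
  by (rule ltree.map_cong) (auto simp: set_labs)

lemma cell_degree_vcell [simp]: "cell_degree m d (vcell v k) = kind_degree m d k"
  by (cases k) auto

lemma graph_degree_stem: "graph_degree m d (stem v t) = pdegree m d (shape t)"
proof (induction t arbitrary: v)
  case (LT w k ts)
  then have "graph_degree m d (concat (map (stem w) ts)) = (\<Sum>t\<leftarrow>ts. pdegree m d (shape t))"
    by (induction ts) (auto simp: algebra_simps)
  also have "\<dots> = (\<Sum>\<^sub># (image_mset (pdegree m d) (mset (map shape ts))))"
    by (simp add: sum_mset_sum_list[symmetric] image_mset.compositionality o_def flip: mset_map)
  finally show ?case by simp
qed

lemma osign_square [simp]: "osign m d t * osign m d t = 1"
proof (induction t)
  case (LT v k ts)
  then have "prod_list (map (osign m d) ts) * prod_list (map (osign m d) ts) = 1"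
  proof (induction ts)
    case (Cons t ts)
    have "prod_list (map (osign m d) (t # ts)) * prod_list (map (osign m d) (t # ts)) =
      (osign m d t * osign m d t) * (prod_list (map (osign m d) ts) * prod_list (map (osign m d) ts))"
      by simp
    then show ?case using Cons by simp
  qed simp
  then show ?case by (simp add: mult_ac)
qed

text \<open>
  \<open>treq m d t t'\<close> expresses that \<open>t'\<close> arises from \<open>t\<close> by reordering siblings, with the expected sign.
\<close>

definition treq :: "(nat \<Rightarrow> nat) \<Rightarrow> nat \<Rightarrow> 'v ltree \<Rightarrow> 'v ltree \<Rightarrow> bool" where
  "treq m d t t' \<longleftrightarrow> root t = root t' \<and> shape t = shape t' \<and>
     (\<exists>e. orel m d (body t) e (body t') \<and>
        (pgood m d (shape t) \<longrightarrow> e = osign m d t * osign m d t'))"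

lemma treq_children:
  assumes "list_all2 (treq m d) ts us"
  shows "\<exists>e. orel m d (concat (map (stem v) ts)) e (concat (map (stem v) us)) \<and>
     ((\<forall>t\<in>set ts. pgood m d (shape t)) \<longrightarrow>
        e = prod_list (map (osign m d) ts) * prod_list (map (osign m d) us))"
  using assms
proof (induction rule: list_all2_induct)
  case Nil
  show ?case using orel.start by fastforce
next
  case (Cons t ts u us)
  then obtain e where e: "orel m d (concat (map (stem v) ts)) e (concat (map (stem v) us))"
    "(\<forall>t\<in>set ts. pgood m d (shape t)) \<Longrightarrow>
        e = prod_list (map (osign m d) ts) * prod_list (map (osign m d) us)" by blast
  from Cons.hyps obtain e' where e': "root t = root u" "orel m d (body t) e' (body u)"
    "pgood m d (shape t) \<Longrightarrow> e' = osign m d t * osign m d u"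
    unfolding treq_def by blast
  have "orel m d (stem v t) e' (stem v u)"
    using orel_Cons[OF e'(2)] e'(1) by simp
  from orel_append[OF this e(1)] show ?case
    using e(2) e'(3) by (intro exI[of _ "e' * e"]) (auto simp: mult_ac)
qed

lemma permute_children:
  assumes "mset us = mset ts"
  shows "\<exists>e. orel m d (concat (map (stem v) us)) e (concat (map (stem v) ts)) \<and>
     (no_odd_repeat (podd m d) (mset (map shape us)) \<longrightarrow>
        e = inversion_sign lt0 (podd m d) (map shape us) * inversion_sign lt0 (podd m d) (map shape ts))"
proof -
  let ?od = "\<lambda>t. podd m d (shape t)"
  obtain e where e: "kperm ?od us e ts" using mset_eq_kperm[OF assms] by blast
  have "?od t = odd_list m d (stem v t)" for t
    unfolding odd_list_def graph_degree_stem ..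
  from kperm_orel_concat[OF e this] have "orel m d (concat (map (stem v) us)) e (concat (map (stem v) ts))" .
  moreover have "no_odd_repeat (podd m d) (mset (map shape us)) \<longrightarrow>
      e = inversion_sign lt0 (podd m d) (map shape us) * inversion_sign lt0 (podd m d) (map shape ts)"
    using kperm_inversion_sign[where g = shape and od = "podd m d", OF tournament_lt0 e] by blast
  ultimately show ?thesis by blast
qed

text \<open>The intermediate list \<open>us\<close> drops out of the sign: entry by entry its shapes
  are those of \<open>ts\<close>, and as a multiset it is \<open>ts'\<close>.\<close>

lemma treq_node:
  assumes all2: "list_all2 (treq m d) ts us" and mset: "mset us = mset ts'"
  shows "treq m d (LT v k ts) (LT v k ts')"
proof -
  obtain e where e: "orel m d (concat (map (stem v) ts)) e (concat (map (stem v) us))"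
    "(\<forall>t\<in>set ts. pgood m d (shape t)) \<Longrightarrow>
        e = prod_list (map (osign m d) ts) * prod_list (map (osign m d) us)"
    using treq_children[OF all2] by blast
  obtain e' where e': "orel m d (concat (map (stem v) us)) e' (concat (map (stem v) ts'))"
    "no_odd_repeat (podd m d) (mset (map shape us)) \<Longrightarrow>
        e' = inversion_sign lt0 (podd m d) (map shape us) * inversion_sign lt0 (podd m d) (map shape ts')"
    using permute_children[OF mset] by blast
  have sh: "map shape us = map shape ts"
    using all2 by (induction rule: list_all2_induct) (auto simp: treq_def)
  have pr: "prod_list (map (osign m d) us) = prod_list (map (osign m d) ts')"
    using mset by (metis mset_map prod_mset_prod_list)
  have "mset (map shape ts) = mset (map shape ts')" using sh mset by (metis mset_map)
  then have "shape (LT v k ts) = shape (LT v k ts')" by (simp del: mset_map)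
  moreover have "orel m d (body (LT v k ts)) (e * e') (body (LT v k ts'))"
    using orel_Cons[OF orel_trans[OF e'(1) e(1)]] by simp
  moreover have "e * e' = osign m d (LT v k ts) * osign m d (LT v k ts')"
    if "pgood m d (shape (LT v k ts))"
  proof -
    have "e = prod_list (map (osign m d) ts) * prod_list (map (osign m d) us)"
      using that e(2) by simp
    moreover have "e' = inversion_sign lt0 (podd m d) (map shape us) * inversion_sign lt0 (podd m d) (map shape ts')"
      using that e'(2) sh by simp
    ultimately show ?thesis using sh pr by (simp add: mult_ac)
  qed
  ultimately show ?thesis unfolding treq_def by auto
qed

lemma mset_map_eq_imp:
  "mset (map f xs) = mset ys \<Longrightarrow> \<exists>us. mset us = mset xs \<and> map f us = ys"
proof (induction ys arbitrary: xs)
  case (Cons y ys)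
  then have "y \<in> set (map f xs)" by (metis list.set_intros(1) set_mset_mset)
  then obtain x where x: "x \<in> set xs" "y = f x" by auto
  then have "mset (map f (remove1 x xs)) = mset ys"
    using Cons.prems by (simp add: image_mset_Diff)
  from Cons.IH[OF this] obtain us where "mset us = mset (remove1 x xs)" "map f us = ys" by blast
  then show ?case using x by (intro exI[of _ "x # us"]) auto
qed simp

text \<open>The maps for the single children are glued. The result is injective because the label
  sets are disjoint on both sides.\<close>

lemma relabel_children:
  assumes "list_all2 (\<lambda>t u. \<exists>f. inj_on f (set (labs t)) \<and> f ` set (labs t) = set (labs u) \<and>
      treq m d (map_ltree f t) u) ts us"
    "distinct (concat (map labs ts))" "distinct (concat (map labs us))"
  shows "\<exists>f. inj_on f (set (concat (map labs ts))) \<and>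
      f ` set (concat (map labs ts)) = set (concat (map labs us)) \<and>
      list_all2 (treq m d) (map (map_ltree f) ts) us"
  using assms
proof (induction rule: list_all2_induct)
  case (Cons t ts u us)
  from Cons.hyps obtain f where f: "inj_on f (set (labs t))" "f ` set (labs t) = set (labs u)"
    "treq m d (map_ltree f t) u" by blast
  from Cons obtain g where g: "inj_on g (set (concat (map labs ts)))"
    "g ` set (concat (map labs ts)) = set (concat (map labs us))"
    "list_all2 (treq m d) (map (map_ltree g) ts) us" by auto
  define h where "h x = (if x \<in> set (labs t) then f x else g x)" for x
  have disj: "set (labs t) \<inter> set (concat (map labs ts)) = {}"
    "set (labs u) \<inter> set (concat (map labs us)) = {}" using Cons.prems by auto
  have ht: "h x = f x" if "x \<in> set (labs t)" for x using that by (simp add: h_def)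
  have hts: "h x = g x" if "x \<in> set (concat (map labs ts))" for x using that disj by (auto simp: h_def)
  have 1: "inj_on h (set (labs t))" "inj_on h (set (concat (map labs ts)))"
    using f(1) g(1) inj_on_cong[of "set (labs t)" h f] ht
      inj_on_cong[of "set (concat (map labs ts))" h g] hts by blast+
  have 2: "h ` set (labs t) = set (labs u)" "h ` set (concat (map labs ts)) = set (concat (map labs us))"
    using f(2) g(2) ht hts by (metis image_cong)+
  have *: "inj_on h (set (labs t) \<union> set (concat (map labs ts)))"
    using 1 2 disj by (subst inj_on_Un) blast
  have **:
    "h ` (set (labs t) \<union> set (concat (map labs ts))) = set (labs u) \<union> set (concat (map labs us))"
    using 2 by (simp_all add: image_Un)
  have "map_ltree h t = map_ltree f t" using ht by (rule map_ltree_cong)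
  moreover have "map (map_ltree h) ts = map (map_ltree g) ts"
    using hts by (intro map_cong refl map_ltree_cong) auto
  ultimately have "list_all2 (treq m d) (map (map_ltree h) (t # ts)) (u # us)"
    using f(3) g(3) by (simp only: list.map list_all2_Cons)
  with * ** show ?case by (intro exI[of _ h]) simp
qed auto

text \<open>The children of \<open>t'\<close> are rearranged into a list \<open>us\<close> that
  matches \<open>ts\<close> shape by shape; then the induction hypothesis applies to each
  pair.\<close>

lemma relabel_tree:
  "shape t = shape t' \<Longrightarrow> distinct (labs t) \<Longrightarrow> distinct (labs t') \<Longrightarrow>
    \<exists>f. inj_on f (set (labs t)) \<and> f ` set (labs t) = set (labs t') \<and> treq m d (map_ltree f t) t'"
proof (induction t arbitrary: t')
  case (LT v k ts)
  obtain v' ts' where t': "t' = LT v' k ts'" using LT.prems by (cases t') auto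
  have "mset (map shape ts') = mset (map shape ts)" using LT.prems t' by simp
  then obtain us where us: "mset us = mset ts'" "map shape us = map shape ts"
    using mset_map_eq_imp by blast
  have "mset (map labs us) = mset (map labs ts')" using us(1) by (metis mset_map)
  then have "mset (concat (map labs us)) = mset (concat (map labs ts'))"
    by (metis mset_concat sum_mset_sum_list mset_map)
  then have c: "distinct (concat (map labs us))" "set (concat (map labs us)) = set (concat (map labs ts'))"
    using LT.prems t' mset_eq_imp_distinct_iff mset_eq_setD by (fastforce, blast)
  have len: "length ts = length us" using us(2) by (metis length_map)
  have "list_all2 (\<lambda>t u. \<exists>f. inj_on f (set (labs t)) \<and> f ` set (labs t) = set (labs u) \<and>
      treq m d (map_ltree f t) u) ts us"
  proof (rule list_all2_all_nthI[OF len])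
    fix i assume i: "i < length ts"
    have "shape (ts ! i) = shape (us ! i)" using us(2) i len by (metis nth_map)
    moreover have "distinct (labs (ts ! i))" using LT.prems i by (auto simp: distinct_concat_iff)
    moreover have "distinct (labs (us ! i))" using c i len by (auto simp: distinct_concat_iff)
    ultimately show "\<exists>f. inj_on f (set (labs (ts ! i))) \<and> f ` set (labs (ts ! i)) = set (labs (us ! i)) \<and>
      treq m d (map_ltree f (ts ! i)) (us ! i)" using LT.IH i by simp
  qed
  from relabel_children[OF this _ c(1)] LT.prems obtain f where f:
    "inj_on f (set (concat (map labs ts)))"
    "f ` set (concat (map labs ts)) = set (concat (map labs us))"
    "list_all2 (treq m d) (map (map_ltree f) ts) us" by auto
  define h where "h = f(v := v')"
  have v: "v \<notin> set (concat (map labs ts))" "v' \<notin> set (concat (map labs ts'))" using LT.prems t' by auto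
  have hf: "h x = f x" if "x \<in> set (concat (map labs ts))" for x using that v(1) by (auto simp: h_def)
  have "map (map_ltree h) ts = map (map_ltree f) ts"
    using hf by (intro map_cong refl map_ltree_cong) auto
  then have tr: "treq m d (map_ltree h (LT v k ts)) t'"
    using treq_node[OF f(3) us(1), of v' k] t' by (simp only: ltree.map) (simp add: h_def)
  have img: "h ` set (concat (map labs ts)) = set (concat (map labs ts'))"
    using f(2) c(2) hf by (metis image_cong)
  have "inj_on h (set (concat (map labs ts)))" using f(1) hf by (metis inj_on_cong)
  then have "inj_on h (set (labs (LT v k ts)))"
    using img v by (auto simp: h_def)
  moreover have "h ` set (labs (LT v k ts)) = set (labs t')"
    unfolding t' labs.simps list.set image_insert img by (simp add: h_def)
  ultimately show ?case using tr by blast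
qed

section \<open>Branches and the centre of a tree\<close>

lemma root_in_concat: "u \<in> set ts \<Longrightarrow> root u \<in> set (concat (map labs ts))"
  by (auto intro!: bexI[of _ u])

definition adj :: "'v cell list \<Rightarrow> 'v \<Rightarrow> 'v \<Rightarrow> bool" where
  "adj G v w \<longleftrightarrow> Edge v w \<in> set G \<or> Edge w v \<in> set G"

lemma adj_sym: "adj G v w \<Longrightarrow> adj G w v"
  by (auto simp: adj_def)

definition unique_kinds :: "'v cell list \<Rightarrow> bool" where
  "unique_kinds G \<longleftrightarrow> (\<forall>v k k'. vcell v k \<in> set G \<longrightarrow> vcell v k' \<in> set G \<longrightarrow> k = k')"

text \<open>
  \<open>branch G p t\<close>: the part of the graph \<open>G\<close> that is seen from \<open>p\<close> through its neighbour \<open>root t\<close>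
  is the tree \<open>t\<close>.
\<close>

fun branch :: "'v cell list \<Rightarrow> 'v \<Rightarrow> 'v ltree \<Rightarrow> bool" where
  "branch G p (LT v k ts) \<longleftrightarrow> vcell v k \<in> set G \<and> distinct (p # map root ts) \<and>
     {w. adj G v w} = insert p (root ` set ts) \<and> (\<forall>t\<in>set ts. branch G v t)"

text \<open>As \<open>branch\<close>, but without a parent: all of the connected graph as seen from
  \<open>v\<close>.\<close>

definition whole :: "'v cell list \<Rightarrow> 'v \<Rightarrow> nat option \<Rightarrow> 'v ltree list \<Rightarrow> bool" where
  "whole G v k ts \<longleftrightarrow> vcell v k \<in> set G \<and> distinct (map root ts) \<and>
     {w. adj G v w} = root ` set ts \<and> (\<forall>t\<in>set ts. branch G v t)"

text \<open>Within one graph the children of a vertex are recognized by their root labels, so these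
  determine how the two lists correspond.\<close>

lemma treq_matching:
  assumes roots: "root ` set ts = root ` set ts'" "distinct (map root ts)" "distinct (map root ts')"
    and treq: "\<And>t u. t \<in> set ts \<Longrightarrow> u \<in> set ts' \<Longrightarrow> root t = root u \<Longrightarrow> treq m d t u"
  shows "\<exists>us. list_all2 (treq m d) ts us \<and> mset us = mset ts'"
proof -
  define match where "match t = (SOME u. u \<in> set ts' \<and> root t = root u)" for t
  have match: "match t \<in> set ts'" "root t = root (match t)" if "t \<in> set ts" for t
  proof -
    have "\<exists>u. u \<in> set ts' \<and> root t = root u" using that roots(1) by (metis imageE imageI)
    from someI_ex[OF this] show "match t \<in> set ts'" "root t = root (match t)"
      by (auto simp: match_def)
  qed
  have "map root (map match ts) = map root ts" using match by auto
  then have dis: "distinct (map root (map match ts))" using roots(2) by (simp only:)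
  then have "distinct (map match ts)" using distinct_map by blast
  moreover have "distinct ts'" using roots(3) distinct_map by blast
  moreover have "set (map match ts) = set ts'"
  proof (intro equalityI subsetI)
    fix u assume u: "u \<in> set ts'"
    then obtain t where t: "t \<in> set ts" "root u = root t" using roots(1) by (metis imageE imageI)
    then have "match t = u" using match[OF t(1)] roots(3) u by (metis distinct_map inj_onD)
    with t show "u \<in> set (map match ts)" by auto
  qed (use match in auto)
  ultimately have "mset (map match ts) = mset ts'" by (metis set_eq_iff_mset_eq_distinct)
  moreover have "list_all2 (treq m d) ts (map match ts)"
    using match treq by (auto simp: list_all2_conv_all_nth)
  ultimately show ?thesis by blast
qed

text \<open>The neighbours of a vertex other than its parent are the roots of its children in either
  tree. Hence the graph determines a branch up to the order of siblings.\<close>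

lemma branch_treq:
  "unique_kinds G \<Longrightarrow> branch G p t \<Longrightarrow> branch G p t' \<Longrightarrow> root t = root t' \<Longrightarrow> treq m d t t'"
proof (induction t arbitrary: p t')
  case (LT v k ts)
  obtain k' ts' where t': "t' = LT v k' ts'" using LT.prems by (cases t') auto
  have "k' = k" using LT.prems t' unfolding unique_kinds_def by auto
  have "insert p (root ` set ts) = insert p (root ` set ts')" "p \<notin> root ` set ts" "p \<notin> root ` set ts'"
    using LT.prems t' by auto
  then have "root ` set ts = root ` set ts'" by (metis insert_ident)
  then obtain us where "list_all2 (treq m d) ts us" "mset us = mset ts'"
    using treq_matching[of ts ts' m d] LT t' by fastforce
  then show ?case unfolding t' \<open>k' = k\<close> by (rule treq_node)
qed

lemma whole_treq:
  assumes "unique_kinds G" "whole G v k ts" "whole G v k' ts'"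
  shows "treq m d (LT v k ts) (LT v k' ts')"
proof -
  have "k' = k" using assms unfolding unique_kinds_def whole_def by auto
  obtain us where "list_all2 (treq m d) ts us" "mset us = mset ts'"
    using treq_matching[of ts ts' m d] branch_treq assms unfolding whole_def by metis
  then show ?thesis unfolding \<open>k' = k\<close> by (rule treq_node)
qed

text \<open>The maximal height is attained by two branches, so the vertex is the midpoint of the
  longest paths, which have even length.\<close>

definition two_max :: "ptree multiset \<Rightarrow> bool" where
  "two_max M \<longleftrightarrow> (\<exists>h. (\<forall>T\<in>#M. height T \<le> h) \<and> size (filter_mset (\<lambda>T. height T = h) M) \<ge> 2)"

definition vertex_centre :: "'v cell list \<Rightarrow> 'v \<Rightarrow> bool" where
  "vertex_centre G v \<longleftrightarrow> (\<exists>k ts. whole G v k ts \<and> two_max (mset (map shape ts)))"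

text \<open>The case of longest paths of odd length, of which this is the middle edge.\<close>

definition edge_centre :: "'v cell list \<Rightarrow> 'v \<Rightarrow> 'v \<Rightarrow> bool" where
  "edge_centre G v w \<longleftrightarrow> (\<exists>t u. root t = v \<and> root u = w \<and> branch G w t \<and> branch G v u \<and>
     height (shape t) = height (shape u))"

lemma edge_centre_sym: "edge_centre G v w \<Longrightarrow> edge_centre G w v"
  unfolding edge_centre_def by metis

lemma edge_centre_adj: "edge_centre G v w \<Longrightarrow> adj G v w"
  unfolding edge_centre_def by (metis adj_sym branch.simps insertI1 ltree.exhaust ltree.sel(1) mem_Collect_eq)

lemma two_max_unique:
  assumes "two_max (mset (map shape ts))" "t \<in> set ts" "distinct ts"
  shows "\<exists>u\<in>set ts. u \<noteq> t \<and> height (shape t) \<le> height (shape u)"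
proof (rule ccontr)
  assume *: "\<not> ?thesis"
  obtain h where h: "\<forall>u\<in>set ts. height (shape u) \<le> h"
    "size (filter_mset (\<lambda>T. height T = h) (mset (map shape ts))) \<ge> 2"
    using assms(1) by (auto simp: two_max_def)
  have "filter (\<lambda>u. height (shape u) = h) ts = filter (\<lambda>u. u = t \<and> height (shape t) = h) ts"
    using * h(1) assms(2) by (intro filter_cong) force+
  moreover have "length (filter (\<lambda>u. u = t \<and> height (shape t) = h) ts) \<le> 1"
  proof -
    have "length (filter (\<lambda>u. u = t \<and> height (shape t) = h) ts) \<le> length (filter ((=) t) ts)"
      by (induction ts) auto
    also have "\<dots> = count_list ts t" by (simp add: count_list_eq_length_filter)
    also have "\<dots> \<le> 1" using assms(3) by (simp add: distinct_count_atmost_1 count_mset)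
    finally show ?thesis .
  qed
  moreover have "size (filter_mset (\<lambda>T. height T = h) (mset (map shape ts))) =
      length (filter (\<lambda>u. height (shape u) = h) ts)"
    by (simp add: filter_mset_image_mset flip: mset_filter)
  ultimately show False using h(2) by simp
qed

text \<open>Rerooting: behind the edge from \<open>root t\<close> to \<open>v\<close> lies the tree
  at \<open>v\<close> with \<open>t\<close> removed.\<close>

lemma branch_sibling:
  assumes "whole G v k ts" "t \<in> set ts"
  shows "branch G (root t) (LT v k (remove1 t ts))"
proof -
  have dis: "distinct (map root ts)" using assms by (simp add: whole_def)
  then have d: "distinct ts" "inj_on root (set ts)" by (simp_all add: distinct_map)
  have s: "set (remove1 t ts) = set ts - {t}" using d by simp
  have "root ` set ts = insert (root t) (root ` set (remove1 t ts))"
    using assms(2) s by auto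
  moreover have "root t \<notin> root ` set (remove1 t ts)"
    unfolding s using d(2) assms(2) by (auto dest: inj_onD)
  ultimately show ?thesis
    using assms dis s by (auto simp: whole_def distinct_map inj_on_subset)
qed

lemma branch_whole:
  assumes "branch G p (LT v k ts)" "branch G v u" "root u = p"
  shows "whole G v k (u # ts)"
  using assms by (auto simp: whole_def)

text \<open>
  Across an edge that points away from a centre the part behind is at least as high as the part
  ahead, and this persists further away, so that there is no second centre.
\<close>

lemma no_centre_beyond:
  assumes "unique_kinds G" "branch G a t" "branch G (root t) t'" "root t' = a"
    "height (shape t) \<le> height (shape t')" "x \<in> set (labs t)"
  shows "\<not> vertex_centre G x \<and>
     (edge_centre G x y \<longrightarrow> x = root t \<and> y = a \<and> height (shape t) = height (shape t'))"
  using assms(2-)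
proof (induction t arbitrary: a t' x y)
  case (LT b k ts)
  note uk = assms(1)
  let ?us = "t' # ts"
  have w: "whole G b k ?us" using branch_whole[OF LT.prems(1), of t'] LT.prems by simp
  have low: "height (shape c) < height (shape t')" if "c \<in> set ts" for c
    using height_shape_child[OF that, of b k] LT.prems(4) by simp
  have sib: "branch G (root c) (LT b k (remove1 c ?us))" if "c \<in> set ts" for c
    using branch_sibling[OF w, of c] that by auto
  \<comment> \<open>Behind \<open>c\<close> lies \<open>t'\<close>, which is higher than every
    branch in \<open>ts\<close>. The inequality is thus strict from here on, which excludes edge
    centres further away.\<close>
  have tall: "height (shape c) < height (shape (LT b k (remove1 c ?us)))" if "c \<in> set ts" for c
  proof -
    have "c \<noteq> t'" using low that by auto
    then have "height (shape t') < height (shape (LT b k (remove1 c ?us)))"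
      by (intro height_shape_child) simp
    with low[OF that] show ?thesis by simp
  qed
  have child: "\<not> vertex_centre G x \<and> \<not> edge_centre G x y" if "c \<in> set ts" "x \<in> set (labs c)" for c x y
  proof -
    have "branch G b c" using that LT.prems by simp
    then have "\<not> vertex_centre G x \<and> (edge_centre G x y \<longrightarrow> x = root c \<and> y = b \<and>
        height (shape c) = height (shape (LT b k (remove1 c ?us))))"
      using LT.IH[OF that(1) _ sib[OF that(1)] _ _ that(2)] tall[OF that(1)] by simp
    then show ?thesis using tall[OF that(1)] by auto
  qed
  show ?case
  proof (cases "x = b")
    case False
    then obtain c where "c \<in> set ts" "x \<in> set (labs c)" using LT.prems(5) by auto
    then show ?thesis using child by blast
  next
    case True
    have "\<not> vertex_centre G b"
    proof
      assume "vertex_centre G b"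
      then obtain k' us where us: "whole G b k' us" "two_max (mset (map shape us))"
        by (auto simp: vertex_centre_def)
      \<comment> \<open>Only the equality of shapes is wanted, so the degree data are set to
        0.\<close>
      have "treq (\<lambda>_. 0) 0 (LT b k' us) (LT b k ?us)" by (rule whole_treq[OF uk us(1) w])
      then have "mset (map shape us) = mset (map shape ?us)" by (simp add: treq_def del: mset_map)
      then have tm: "two_max (mset (map shape ?us))" using us(2) by simp
      have "distinct ?us" using w by (auto simp: whole_def distinct_map)
      from two_max_unique[OF tm _ this, of t'] obtain u
        where "u \<in> set ?us" "u \<noteq> t'" "height (shape t') \<le> height (shape u)" by auto
      with low[of u] show False by simp
    qed
    moreover have "y = a \<and> height (shape (LT b k ts)) = height (shape t')" if ec: "edge_centre G b y"
    proof -
      have "y \<in> root ` set ?us" using edge_centre_adj[OF ec] w by (auto simp: whole_def)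
      moreover have "y \<noteq> root c" if "c \<in> set ts" for c
        using child[OF that, of "root c" b] edge_centre_sym[OF ec] by auto
      ultimately have y: "y = a" using LT.prems(3) by auto
      obtain t1 t2 where t12: "root t1 = b" "root t2 = a" "branch G a t1" "branch G b t2"
        "height (shape t1) = height (shape t2)" using ec y by (auto simp: edge_centre_def)
      have "treq (\<lambda>_. 0) 0 t1 (LT b k ts)" using branch_treq[OF uk t12(3) LT.prems(1)] t12 by simp
      moreover have "treq (\<lambda>_. 0) 0 t2 t'" using branch_treq[OF uk t12(4)] t12 LT.prems by simp
      ultimately show ?thesis using t12 y by (simp add: treq_def)
    qed
    ultimately show ?thesis using True by simp
  qed
qed

text \<open>Each branch \<open>t\<close> has a sibling at least as high, so the part behind it is
  strictly higher than \<open>t\<close> and \<open>no_centre_beyond\<close> applies to every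
  branch.\<close>

lemma vertex_centre_unique:
  assumes "unique_kinds G" "whole G v k ts" "two_max (mset (map shape ts))" "x \<in> set (labs (LT v k ts))"
  shows "\<not> edge_centre G x y" "vertex_centre G x \<Longrightarrow> x = v"
proof -
  have dis: "distinct ts" using assms(2) by (auto simp: whole_def distinct_map)
  have sub: "\<not> vertex_centre G x \<and> \<not> edge_centre G x y" if t: "t \<in> set ts" and x: "x \<in> set (labs t)" for t x y
  proof -
    have b: "branch G v t" "branch G (root t) (LT v k (remove1 t ts))"
      using branch_sibling[OF assms(2) t] t assms(2) by (auto simp: whole_def)
    obtain u where "u \<in> set ts" "u \<noteq> t" "height (shape t) \<le> height (shape u)"
      using two_max_unique[OF assms(3) t dis] by blast
    moreover from this have "height (shape u) < height (shape (LT v k (remove1 t ts)))"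
      by (intro height_shape_child) simp
    ultimately show ?thesis
      using no_centre_beyond[OF assms(1) b _ _ x, of y] by auto
  qed
  show "vertex_centre G x \<Longrightarrow> x = v" using sub assms(4) by auto
  show "\<not> edge_centre G x y"
  proof
    assume ec: "edge_centre G x y"
    with sub assms(4) have "x = v" by auto
    with edge_centre_adj[OF ec] assms(2) obtain t where "t \<in> set ts" "y = root t"
      by (auto simp: whole_def)
    with sub[of t y x] edge_centre_sym[OF ec] show False by auto
  qed
qed

lemma edge_centre_unique:
  assumes "unique_kinds G" "branch G (root u) t" "branch G (root t) u" "height (shape t) = height (shape u)"
    "x \<in> set (labs t) \<union> set (labs u)"
  shows "\<not> vertex_centre G x"
    "edge_centre G x y \<Longrightarrow> (x = root t \<and> y = root u) \<or> (x = root u \<and> y = root t)"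
  using no_centre_beyond[OF assms(1,2,3) HOL.refl, of x y] no_centre_beyond[OF assms(1,3,2) HOL.refl, of x y] assms(4,5)
  by auto

section \<open>Branches of the graph listed by a labelled tree\<close>

lemma adj_append [simp]: "adj (A @ B) x y \<longleftrightarrow> adj A x y \<or> adj B x y"
  by (auto simp: adj_def)

lemma adj_Nil [simp]: "\<not> adj [] x y"
  by (auto simp: adj_def)

lemma adj_Cons [simp]:
  "adj (Edge v w # A) x y \<longleftrightarrow> (x = v \<and> y = w) \<or> (x = w \<and> y = v) \<or> adj A x y"
  "adj (Internal v # A) x y \<longleftrightarrow> adj A x y"
  "adj (External v i # A) x y \<longleftrightarrow> adj A x y"
  by (auto simp: adj_def)

lemma adj_vcell [simp]: "adj (vcell v k # A) x y \<longleftrightarrow> adj A x y"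
  by (cases k) auto

lemma adj_concat [simp]: "adj (concat (map f ts)) x y \<longleftrightarrow> (\<exists>t\<in>set ts. adj (f t) x y)"
  by (induction ts) auto

lemma adj_body: "adj (body t) x y \<Longrightarrow> x \<in> set (labs t) \<and> y \<in> set (labs t)"
  by (induction t) (auto, (metis root_in_labs)+)

lemma adj_root:
  assumes "distinct (labs (LT v k ts))"
  shows "adj (body (LT v k ts)) v y \<longleftrightarrow> y \<in> root ` set ts"
proof -
  have "\<not> adj (body t) v y" "v \<noteq> root t" if "t \<in> set ts" for t
    using adj_body[of t v y] root_in_concat[OF that] assms that by auto
  then show ?thesis by auto
qed

lemma adj_child:
  assumes "distinct (labs (LT v k ts))" "t \<in> set ts" "x \<in> set (labs t)"
  shows "adj (body (LT v k ts)) x y \<longleftrightarrow> adj (body t) x y \<or> (x = root t \<and> y = v)"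
proof -
  have "x \<noteq> v" using assms by auto
  moreover have "x \<noteq> root u" "\<not> adj (body u) x y" if "u \<in> set ts" "u \<noteq> t" for u
    using labs_disjoint[OF _ assms(2) that(1)] that(2) assms(1,3) adj_body[of u x y] by (auto simp: disjoint_iff)
  ultimately show ?thesis using assms(2) by auto
qed

text \<open>Passes from a global comparison of \<open>G\<close> with \<open>body t\<close> to the
  local conditions of \<open>branch\<close>. On the vertices of \<open>t\<close> the only additional
  adjacency is the stem from the root to \<open>p\<close>.\<close>

lemma branch_of_body:
  "distinct (labs t) \<Longrightarrow> p \<notin> set (labs t) \<Longrightarrow>
   (\<And>v k. vcell v k \<in> set (body t) \<Longrightarrow> vcell v k \<in> set G) \<Longrightarrow>
   (\<And>x y. x \<in> set (labs t) \<Longrightarrow> adj G x y \<longleftrightarrow> adj (body t) x y \<or> (x = root t \<and> y = p)) \<Longrightarrow>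
   branch G p t"
proof (induction t arbitrary: p)
  case (LT v k ts)
  have dis: "distinct (concat (map labs ts))" "v \<notin> set (concat (map labs ts))" using LT.prems(1) by auto
  have "{w. adj G v w} = insert p (root ` set ts)"
    using LT.prems(4)[of v] adj_root[OF LT.prems(1)] by auto
  moreover have "branch G v t" if t: "t \<in> set ts" for t
  proof (rule LT.IH[OF t])
    show "distinct (labs t)" using dis(1) t by (auto simp: distinct_concat_iff)
    show "v \<notin> set (labs t)" using dis(2) t by auto
    show "vcell w k' \<in> set G" if "vcell w k' \<in> set (body t)" for w k'
      using LT.prems(3)[of w k'] that t by auto
    show "adj G x y \<longleftrightarrow> adj (body t) x y \<or> (x = root t \<and> y = v)" if x: "x \<in> set (labs t)" for x y
      using LT.prems(4)[of x y] adj_child[OF LT.prems(1) t x, of y] x t dis(2) by auto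
  qed
  moreover have "p \<notin> root ` set ts"
    using LT.prems(2) root_in_concat unfolding labs.simps by (metis imageE list.set_intros(2))
  ultimately show ?case using distinct_roots[OF dis(1)] LT.prems(3)[of v k] by auto
qed

lemma whole_of_body:
  assumes "distinct (labs (LT v k ts))"
    "\<And>w k'. vcell w k' \<in> set (body (LT v k ts)) \<Longrightarrow> vcell w k' \<in> set G"
    "\<And>x y. adj G x y \<longleftrightarrow> adj (body (LT v k ts)) x y"
  shows "whole G v k ts"
proof -
  have dis: "distinct (concat (map labs ts))" "v \<notin> set (concat (map labs ts))" using assms(1) by auto
  have "branch G v t" if t: "t \<in> set ts" for t
  proof (rule branch_of_body)
    show "distinct (labs t)" using dis(1) t by (auto simp: distinct_concat_iff)
    show "v \<notin> set (labs t)" using dis(2) t by auto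
    show "vcell w k' \<in> set G" if "vcell w k' \<in> set (body t)" for w k'
      using assms(2)[of w k'] that t by auto
    show "adj G x y \<longleftrightarrow> adj (body t) x y \<or> (x = root t \<and> y = v)" if "x \<in> set (labs t)" for x y
      using assms(3)[of x y] adj_child[OF assms(1) t that] by simp
  qed
  moreover have "{w. adj G v w} = root ` set ts"
    using assms(3)[of v] adj_root[OF assms(1)] by auto
  ultimately show ?thesis using distinct_roots[OF dis(1)] assms(2)[of v k] by (auto simp: whole_def)
qed

section \<open>Centred forms and presentations\<close>

datatype cform = VC "ptree multiset" | EC "ptree multiset"

text \<open>The stems account for all edges at a vertex centre, where only the centre itself is
  missing. A central edge is the stem of both halves and is subtracted once.\<close>

fun cdegree :: "(nat \<Rightarrow> nat) \<Rightarrow> nat \<Rightarrow> cform \<Rightarrow> int" where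
  "cdegree m d (VC M) = (\<Sum>\<^sub># (image_mset (pdegree m d) M)) - int d"
| "cdegree m d (EC M) = (\<Sum>\<^sub># (image_mset (pdegree m d) M)) - (int d - 1)"

text \<open>For an edge centre the parity rule is reversed: exchanging equal halves also reverses
  the central edge, and the total sign is -1 exactly when the planted halves are even, see
  \<open>swap_sign_same\<close>.\<close>

fun cgood :: "(nat \<Rightarrow> nat) \<Rightarrow> nat \<Rightarrow> cform \<Rightarrow> bool" where
  "cgood m d (VC M) \<longleftrightarrow> (\<forall>T\<in>#M. pgood m d T) \<and> no_odd_repeat (podd m d) M"
| "cgood m d (EC M) \<longleftrightarrow> (\<forall>T\<in>#M. pgood m d T) \<and> no_odd_repeat (\<lambda>T. \<not> podd m d T) M"

fun cwf :: "nat \<Rightarrow> cform \<Rightarrow> bool" where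
  "cwf r (VC M) \<longleftrightarrow> (\<forall>T\<in>#M. pwf r T) \<and> size M \<ge> 3 \<and> two_max M"
| "cwf r (EC M) \<longleftrightarrow> (\<forall>T\<in>#M. pwf r T) \<and> size M = 2 \<and> (\<forall>T\<in>#M. \<forall>U\<in>#M. height T = height U)"

abbreviation edge_body :: "'v ltree \<Rightarrow> 'v ltree \<Rightarrow> 'v cell list" where
  "edge_body t u \<equiv> Edge (root t) (root u) # body t @ body u"

definition body_odd :: "(nat \<Rightarrow> nat) \<Rightarrow> nat \<Rightarrow> ptree \<Rightarrow> bool" where
  "body_odd m d T \<longleftrightarrow> odd (pdegree m d T - (int d - 1))"

definition swap_sign :: "(nat \<Rightarrow> nat) \<Rightarrow> nat \<Rightarrow> ptree \<Rightarrow> ptree \<Rightarrow> rat" where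
  "swap_sign m d T U = (- 1) ^ d * kz (body_odd m d) T U"

text \<open>The sign of bringing the two halves into the order \<open>lt0\<close>. For equal odd
  halves the value is 1 whatever \<open>lt0 T T\<close> is.\<close>

definition esign :: "(nat \<Rightarrow> nat) \<Rightarrow> nat \<Rightarrow> ptree \<Rightarrow> ptree \<Rightarrow> rat" where
  "esign m d T U = (if lt0 T U then 1 else swap_sign m d T U)"

text \<open>The sign compares \<open>G\<close> with a listing of the tree whose siblings, or halves,
  are sorted by shape. Multiplying by \<open>osign\<close> and \<open>esign\<close> is what should
  make it independent of the chosen tree; \<open>pres_unique\<close> confirms this for good
  forms.\<close>

inductive pres :: "(nat \<Rightarrow> nat) \<Rightarrow> nat \<Rightarrow> nat \<Rightarrow> ograph \<Rightarrow> rat \<Rightarrow> cform \<Rightarrow> bool" for m d r G where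
  vertex: "distinct (labs (LT v None ts)) \<Longrightarrow> orel m d G e (body (LT v None ts)) \<Longrightarrow>
     cwf r (VC (mset (map shape ts))) \<Longrightarrow>
     pres m d r G (e * osign m d (LT v None ts)) (VC (mset (map shape ts)))"
| edge: "distinct (labs t @ labs u) \<Longrightarrow> orel m d G e (edge_body t u) \<Longrightarrow>
     cwf r (EC {#shape t, shape u#}) \<Longrightarrow>
     pres m d r G (e * (osign m d t * osign m d u * esign m d (shape t) (shape u)))
       (EC {#shape t, shape u#})"

lemma graph_degree_body: "graph_degree m d (body t) = pdegree m d (shape t) - (int d - 1)"
  using graph_degree_stem[of m d undefined t] by simp

lemma odd_list_body: "odd_list m d (body t) = body_odd m d (shape t)"
  unfolding odd_list_def body_odd_def graph_degree_body ..

lemma swap_sign_square [simp]: "swap_sign m d T U * swap_sign m d T U = 1"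
proof -
  have "swap_sign m d T U * swap_sign m d T U = ((- 1) ^ d * (- 1) ^ d) * (kz (body_odd m d) T U * kz (body_odd m d) T U)"
    unfolding swap_sign_def by (simp only: mult_ac)
  then show ?thesis by (simp flip: power_add)
qed

lemma swap_sign_commute: "swap_sign m d T U = swap_sign m d U T"
  by (simp add: swap_sign_def kz_commute)

text \<open>The exchanged bodies lack their stems, of degree \<open>d - 1\<close>. Together with the
  sign \<open>(-1)^d\<close> of the reversed edge the dependence on \<open>d\<close>
  cancels.\<close>

lemma swap_sign_same: "swap_sign m d T T = (if podd m d T then 1 else - 1)"
proof -
  have "body_odd m d T \<longleftrightarrow> (podd m d T \<longleftrightarrow> odd d)"
    unfolding body_odd_def by (simp add: even_diff_iff)
  then show ?thesis by (cases "even d"; cases "podd m d T") (simp_all only: swap_sign_def kz_def, simp_all)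
qed

lemma esign_swap:
  assumes "T \<noteq> U \<or> podd m d T"
  shows "esign m d T U = swap_sign m d T U * esign m d U T"
proof (cases "T = U")
  case True
  with assms have "podd m d U" by simp
  then have "swap_sign m d U U = 1" by (simp add: swap_sign_same)
  then show ?thesis unfolding True by simp
next
  case False
  then have "lt0 T U = (\<not> lt0 U T)"
    by (rule tournament_lt0[unfolded tournament_def, rule_format])
  then consider "lt0 T U" "\<not> lt0 U T" | "\<not> lt0 T U" "lt0 U T" by blast
  then show ?thesis
    by cases (simp_all only: esign_def if_True if_False swap_sign_commute[of m d U T] swap_sign_square mult_1_right)
qed

lemma orel_edge_swap:
  "orel m d (edge_body t u) (swap_sign m d (shape t) (shape u)) (edge_body u t)"
proof -
  have "orel m d (edge_body t u) ((- 1) ^ d) (Edge (root u) (root t) # body t @ body u)"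
    using orel_flip1[of m d "[]"] by simp
  moreover have "orel m d (Edge (root u) (root t) # body t @ body u) (kz (odd_list m d) (body t) (body u)) (edge_body u t)"
    using orel_block_swap[of m d "[Edge (root u) (root t)]" "body t" "body u" "[]"] by simp
  moreover have "kz (odd_list m d) (body t) (body u) = kz (body_odd m d) (shape t) (shape u)"
    by (simp add: kz_def odd_list_body)
  ultimately show ?thesis using orel_trans unfolding swap_sign_def by fastforce
qed

lemma orel_edge_cong:
  "treq m d t t' \<Longrightarrow> treq m d u u' \<Longrightarrow> \<exists>e. orel m d (edge_body t u) e (edge_body t' u') \<and>
     (pgood m d (shape t) \<longrightarrow> pgood m d (shape u) \<longrightarrow>
        e = osign m d t * osign m d t' * (osign m d u * osign m d u'))"
proof -
  assume "treq m d t t'" "treq m d u u'"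
  then obtain e e' where e: "orel m d (body t) e (body t')" "pgood m d (shape t) \<Longrightarrow> e = osign m d t * osign m d t'"
    "orel m d (body u) e' (body u')" "pgood m d (shape u) \<Longrightarrow> e' = osign m d u * osign m d u'"
    and r: "root t = root t'" "root u = root u'" unfolding treq_def by blast
  have "orel m d (edge_body t u) (e * e') (edge_body t' u')"
    using orel_Cons[OF orel_append[OF e(1,3)]] r by simp
  with e show ?thesis by blast
qed

section \<open>Absence of tadpoles and multiple edges, uniqueness of kinds\<close>

lemma set_cell_body: "c \<in> set (body t) \<Longrightarrow> set_cell c \<subseteq> set (labs t) \<and> set_cell c \<noteq> {}"
proof (induction t)
  case (LT v k ts)
  have "set_cell (vcell v k) = {v}" by (cases k) auto
  then show ?case using LT root_in_labs by fastforce
qed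

lemma set_cell_stem: "c \<in> set (stem v t) \<Longrightarrow> set_cell c \<subseteq> insert v (set (labs t)) \<and> set_cell c \<inter> set (labs t) \<noteq> {}"
  using set_cell_body[of c t] by auto

lemma set_normal_cell: "set_cell (normal_cell c) = set_cell c"
  by (cases c) (auto simp: min_def max_def)

lemma simple_list_append:
  assumes "simple_list A" "simple_list B"
    "\<And>a b. a \<in> set A \<Longrightarrow> b \<in> set B \<Longrightarrow> set_cell a = set_cell b \<Longrightarrow> False"
  shows "simple_list (A @ B)"
proof -
  have "normal_cell a \<noteq> normal_cell b" if "a \<in> set A" "b \<in> set B" for a b
    using assms(3)[OF that] set_normal_cell by metis
  then show ?thesis using assms(1,2) by (auto simp: simple_list_def)
qed

lemma simple_list_body: "distinct (labs t) \<Longrightarrow> simple_list (body t)"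
proof (induction t)
  case (LT v k ts)
  have 1: "distinct (v # concat (map labs ts))" using LT.prems by simp
  have 2: "simple_list (body t)" if "t \<in> set ts" for t
    using LT that by (auto simp: distinct_concat_iff)
  \<comment> \<open>The inclusion separates the blocks of different children during the induction;
    \<open>set_cell c \<noteq> {v}\<close> separates all of them from the root cell
    afterwards.\<close>
  have "simple_list (concat (map (stem v) ts)) \<and>
    (\<forall>c\<in>set (concat (map (stem v) ts)). set_cell c \<subseteq> insert v (set (concat (map labs ts))) \<and> set_cell c \<noteq> {v})"
    using 1 2
  proof (induction ts)
    case (Cons t ts)
    have v: "v \<notin> set (labs t)" "v \<noteq> root t" using Cons.prems by auto
    have st: "set_cell c \<subseteq> insert v (set (labs t)) \<and> set_cell c \<noteq> {v}" if "c \<in> set (stem v t)" for c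
      using set_cell_stem[OF that] v by auto
    have "simple_list ([Edge v (root t)] @ body t)"
    proof (rule simple_list_append)
      show "simple_list (body t)" using Cons.prems by simp
      show "simple_list [Edge v (root t)]" using v by (simp add: simple_list_def)
      show False if "a \<in> set [Edge v (root t)]" "b \<in> set (body t)" "set_cell a = set_cell b" for a b
        using that set_cell_body[of b t] v by auto
    qed
    then have sl: "simple_list (stem v t)" by simp
    have "distinct (v # concat (map labs ts))" "\<And>u. u \<in> set ts \<Longrightarrow> simple_list (body u)"
      using Cons.prems by auto
    then have IH: "simple_list (concat (map (stem v) ts))"
      "\<forall>c\<in>set (concat (map (stem v) ts)). set_cell c \<subseteq> insert v (set (concat (map labs ts))) \<and> set_cell c \<noteq> {v}"
      using Cons.IH by blast+
    have disj: "set (labs t) \<inter> set (concat (map labs ts)) = {}" using Cons.prems by auto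
    have "simple_list (stem v t @ concat (map (stem v) ts))"
    proof (rule simple_list_append[OF sl IH(1)])
      fix a b assume ab: "a \<in> set (stem v t)" "b \<in> set (concat (map (stem v) ts))" "set_cell a = set_cell b"
      have "set_cell b \<subseteq> insert v (set (concat (map labs ts)))" using IH(2) ab(2) by blast
      with disj show False using ab(3) v set_cell_stem[OF ab(1)] by blast
    qed
    moreover have "set_cell c \<subseteq> insert v (set (concat (map labs (t # ts)))) \<and> set_cell c \<noteq> {v}"
      if "c \<in> set (concat (map (stem v) (t # ts)))" for c
    proof (cases "c \<in> set (stem v t)")
      case True
      then show ?thesis using st[of c] by auto
    next
      case False
      with that have "c \<in> set (concat (map (stem v) ts))" by auto
      then show ?thesis using IH(2) by fastforce
    qed
    ultimately show ?case unfolding concat.simps list.map by blast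
  qed (simp add: simple_list_def)
  moreover have "set_cell (vcell v k) = {v}" by (cases k) auto
  moreover have "simple_list [vcell v k]" by (cases k) (auto simp: simple_list_def)
  ultimately have "simple_list ([vcell v k] @ concat (map (stem v) ts))"
    by (intro simple_list_append) auto
  then show ?case by simp
qed

lemma simple_list_edge_body:
  assumes "distinct (labs t @ labs u)"
  shows "simple_list (edge_body t u)"
proof -
  have ne: "root t \<notin> set (labs u)" "root u \<notin> set (labs t)" "root t \<noteq> root u"
    using assms root_in_labs[of t] root_in_labs[of u] unfolding distinct_append by (blast, blast, metis disjoint_iff)
  have b: "simple_list (body t @ body u)"
  proof (rule simple_list_append)
    show False if "a \<in> set (body t)" "b \<in> set (body u)" "set_cell a = set_cell b" for a b
      using that set_cell_body[of a t] set_cell_body[of b u] assms by auto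
  qed (use assms simple_list_body in auto)
  have "simple_list ([Edge (root t) (root u)] @ (body t @ body u))"
  proof (rule simple_list_append[OF _ b])
    show False if "a \<in> set [Edge (root t) (root u)]" "b \<in> set (body t @ body u)" "set_cell a = set_cell b" for a b
      using that set_cell_body[of b t] set_cell_body[of b u] ne by auto
  qed (use ne in \<open>simp add: simple_list_def\<close>)
  then show ?thesis by simp
qed

lemma orel_adj:
  "orel m d L e M \<Longrightarrow> (\<forall>x y. adj L x y \<longleftrightarrow> adj M x y) \<and> (\<forall>v k. vcell v k \<in> set L \<longleftrightarrow> vcell v k \<in> set M)"
proof (induction rule: orel.induct)
  case (flip L e A v w B)
  have "vcell x k \<noteq> Edge a b" for x k and a b :: 'a by (cases k) auto
  then show ?case using flip by auto
qed (auto simp: adj_def)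

lemma vcell_eq [simp]: "vcell v k = vcell w k' \<longleftrightarrow> v = w \<and> k = k'"
  by (cases k; cases k') auto

lemma vcell_neq_Edge [simp]: "vcell v k \<noteq> Edge a b" "Edge a b \<noteq> vcell v k"
  by (cases k; simp)+

lemma vcell_body_labs: "x \<in> set (labs t) \<longleftrightarrow> (\<exists>k. vcell x k \<in> set (body t))"
  by (induction t) auto

lemma unique_kinds_body: "distinct (labs t) \<Longrightarrow> unique_kinds (body t)"
proof (induction t)
  case (LT v k ts)
  have dis: "distinct (concat (map labs ts))" "v \<notin> set (concat (map labs ts))" using LT.prems by auto
  have uk: "unique_kinds (body t)" if "t \<in> set ts" for t
    using LT that by (auto simp: distinct_concat_iff)
  show ?case
    unfolding unique_kinds_def
  proof (intro allI impI)
    fix w k1 k2 assume "vcell w k1 \<in> set (body (LT v k ts))" "vcell w k2 \<in> set (body (LT v k ts))"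
    then consider "w = v" "k1 = k" "k2 = k" | t u where "t \<in> set ts" "u \<in> set ts" "vcell w k1 \<in> set (body t)" "vcell w k2 \<in> set (body u)"
      using dis(2) vcell_body_labs[of v] by auto
    then show "k1 = k2"
    proof cases
      case 2
      then have "t = u" using labs_disjoint[OF dis(1), of t u] vcell_body_labs[of w] by blast
      with 2 uk show ?thesis by (auto simp: unique_kinds_def)
    qed simp
  qed
qed

lemma unique_kinds_edge_body: "distinct (labs t @ labs u) \<Longrightarrow> unique_kinds (edge_body t u)"
  using unique_kinds_body[of t] unique_kinds_body[of u]
  unfolding unique_kinds_def
  by (simp add: disjoint_iff vcell_body_labs) blast

lemma branch_edge_body:
  assumes "distinct (labs t @ labs u)" "orel m d G e (edge_body t u)"
  shows "branch G (root u) t" "branch G (root t) u"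
proof -
  have ne: "root t \<notin> set (labs u)" "root u \<notin> set (labs t)"
    using assms(1) root_in_labs[of t] root_in_labs[of u] unfolding distinct_append by blast+
  have adj: "adj G x y \<longleftrightarrow> adj (edge_body t u) x y" for x y using orel_adj[OF assms(2)] by blast
  have vc: "vcell x k \<in> set G \<longleftrightarrow> vcell x k \<in> set (edge_body t u)" for x k
    using orel_adj[OF assms(2)] by blast
  show "branch G (root u) t"
  proof (rule branch_of_body)
    show "adj G x y = (adj (body t) x y \<or> x = root t \<and> y = root u)" if "x \<in> set (labs t)" for x y
      using that adj_body[of u x y] adj[of x y] assms(1) ne by auto
  qed (use assms ne vc in auto)
  show "branch G (root t) u"
  proof (rule branch_of_body)
    show "adj G x y = (adj (body u) x y \<or> x = root u \<and> y = root t)" if "x \<in> set (labs u)" for x y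
      using that adj_body[of t x y] adj[of x y] assms(1) ne by auto
  qed (use assms ne vc in auto)
qed

lemma whole_body:
  assumes "distinct (labs (LT v k ts))" "orel m d G e (body (LT v k ts))"
  shows "whole G v k ts"
  using whole_of_body[OF assms(1), of G] orel_adj[OF assms(2)] by blast

section \<open>Uniqueness of the form and of its sign\<close>

lemma orel_vertices: "orel m d G e (body t) \<Longrightarrow> set (labs t) = {x. \<exists>k. vcell x k \<in> set G}"
  using orel_adj[of m d G e "body t"] vcell_body_labs[of _ t] by auto

lemma orel_edge_vertices:
  "orel m d G e (edge_body t u) \<Longrightarrow> set (labs t) \<union> set (labs u) = {x. \<exists>k. vcell x k \<in> set G}"
  using orel_adj[of m d G e "edge_body t u"] vcell_body_labs[of _ t] vcell_body_labs[of _ u] by auto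

lemma orel_unique_kinds: "orel m d L e M \<Longrightarrow> unique_kinds M \<Longrightarrow> unique_kinds L"
  using orel_adj unfolding unique_kinds_def by metis

lemma cwf_EC_height: "cwf r (EC {#T, U#}) \<Longrightarrow> height T = height U"
proof -
  assume "cwf r (EC {#T, U#})"
  moreover have "T \<in># {#T, U#}" "U \<in># {#T, U#}" by simp_all
  ultimately show ?thesis unfolding cwf.simps by blast
qed

lemma edge_centre_edge_body:
  assumes "distinct (labs t @ labs u)" "orel m d G e (edge_body t u)" "cwf r (EC {#shape t, shape u#})"
  shows "edge_centre G (root t) (root u)"
  using branch_edge_body[OF assms(1,2)] cwf_EC_height[OF assms(3)] unfolding edge_centre_def by blast

lemma vertex_centre_body:
  assumes "distinct (labs (LT v k ts))" "orel m d G e (body (LT v k ts))" "two_max (mset (map shape ts))"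
  shows "vertex_centre G v"
  using whole_body[OF assms(1,2)] assms(3) unfolding vertex_centre_def by blast

text \<open>Both roots are the unique vertex centre of \<open>G\<close>, so the two trees differ by
  the order of siblings, for which \<open>treq\<close> supplies the sign. Since \<open>G\<close> is
  simple, this sign is also the quotient of \<open>e\<close> and \<open>e'\<close>.\<close>

lemma pres_unique_vertex:
  fixes G :: ograph
  assumes "distinct (labs (LT v None ts))" "orel m d G e (body (LT v None ts))" "two_max (mset (map shape ts))"
    "distinct (labs (LT v' None ts'))" "orel m d G e' (body (LT v' None ts'))" "two_max (mset (map shape ts'))"
  shows "mset (map shape ts) = mset (map shape ts') \<and> (cgood m d (VC (mset (map shape ts))) \<longrightarrow>
    e * osign m d (LT v None ts) = e' * osign m d (LT v' None ts'))"
proof -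
  have uk: "unique_kinds G" using orel_unique_kinds[OF assms(2)] unique_kinds_body[OF assms(1)] .
  have w: "whole G v None ts" "whole G v' None ts'" using whole_body[OF assms(1,2)] whole_body[OF assms(4,5)] by auto
  have "v' \<in> set (labs (LT v None ts))"
    using orel_vertices[OF assms(2)] w(2) unfolding whole_def by blast
  then have v': "v' = v"
    using vertex_centre_unique(2)[OF uk w(1) assms(3)] vertex_centre_body[OF assms(4-6)] by blast
  have tr: "treq m d (LT v None ts) (LT v' None ts')" using whole_treq[OF uk w(1)] w(2) v' by simp
  then obtain e0 where e0: "orel m d (body (LT v None ts)) e0 (body (LT v' None ts'))"
    "pgood m d (shape (LT v None ts)) \<Longrightarrow> e0 = osign m d (LT v None ts) * osign m d (LT v' None ts')"
    unfolding treq_def by blast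
  have "simple_list G"
    using orel_list_sign[OF orel_sym[OF assms(2)] simple_list_body[OF assms(1)]] by blast
  then have e': "e' = e * e0" using orel_unique[OF assms(5) orel_trans[OF e0(1) assms(2)]] by blast
  have "mset (map shape ts) = mset (map shape ts')" using tr by (simp add: treq_def del: mset_map)
  moreover have "e * osign m d (LT v None ts) = e' * osign m d (LT v' None ts')"
    if "cgood m d (VC (mset (map shape ts)))"
  proof -
    have "e0 = osign m d (LT v None ts) * osign m d (LT v' None ts')" using e0(2) that by simp
    then have "e0 * osign m d (LT v' None ts') = osign m d (LT v None ts)"
      by (metis mult.assoc mult.right_neutral osign_square)
    then show ?thesis unfolding e' by (metis mult.assoc)
  qed
  ultimately show ?thesis by blast
qed

lemma pres_unique_edge_same:
  fixes G :: ograph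
  assumes "distinct (labs t @ labs u)" "orel m d G e (edge_body t u)"
    "distinct (labs t' @ labs u')" "orel m d G e' (edge_body t' u')"
    "root t = root t'" "root u = root u'"
  shows "shape t = shape t' \<and> shape u = shape u' \<and> (pgood m d (shape t) \<longrightarrow> pgood m d (shape u) \<longrightarrow>
    e * (osign m d t * osign m d u) = e' * (osign m d t' * osign m d u'))"
proof -
  have uk: "unique_kinds G" using orel_unique_kinds[OF assms(2)] unique_kinds_edge_body[OF assms(1)] .
  have b: "branch G (root u) t" "branch G (root t) u" "branch G (root u) t'" "branch G (root t) u'"
    using branch_edge_body[OF assms(1,2)] branch_edge_body[OF assms(3,4)] assms(5,6) by auto
  have tr: "treq m d t t'" "treq m d u u'"
    using branch_treq[OF uk b(1,3)] branch_treq[OF uk b(2,4)] assms(5,6) by auto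
  obtain e0 where e0: "orel m d (edge_body t u) e0 (edge_body t' u')"
    "pgood m d (shape t) \<Longrightarrow> pgood m d (shape u) \<Longrightarrow>
        e0 = osign m d t * osign m d t' * (osign m d u * osign m d u')"
    using orel_edge_cong[OF tr] by blast
  have "simple_list G"
    using orel_list_sign[OF orel_sym[OF assms(2)] simple_list_edge_body[OF assms(1)]] by blast
  then have e': "e' = e * e0" using orel_unique[OF assms(4) orel_trans[OF e0(1) assms(2)]] by blast
  have "e * (osign m d t * osign m d u) = e' * (osign m d t' * osign m d u')"
    if "pgood m d (shape t)" "pgood m d (shape u)"
  proof -
    have "e' * (osign m d t' * osign m d u') = e * (osign m d t * osign m d u) *
       ((osign m d t' * osign m d t') * (osign m d u' * osign m d u'))"
      unfolding e' e0(2)[OF that] by (simp only: mult_ac)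
    then show ?thesis by simp
  qed
  then show ?thesis using tr by (auto simp: treq_def)
qed

text \<open>Uniqueness of the centre rules out the mixed cases. In the edge case the two halves can
  still be listed in either order, and \<open>esign\<close> compensates the exchange.\<close>

lemma pres_unique:
  assumes "pres m d r G e c" "pres m d r G e' c'"
  shows "c = c' \<and> (cgood m d c \<longrightarrow> e = e')"
  using assms(1)
proof cases
  case V: (vertex v ts e1)
  have uk: "unique_kinds G" using orel_unique_kinds[OF V(4)] unique_kinds_body[OF V(3)] .
  show ?thesis using assms(2)
  proof cases
    case V': (vertex v' ts' e1')
    have tm: "two_max (mset (map shape ts))" "two_max (mset (map shape ts'))" using V(5) V'(5) by simp_all
    show ?thesis
      using pres_unique_vertex[OF V(3,4) tm(1) V'(3,4) tm(2)] unfolding V(1,2) V'(1,2) by metis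
  next
    case E: (edge t u e1')
    have "set (labs t) \<union> set (labs u) = set (labs (LT v None ts))"
      unfolding orel_vertices[OF V(4)] orel_edge_vertices[OF E(4)] ..
    then have "root t \<in> set (labs (LT v None ts))" using root_in_labs by blast
    then have False
      using vertex_centre_unique(1)[OF uk whole_body[OF V(3,4)]] V(5) edge_centre_edge_body[OF E(3-5)] by fastforce
    then show ?thesis ..
  qed
next
  case E: (edge t u e1)
  have uk: "unique_kinds G" using orel_unique_kinds[OF E(4)] unique_kinds_edge_body[OF E(3)] .
  have h: "height (shape t) = height (shape u)" by (rule cwf_EC_height[OF E(5)])
  show ?thesis using assms(2)
  proof cases
    case V: (vertex v ts e1)
    have "set (labs t) \<union> set (labs u) = set (labs (LT v None ts))"
      unfolding orel_vertices[OF V(4)] orel_edge_vertices[OF E(4)] ..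
    then have "v \<in> set (labs t) \<union> set (labs u)" by simp
    then have False
      using edge_centre_unique(1)[OF uk branch_edge_body[OF E(3,4)] h] vertex_centre_body[OF V(3,4)] V(5) by fastforce
    then show ?thesis ..
  next
    case E': (edge t' u' e1')
    have mem: "root t' \<in> set (labs t) \<union> set (labs u)"
      unfolding orel_edge_vertices[OF E(4)] orel_edge_vertices[OF E'(4), symmetric] by simp
    consider "root t = root t'" "root u = root u'" | "root t = root u'" "root u = root t'"
      using edge_centre_unique(2)[OF uk branch_edge_body[OF E(3,4)] h mem edge_centre_edge_body[OF E'(3-5)]]
      by fastforce
    then show ?thesis
    proof cases
      case 1
      have *: "shape t = shape t' \<and> shape u = shape u' \<and> (pgood m d (shape t) \<longrightarrow> pgood m d (shape u) \<longrightarrow>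
        e1 * (osign m d t * osign m d u) = e1' * (osign m d t' * osign m d u'))"
        by (rule pres_unique_edge_same[OF E(3,4) E'(3,4) 1])
      have "e = e'" if "pgood m d (shape t)" "pgood m d (shape u)"
      proof -
        have "e = e1 * (osign m d t * osign m d u) * esign m d (shape t) (shape u)" using E(1) by (simp only: mult_ac)
        also have "\<dots> = e1' * (osign m d t' * osign m d u') * esign m d (shape t') (shape u')" using * that by metis
        also have "\<dots> = e'" using E'(1) by (simp only: mult_ac)
        finally show ?thesis .
      qed
      moreover have "cgood m d c \<Longrightarrow> pgood m d (shape t) \<and> pgood m d (shape u)" by (simp add: E(2))
      moreover have "c = c'" using * unfolding E(2) E'(2) by metis
      ultimately show ?thesis by blast
    next
      case 2
      have dis: "distinct (labs u' @ labs t')" using E'(3) by auto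
      have o: "orel m d G (e1' * swap_sign m d (shape t') (shape u')) (edge_body u' t')"
        by (rule orel_trans[OF orel_edge_swap E'(4)])
      have *: "shape t = shape u' \<and> shape u = shape t' \<and> (pgood m d (shape t) \<longrightarrow> pgood m d (shape u) \<longrightarrow>
        e1 * (osign m d t * osign m d u) = e1' * swap_sign m d (shape t') (shape u') * (osign m d u' * osign m d t'))"
        by (rule pres_unique_edge_same[OF E(3,4) dis o 2])
      have "e = e'" if g: "cgood m d c"
      proof -
        have pg: "pgood m d (shape t)" "pgood m d (shape u)" using g by (simp_all add: E(2))
        have "\<not> podd m d (shape t) \<Longrightarrow> count {#shape t, shape u#} (shape t) \<le> 1"
          using g unfolding E(2) cgood.simps no_odd_repeat_def by blast
        then have "shape t \<noteq> shape u \<or> podd m d (shape t)" by (cases "podd m d (shape t)"; cases "shape t = shape u") simp_all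
        then have "shape t' \<noteq> shape u' \<or> podd m d (shape t')" using * by metis
        from esign_swap[OF this] have es: "esign m d (shape t') (shape u') =
          swap_sign m d (shape t') (shape u') * esign m d (shape u') (shape t')" by simp
        have "e = e1 * (osign m d t * osign m d u) * esign m d (shape t) (shape u)" using E(1) by (simp only: mult_ac)
        also have "\<dots> = e1' * swap_sign m d (shape t') (shape u') * (osign m d u' * osign m d t') * esign m d (shape u') (shape t')"
          using * pg by metis
        also have "\<dots> = e'" unfolding E'(1) es by (simp only: mult_ac)
        finally show ?thesis .
      qed
      moreover have "c = c'" using * unfolding E(2) E'(2) by (metis add_mset_commute)
      ultimately show ?thesis by blast
    qed
  qed
qed

lemma pres_orel:
  assumes "pres m d r G e c" "orel m d G a G'"
  shows "pres m d r G' (a * e) c"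
  using assms(1)
proof cases
  case (vertex v ts e1)
  have "orel m d G' (a * e1) (body (LT v None ts))"
    using orel_trans[OF vertex(4) orel_sym[OF assms(2)]] .
  from pres.vertex[OF vertex(3) this vertex(5)] show ?thesis
    unfolding vertex(1,2) by (simp only: mult.assoc)
next
  case (edge t u e1)
  have "orel m d G' (a * e1) (edge_body t u)"
    using orel_trans[OF edge(4) orel_sym[OF assms(2)]] .
  from pres.edge[OF edge(3) this edge(5)] show ?thesis
    unfolding edge(1,2) by (simp only: mult.assoc)
qed

lemma vertices_conv: "vertices G = {v. \<exists>k. vcell v k \<in> set G}"
proof (intro set_eqI)
  fix v
  have "v \<in> vertices G \<longleftrightarrow> Internal v \<in> set G \<or> (\<exists>i. External v i \<in> set G)"
    by (auto simp: vertices_def internals_def externals_def split: cell.splits)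
  also have "\<dots> \<longleftrightarrow> (\<exists>k. vcell v k \<in> set G)"
  proof -
    have "(\<exists>k. vcell v k \<in> set G) \<longleftrightarrow> vcell v None \<in> set G \<or> (\<exists>i. vcell v (Some i) \<in> set G)"
      by (metis option.exhaust)
    then show ?thesis by simp
  qed
  finally show "v \<in> vertices G \<longleftrightarrow> v \<in> {v. \<exists>k. vcell v k \<in> set G}" by simp
qed

lemma pres_VC:
  assumes "pres m d r G e (VC M)"
  shows "\<exists>v ts e1. distinct (labs (LT v None ts)) \<and> orel m d G e1 (body (LT v None ts)) \<and> M = mset (map shape ts)"
  using assms
proof cases
  case (vertex v ts e1)
  then show ?thesis by blast
qed

lemma pres_EC:
  assumes "pres m d r G e (EC M)"
  shows "\<exists>t u e1. distinct (labs t @ labs u) \<and> orel m d G e1 (edge_body t u) \<and> M = {#shape t, shape u#}"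
  using assms
proof cases
  case (edge t u e1)
  then show ?thesis by blast
qed

lemma pres_map:
  assumes "pres m d r G e c" "inj_on f (vertices G)"
  shows "pres m d r (map (map_cell f) G) e c"
  using assms(1)
proof cases
  case (vertex v ts e1)
  let ?us = "map (map_ltree f) ts"
  have "set (labs (LT v None ts)) = vertices G"
    by (simp only: orel_vertices[OF vertex(4)] vertices_conv)
  then have "distinct (labs (map_ltree f (LT v None ts)))"
    using vertex(3) assms(2) unfolding labs_map by (simp only: distinct_map)
  then have 1: "distinct (labs (LT (f v) None ?us))" by (simp only: ltree.map)
  have 2: "orel m d (map (map_cell f) G) e1 (body (LT (f v) None ?us))"
    using orel_map[OF vertex(4), of f] by (simp only: ltree.map flip: body_map)
  have sh: "map shape ?us = map shape ts" by simp
  have os: "osign m d (LT (f v) None ?us) = osign m d (LT v None ts)"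
    using osign_map[of m d f "LT v None ts"] by (simp only: ltree.map)
  from pres.vertex[OF 1 2] show ?thesis using vertex(5) unfolding vertex(1,2) sh os .
next
  case (edge t u e1)
  have "set (labs t @ labs u) = vertices G"
    using orel_edge_vertices[OF edge(4)] vertices_conv[of G] by simp
  then have "distinct (map f (labs t @ labs u))"
    using edge(3) assms(2) by (simp only: distinct_map)
  then have 1: "distinct (labs (map_ltree f t) @ labs (map_ltree f u))" by simp
  have 2: "orel m d (map (map_cell f) G) e1 (edge_body (map_ltree f t) (map_ltree f u))"
    using orel_map[OF edge(4), of f] by simp
  from pres.edge[OF 1 2] show ?thesis using edge(5) unfolding edge(1,2) shape_map osign_map .
qed

section \<open>Relabelling: isomorphism of graphs with the same form, odd automorphisms\<close>

lemma map_cell_cong_body: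
  assumes "\<And>x. x \<in> set (labs t) \<Longrightarrow> f x = g x"
  shows "map (map_cell f) (body t) = map (map_cell g) (body t)"
  using map_ltree_cong[of t f g, OF assms] by (simp flip: body_map)

lemma map_id_body:
  assumes "\<And>x. x \<in> set (labs t) \<Longrightarrow> f x = x"
  shows "map (map_cell f) (body t) = body t"
proof -
  have "map_ltree f t = map_ltree id t" by (rule map_ltree_cong) (simp add: assms)
  then have "map_ltree f t = t" by (simp add: ltree.map_id)
  then show ?thesis by (simp flip: body_map)
qed

lemma pres_edge_swap:
  assumes "distinct (labs t @ labs u)" "orel m d G e (edge_body t u)"
  shows "\<exists>a. orel m d G a (edge_body u t)"
  using orel_trans[OF orel_edge_swap assms(2)] by blast

lemma pres_related_edge:
  assumes t: "distinct (labs t @ labs u)" "orel m d G e (edge_body t u)"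
    and t': "distinct (labs t' @ labs u')" "orel m d G' e' (edge_body t' u')"
    and sh: "shape t = shape t'" "shape u = shape u'"
  shows "\<exists>f a. inj_on f (vertices G) \<and> orel m d (map (map_cell f) G) a G'"
proof -
  have dis: "distinct (labs t)" "distinct (labs u)" "distinct (labs t')" "distinct (labs u')"
    "set (labs t) \<inter> set (labs u) = {}" "set (labs t') \<inter> set (labs u') = {}"
    using t(1) t'(1) by auto
  obtain f where f: "inj_on f (set (labs t))" "f ` set (labs t) = set (labs t')" "treq m d (map_ltree f t) t'"
    using relabel_tree[OF sh(1) dis(1,3)] by blast
  obtain g where g: "inj_on g (set (labs u))" "g ` set (labs u) = set (labs u')" "treq m d (map_ltree g u) u'"
    using relabel_tree[OF sh(2) dis(2,4)] by blast
  define h where "h x = (if x \<in> set (labs t) then f x else g x)" for x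
  have hf: "h x = f x" if "x \<in> set (labs t)" for x using that by (simp add: h_def)
  have hg: "h x = g x" if "x \<in> set (labs u)" for x using that dis(5) by (auto simp: h_def)
  have "map_ltree h t = map_ltree f t" "map_ltree h u = map_ltree g u"
    by (rule map_ltree_cong; simp add: hf hg)+
  then have "treq m d (map_ltree h t) t'" "treq m d (map_ltree h u) u'" using f(3) g(3) by simp_all
  then obtain a where "orel m d (edge_body (map_ltree h t) (map_ltree h u)) a (edge_body t' u')"
    using orel_edge_cong by blast
  then have "orel m d (map (map_cell h) (edge_body t u)) a (edge_body t' u')" by simp
  from orel_trans[OF orel_sym[OF t'(2)] orel_trans[OF this orel_map[OF t(2), of h]]]
  have "orel m d (map (map_cell h) G) (e * a * e') G'" .
  moreover have "inj_on h (vertices G)"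
  proof -
    have 1: "inj_on h (set (labs t))" "inj_on h (set (labs u))"
      using f(1) g(1) inj_on_cong[of "set (labs t)" h f] hf inj_on_cong[of "set (labs u)" h g] hg by blast+
    have 2: "h ` set (labs t) = set (labs t')" "h ` set (labs u) = set (labs u')"
      using f(2) g(2) hf hg by (metis image_cong)+
    have "vertices G = set (labs t) \<union> set (labs u)"
      using orel_edge_vertices[OF t(2)] vertices_conv[of G] by simp
    then show ?thesis using 1 2 dis by (simp add: inj_on_Un) blast
  qed
  ultimately show ?thesis by blast
qed

lemma pres_related:
  assumes "pres m d r G e c" "pres m d r G' e' c"
  shows "\<exists>f a. inj_on f (vertices G) \<and> orel m d (map (map_cell f) G) a G'"
  using assms(1)
proof cases
  case V: (vertex v ts e1)
  obtain v' ts' e1' where V': "distinct (labs (LT v' None ts'))"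
    "orel m d G' e1' (body (LT v' None ts'))" "mset (map shape ts) = mset (map shape ts')"
    using pres_VC[OF assms(2)[unfolded V(2)]] by blast
  have "shape (LT v None ts) = shape (LT v' None ts')" using V'(3) by (simp only: shape.simps)
  from relabel_tree[OF this V(3) V'(1)] obtain f where f: "inj_on f (set (labs (LT v None ts)))"
    "treq m d (map_ltree f (LT v None ts)) (LT v' None ts')" by blast
  then obtain a where a: "orel m d (map (map_cell f) (body (LT v None ts))) a (body (LT v' None ts'))"
    unfolding treq_def body_map by blast
  have "orel m d (map (map_cell f) G) (e1 * a * e1') G'"
    using orel_trans[OF orel_sym[OF V'(2)] orel_trans[OF a orel_map[OF V(4), of f]]] .
  moreover have "vertices G = set (labs (LT v None ts))"
    by (simp only: orel_vertices[OF V(4)] vertices_conv)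
  ultimately show ?thesis using f(1) by auto
next
  case E: (edge t u e1)
  obtain t' u' e1' where E': "distinct (labs t' @ labs u')"
    "orel m d G' e1' (edge_body t' u')" "{#shape t, shape u#} = {#shape t', shape u'#}"
    using pres_EC[OF assms(2)[unfolded E(2)]] by blast
  from E'(3) consider "shape t = shape t'" "shape u = shape u'" | "shape t = shape u'" "shape u = shape t'"
    by (auto simp: add_eq_conv_ex)
  then show ?thesis
  proof cases
    case 1 then show ?thesis using pres_related_edge[OF E(3,4) E'(1,2)] by blast
  next
    case 2
    obtain a where "orel m d G' a (edge_body u' t')" using pres_edge_swap[OF E'(1,2)] by blast
    moreover have "distinct (labs u' @ labs t')" using E'(1) by auto
    ultimately show ?thesis using pres_related_edge[OF E(3,4) _ _ 2] by blast
  qed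
qed

text \<open>On \<open>u\<close> the map \<open>f\<close> is the inverse of what it is on
  \<open>t\<close>. The two comparisons of bodies therefore have the same sign \<open>e\<close> and
  cancel when both trees are moved at once.\<close>

lemma exchange_trees:
  assumes sh: "shape t = shape u" and dis: "distinct (labs t @ labs u)"
  obtains f e where "f permutes (set (labs t) \<union> set (labs u))" "f (root t) = root u" "f (root u) = root t"
    "orel m d (map (map_cell f) (body t)) e (body u)" "orel m d (map (map_cell f) (body u)) e (body t)"
    "e * e = 1"
proof -
  have d: "distinct (labs t)" "distinct (labs u)" "set (labs t) \<inter> set (labs u) = {}" using dis by auto
  obtain g where g: "inj_on g (set (labs t))" "g ` set (labs t) = set (labs u)" "treq m d (map_ltree g t) u"
    using relabel_tree[OF sh d(1,2)] by blast
  obtain e where e: "orel m d (map (map_cell g) (body t)) e (body u)" using g(3) by (auto simp: treq_def)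
  define h where "h = inv_into (set (labs t)) g"
  have hg: "h (g x) = x" if "x \<in> set (labs t)" for x using g(1) that by (simp add: h_def)
  have h: "inj_on h (set (labs u))" "h ` set (labs u) = set (labs t)"
    using g(1,2) unfolding h_def by (metis inj_on_inv_into order_refl, metis bij_betw_def bij_betw_inv_into)
  define f where "f x = (if x \<in> set (labs t) then g x else if x \<in> set (labs u) then h x else x)" for x
  have ft: "f x = g x" if "x \<in> set (labs t)" for x using that by (simp add: f_def)
  have fu: "f x = h x" if "x \<in> set (labs u)" for x using that d(3) by (auto simp: f_def)
  have 1: "inj_on f (set (labs t))" "inj_on f (set (labs u))"
    using g(1) h(1) inj_on_cong[of "set (labs t)" f g] ft inj_on_cong[of "set (labs u)" f h] fu by blast+
  have 2: "f ` set (labs t) = set (labs u)" "f ` set (labs u) = set (labs t)"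
    using g(2) h(2) ft fu by (metis image_cong)+
  have rt: "f (root t) = root u" using ft[OF root_in_labs] g(3) by (simp add: treq_def)
  have "f (root u) = h (g (root t))" using fu[OF root_in_labs] g(3) by (simp add: treq_def)
  then have ru: "f (root u) = root t" using hg[OF root_in_labs] by simp
  have o1: "orel m d (map (map_cell f) (body t)) e (body u)"
    using e map_cell_cong_body[of t f g, OF ft] by (simp only:)
  have "map (map_cell h) (map (map_cell g) (body t)) = map (map_cell (h \<circ> g)) (body t)"
    by (simp add: cell.map_comp)
  also have "\<dots> = body t" by (rule map_id_body) (simp add: hg)
  finally have "orel m d (body t) e (map (map_cell h) (body u))" using orel_map[OF e, of h] by simp
  then have o2: "orel m d (map (map_cell f) (body u)) e (body t)"
    using orel_sym map_cell_cong_body[of u f h, OF fu] by (simp only:)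
  have "f permutes (set (labs t) \<union> set (labs u))"
  proof (rule bij_imp_permutes)
    show "bij_betw f (set (labs t) \<union> set (labs u)) (set (labs t) \<union> set (labs u))"
      unfolding bij_betw_def using 1 2 d(3) by (simp add: inj_on_Un image_Un Un_commute) blast
  qed (auto simp: f_def)
  then show ?thesis by (rule that[OF _ rt ru o1 o2 orel_square[OF e]])
qed

text \<open>The root is fixed and other labels are not moved, so the automorphism extends to any
  graph in which \<open>t\<close> is planted.\<close>

definition odd_automorphism :: "(nat \<Rightarrow> nat) \<Rightarrow> nat \<Rightarrow> 'v ltree \<Rightarrow> bool" where
  "odd_automorphism m d t \<longleftrightarrow> (\<exists>f. f permutes set (labs t) \<and> f (root t) = root t \<and>
     orel m d (map (map_cell f) (body t)) (- 1) (body t))"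

text \<open>The block \<open>B\<close> in the middle is passed once by \<open>X\<close> and once by
  \<open>Y\<close>. Both are odd, so the parity of \<open>B\<close> cancels.\<close>

lemma orel_exchange_odd:
  assumes "odd_list m d X" "odd_list m d Y"
  shows "orel m d (A @ X @ B @ Y @ C) (- 1) (A @ Y @ B @ X @ C)"
proof -
  have "orel m d (A @ X @ (B @ Y) @ C) (kz (odd_list m d) X (B @ Y)) (A @ (B @ Y) @ X @ C)"
    by (rule orel_block_swap)
  moreover have "orel m d (A @ B @ Y @ (X @ C)) (kz (odd_list m d) B Y) (A @ Y @ B @ (X @ C))"
    by (rule orel_block_swap)
  ultimately have "orel m d (A @ X @ B @ Y @ C) (kz (odd_list m d) X (B @ Y) * kz (odd_list m d) B Y) (A @ Y @ B @ X @ C)"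
    using orel_trans by fastforce
  moreover have "kz (odd_list m d) X (B @ Y) * kz (odd_list m d) B Y = - 1"
    using assms by (auto simp: kz_def odd_list_def)
  ultimately show ?thesis by simp
qed

lemma mset_repeat_split:
  assumes "count (mset (map f xs)) y \<ge> 2"
  obtains A x B x' C where "xs = A @ x # B @ x' # C" "f x = y" "f x' = y"
proof -
  have "y \<in> set (map f xs)" using assms by (metis count_greater_zero_iff gr_zeroI not_numeral_le_zero set_mset_mset)
  then have "\<exists>x\<in>set xs. f x = y" by auto
  from split_list_first_prop[OF this] obtain A x D
    where xs: "xs = A @ x # D" "f x = y" "\<forall>z\<in>set A. f z \<noteq> y" by blast
  have "count (mset (map f A)) y = 0" using xs(3) by (auto simp: count_eq_zero_iff)
  then have "count (mset (map f D)) y \<ge> 1" using assms xs by simp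
  then have "y \<in> set (map f D)" by (metis count_greater_eq_one_iff set_mset_mset)
  then obtain x' where "x' \<in> set D" "f x' = y" by auto
  then obtain B C where "D = B @ x' # C" by (meson split_list)
  with xs \<open>f x' = y\<close> that show ?thesis by blast
qed

lemma map_id_stems:
  assumes "\<And>x. x \<in> set (concat (map labs ts)) \<Longrightarrow> f x = x" "f v = v"
  shows "map (map_cell f) (concat (map (stem v) ts)) = concat (map (stem v) ts)"
  using assms
proof (induction ts)
  case (Cons t ts)
  have "map (map_cell f) (body t) = body t" using Cons.prems by (intro map_id_body) auto
  moreover have "f (root t) = root t" using Cons.prems root_in_labs by simp
  ultimately show ?case using Cons by simp
qed simp

text \<open>A bad tree has either a bad branch, whose odd automorphism is extended by the identity,
  or two equal odd branches, which are exchanged.\<close>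

lemma bad_odd_automorphism:
  "\<not> pgood m d (shape t) \<Longrightarrow> distinct (labs t) \<Longrightarrow> odd_automorphism m d t"
proof (induction t)
  case (LT v k ts)
  have dis: "distinct (concat (map labs ts))" "v \<notin> set (concat (map labs ts))" using LT.prems by auto
  consider t where "t \<in> set ts" "\<not> pgood m d (shape t)"
    | s where "podd m d s" "count (mset (map shape ts)) s \<ge> 2"
    using LT.prems(1) by (auto simp: no_odd_repeat_def not_le Suc_le_eq numeral_2_eq_2)
  then show ?case
  proof cases
    case 1
    obtain A B where ts: "ts = A @ t # B" using 1(1) by (meson split_list)
    have "odd_automorphism m d t" using LT.IH[OF 1] LT.prems(2) 1(1) by (auto simp: distinct_concat_iff)
    then obtain f where f: "f permutes set (labs t)" "f (root t) = root t"
      "orel m d (map (map_cell f) (body t)) (- 1) (body t)" unfolding odd_automorphism_def by blast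
    note fid = permutes_not_in[OF f(1)]
    have fv: "f v = v" using fid dis(2) ts by auto
    have AB: "map (map_cell f) (concat (map (stem v) A)) = concat (map (stem v) A)"
      "map (map_cell f) (concat (map (stem v) B)) = concat (map (stem v) B)"
      using fid dis(1) ts fv by (intro map_id_stems; fastforce)+
    have "orel m d ((vcell v k # concat (map (stem v) A) @ [Edge v (root t)]) @ map (map_cell f) (body t) @ concat (map (stem v) B)) (- 1)
       ((vcell v k # concat (map (stem v) A) @ [Edge v (root t)]) @ body t @ concat (map (stem v) B))"
      by (rule orel_context[OF f(3)])
    then have "orel m d (map (map_cell f) (body (LT v k ts))) (- 1) (body (LT v k ts))"
      using AB ts fv f(2) by simp
    moreover have "f permutes set (labs (LT v k ts))"
      using f(1) by (rule permutes_subset) (use ts in auto)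
    ultimately show ?thesis unfolding odd_automorphism_def using fv by auto
  next
    case 2
    obtain A t B u C where ts: "ts = A @ t # B @ u # C" "shape t = s" "shape u = s"
      using mset_repeat_split[OF 2(2)] by blast
    have dtu: "distinct (labs t @ labs u)" using dis(1) ts by auto
    obtain f e where f: "f permutes (set (labs t) \<union> set (labs u))"
      "f (root t) = root u" "f (root u) = root t"
      "orel m d (map (map_cell f) (body t)) e (body u)" "orel m d (map (map_cell f) (body u)) e (body t)"
      "e * e = 1"
      using exchange_trees[of t u m d] ts dtu by metis
    note fid = permutes_not_in[OF f(1)]
    have fv: "f v = v" using fid dis(2) ts by auto
    have ABC: "map (map_cell f) (concat (map (stem v) A)) = concat (map (stem v) A)"
      "map (map_cell f) (concat (map (stem v) B)) = concat (map (stem v) B)"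
      "map (map_cell f) (concat (map (stem v) C)) = concat (map (stem v) C)"
      using fid dis(1) ts fv by (intro map_id_stems; fastforce)+
    let ?A = "vcell v k # concat (map (stem v) A)" and ?B = "concat (map (stem v) B)" and ?C = "concat (map (stem v) C)"
    let ?t = "Edge v (root u) # map (map_cell f) (body t)" and ?u = "Edge v (root t) # map (map_cell f) (body u)"
    have "orel m d (?A @ stem v u @ ?B @ stem v t @ ?C) (- 1) (?A @ stem v t @ ?B @ stem v u @ ?C)"
      by (rule orel_exchange_odd; unfold odd_list_def graph_degree_stem) (use 2(1) ts in simp_all)
    \<comment> \<open>After relabelling, each of the two blocks agrees with the other original block
      up to the sign \<open>e\<close>, and \<open>e * e = 1\<close>. The whole sign comes from
      exchanging the blocks back.\<close>
    moreover have "orel m d (?A @ ?t @ ?B @ ?u @ ?C) 1 (?A @ stem v u @ ?B @ stem v t @ ?C)"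
    proof -
      have "orel m d (?t @ ?B @ ?u @ ?C) (e * (1 * (e * 1))) (stem v u @ ?B @ stem v t @ ?C)"
        by (intro orel_append orel_Cons f orel.start)
      then show ?thesis using orel_context[of m d _ _ _ ?A "[]"] f(6) by fastforce
    qed
    ultimately have "orel m d (?A @ ?t @ ?B @ ?u @ ?C) (- 1) (?A @ stem v t @ ?B @ stem v u @ ?C)"
      using orel_trans by fastforce
    then have "orel m d (map (map_cell f) (body (LT v k ts))) (- 1) (body (LT v k ts))"
      using ABC ts fv f(2,3) by simp
    moreover have "f permutes set (labs (LT v k ts))"
      using f(1) by (rule permutes_subset) (use ts in auto)
    ultimately show ?thesis unfolding odd_automorphism_def using fv by auto
  qed
qed

lemma pres_bad_edge_child:
  assumes "distinct (labs t @ labs u)" "orel m d G e (edge_body t u)" "\<not> pgood m d (shape t)"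
  shows "\<exists>f. inj_on f (vertices G) \<and> orel m d (map (map_cell f) G) (- 1) G"
proof -
  have "odd_automorphism m d t" using bad_odd_automorphism assms(1,3) by auto
  then obtain f where f: "f permutes set (labs t)" "f (root t) = root t"
    "orel m d (map (map_cell f) (body t)) (- 1) (body t)" unfolding odd_automorphism_def by blast
  have "root u \<notin> set (labs t)" using assms(1) root_in_labs[of u] unfolding distinct_append by blast
  then have ru: "f (root u) = root u" by (rule permutes_not_in[OF f(1)])
  have bu: "map (map_cell f) (body u) = body u"
    using permutes_not_in[OF f(1)] assms(1) by (intro map_id_body) auto
  have "orel m d (map (map_cell f) (edge_body t u)) (- 1) (edge_body t u)"
    using orel_context[OF f(3), of "[Edge (root t) (root u)]" "body u"] ru f(2) bu by simp
  from orel_trans[OF orel_sym[OF assms(2)] orel_trans[OF this orel_map[OF assms(2), of f]]]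
  have "orel m d (map (map_cell f) G) (e * - 1 * e) G" .
  then show ?thesis using permutes_inj_on[OF f(1)] orel_square[OF assms(2)] by auto
qed

text \<open>This will put \<open>gen G\<close> into the span of the relations. New compared with
  planted trees is the case of equal even halves of an edge centre, where the automorphism reverses
  the central edge.\<close>

lemma pres_bad:
  assumes "pres m d r G e c" "\<not> cgood m d c"
  shows "\<exists>f. inj_on f (vertices G) \<and> orel m d (map (map_cell f) G) (- 1) G"
  using assms(1)
proof cases
  case V: (vertex v ts e1)
  let ?t = "LT v None ts"
  have "\<not> pgood m d (shape ?t)" using assms(2) V(2) by simp
  then have "odd_automorphism m d ?t" using bad_odd_automorphism V(3) by blast
  then obtain f where f: "f permutes set (labs ?t)"
    "orel m d (map (map_cell f) (body ?t)) (- 1) (body ?t)" unfolding odd_automorphism_def by blast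
  from orel_trans[OF orel_sym[OF V(4)] orel_trans[OF f(2) orel_map[OF V(4), of f]]]
  have "orel m d (map (map_cell f) G) (e1 * - 1 * e1) G" .
  then show ?thesis using permutes_inj_on[OF f(1)] orel_square[OF V(4)] by auto
next
  case E: (edge t u e1)
  consider "\<not> pgood m d (shape t)" | "\<not> pgood m d (shape u)" | "shape t = shape u" "\<not> podd m d (shape u)"
    using assms(2) unfolding E(2) by (auto simp: no_odd_repeat_def split: if_splits)
  then show ?thesis
  proof cases
    case 1 then show ?thesis using pres_bad_edge_child[OF E(3,4)] by blast
  next
    case 2
    obtain a where "orel m d G a (edge_body u t)" using pres_edge_swap[OF E(3,4)] by blast
    moreover have "distinct (labs u @ labs t)" using E(3) by auto
    ultimately show ?thesis using pres_bad_edge_child 2 by blast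
  next
    case 3
    obtain f e where f: "f permutes (set (labs t) \<union> set (labs u))"
      "f (root t) = root u" "f (root u) = root t"
      "orel m d (map (map_cell f) (body t)) e (body u)" "orel m d (map (map_cell f) (body u)) e (body t)"
      "e * e = 1"
      using exchange_trees[OF 3(1) E(3), of m d] by metis
    have "orel m d (Edge (root u) (root t) # map (map_cell f) (body t) @ map (map_cell f) (body u)) (e * e) (edge_body u t)"
      by (intro orel_append orel_Cons f)
    then have "orel m d (map (map_cell f) (edge_body t u)) 1 (edge_body u t)" using f(2,3,6) by simp
    from orel_trans[OF orel_edge_swap this]
    have o: "orel m d (map (map_cell f) (edge_body t u)) (- 1) (edge_body t u)"
      using 3 by (simp add: swap_sign_same)
    from orel_trans[OF orel_sym[OF E(4)] orel_trans[OF o orel_map[OF E(4), of f]]]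
    have "orel m d (map (map_cell f) G) (e1 * - 1 * e1) G" .
    then show ?thesis using permutes_inj_on[OF f(1)] orel_square[OF E(4)] by auto
  qed
qed

section \<open>Hairy graphs of genus zero\<close>

lemma edges_simps [simp]:
  "edges [] = []" "edges (Edge v w # G) = (v, w) # edges G"
  "edges (Internal v # G) = edges G" "edges (External v i # G) = edges G"
  "edges (vcell v k # G) = edges G" "edges (A @ B) = edges A @ edges B"
  by (simp_all add: edges_def) (cases k; simp)

lemma internals_simps [simp]:
  "internals [] = []" "internals (Edge v w # G) = internals G"
  "internals (Internal v # G) = v # internals G" "internals (External v i # G) = internals G"
  "internals (A @ B) = internals A @ internals B"
  by (simp_all add: internals_def)

lemma externals_simps [simp]:
  "externals [] = []" "externals (Edge v w # G) = externals G"
  "externals (Internal v # G) = externals G" "externals (External v i # G) = v # externals G"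
  "externals (A @ B) = externals A @ externals B"
  by (simp_all add: externals_def)

lemma hair_colours_simps [simp]:
  "hair_colours [] = []" "hair_colours (Edge v w # G) = hair_colours G"
  "hair_colours (Internal v # G) = hair_colours G" "hair_colours (External v i # G) = i # hair_colours G"
  "hair_colours (A @ B) = hair_colours A @ hair_colours B"
  by (simp_all add: hair_colours_def)

lemma valence_simps [simp]:
  "valence [] x = 0"
  "valence (Edge v w # G) x = (if v = x then 1 else 0) + (if w = x then 1 else 0) + valence G x"
  "valence (vcell v k # G) x = valence G x" "valence (A @ B) x = valence A x + valence B x"
  "valence (Internal v # G) x = valence G x" "valence (External v i # G) x = valence G x"
  by (simp_all add: valence_def)

lemma length_cells: "length G = length (edges G) + length (internals G) + length (externals G)"
proof (induction G)
  case (Cons c G)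
  then show ?case by (cases c) simp_all
qed simp

lemma length_hair_colours: "length (hair_colours G) = length (externals G)"
proof (induction G)
  case (Cons c G)
  then show ?case by (cases c) simp_all
qed simp

lemma set_hair_colours: "set (hair_colours G) = {i. \<exists>v. External v i \<in> set G}"
proof (induction G)
  case (Cons c G)
  then show ?case by (cases c) auto
qed simp

lemma orel_invariants:
  "orel m d L e M \<Longrightarrow> mset (hair_colours M) = mset (hair_colours L) \<and>
     (\<forall>x. valence M x = valence L x) \<and> length M = length L \<and> graph_degree m d M = graph_degree m d L"
proof (induction rule: orel.induct)
  case (swap L e A x y B)
  then show ?case by (cases x; cases y) (auto simp: add_ac add_mset_commute)
qed (auto simp: add_ac)

lemma set_edges: "set (edges G) \<union> (set (edges G))\<inverse> = {(x, y). adj G x y}"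
  by (auto simp: edges_def adj_def split: cell.splits)

lemma components_one_imp:
  assumes "card (graph_components V es) = 1" "x \<in> V" "y \<in> V"
  shows "(x, y) \<in> (set es \<union> (set es)\<inverse>)\<^sup>*"
proof -
  let ?R = "{(v, w). v \<in> V \<and> w \<in> V \<and> (v, w) \<in> (set es \<union> (set es)\<inverse>)\<^sup>*}"
  obtain C where C: "graph_components V es = {C}" using assms(1) by (auto simp: card_1_singleton_iff)
  have "?R `` {x} \<in> graph_components V es" "?R `` {y} \<in> graph_components V es"
    using assms by (auto simp: graph_components_def quotient_def)
  then have "?R `` {x} = ?R `` {y}" using C by simp
  moreover have "y \<in> ?R `` {y}" using assms by simp
  ultimately have "y \<in> ?R `` {x}" by simp
  then show ?thesis by simp
qed

lemma components_oneI:
  assumes "V \<noteq> {}" "\<And>x y. x \<in> V \<Longrightarrow> y \<in> V \<Longrightarrow> (x, y) \<in> (set es \<union> (set es)\<inverse>)\<^sup>*"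
  shows "card (graph_components V es) = 1"
proof -
  have "graph_components V es = {V}"
    using assms unfolding graph_components_def quotient_def by auto
  then show ?thesis by simp
qed

lemma length_body: "length (body t) + 1 = 2 * length (labs t)"
proof (induction t)
  case (LT v k ts)
  then have "length (concat (map (stem v) ts)) = 2 * length (concat (map labs ts))"
    by (induction ts) auto
  then show ?case by simp
qed

section \<open>Spanning trees\<close>

lemma orel_ex_trans:
  "\<exists>e. orel m d L e M \<Longrightarrow> \<exists>e. orel m d M e N \<Longrightarrow> \<exists>e. orel m d L e N"
  using orel_trans by blast

text \<open>The growth step for a spanning tree: a new edge and its far end are sorted into the
  listing of the tree, next to the vertex \<open>a\<close>.\<close>

lemma graft:
  assumes "a \<in> set (labs t)" "w \<notin> set (labs t)" "distinct (labs t)"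
  shows "\<exists>t'. root t' = root t \<and> distinct (labs t') \<and> set (labs t') = insert w (set (labs t)) \<and>
     (\<exists>e. orel m d (body t @ [Edge a w, vcell w k]) e (body t'))"
  using assms
proof (induction t)
  case (LT v k' ts)
  show ?case
  proof (cases "a = v")
    case True
    let ?t = "LT v k' (ts @ [LT w k []])"
    have "orel m d (body (LT v k' ts) @ [Edge a w, vcell w k]) 1 (body ?t)"
      using True orel.start by simp
    moreover have "distinct (labs ?t)" "set (labs ?t) = insert w (set (labs (LT v k' ts)))"
      using LT.prems by auto
    ultimately show ?thesis by (intro exI[of _ ?t]) auto
  next
    case False
    then obtain t where t: "t \<in> set ts" "a \<in> set (labs t)" using LT.prems(1) by auto
    then obtain A B where ts: "ts = A @ t # B" by (meson split_list)
    have "w \<notin> set (labs t)" "distinct (labs t)" using LT.prems ts by auto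
    from LT.IH[OF t this] obtain t' where t': "root t' = root t" "distinct (labs t')"
      "set (labs t') = insert w (set (labs t))" "\<exists>e. orel m d (body t @ [Edge a w, vcell w k]) e (body t')"
      by blast
    let ?X = "vcell v k' # concat (map (stem v) A) @ [Edge v (root t)]" and ?Y = "concat (map (stem v) B)"
    have o1: "\<exists>e. orel m d (body (LT v k' ts) @ [Edge a w, vcell w k]) e (?X @ (body t @ [Edge a w, vcell w k]) @ ?Y)"
      using ts by (intro orel_mset) simp
    obtain e where "orel m d (body t @ [Edge a w, vcell w k]) e (body t')" using t'(4) by blast
    then have o2: "\<exists>e. orel m d (?X @ (body t @ [Edge a w, vcell w k]) @ ?Y) e (?X @ body t' @ ?Y)"
      using orel_context by blast
    have "?X @ body t' @ ?Y = body (LT v k' (A @ t' # B))" using t'(1) by simp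
    then have "\<exists>e. orel m d (body (LT v k' ts) @ [Edge a w, vcell w k]) e (body (LT v k' (A @ t' # B)))"
      using orel_ex_trans[OF o1 o2] by (simp only:)
    moreover have "distinct (labs (LT v k' (A @ t' # B)))"
      "set (labs (LT v k' (A @ t' # B))) = insert w (set (labs (LT v k' ts)))"
      using LT.prems ts t'(2,3) by auto
    moreover have "root (LT v k' (A @ t' # B)) = root (LT v k' ts)" by simp
    ultimately show ?thesis by blast
  qed
qed

lemma rtrancl_crossing:
  assumes "(x, y) \<in> R\<^sup>*" "x \<in> A" "y \<notin> A"
  shows "\<exists>u v. (u, v) \<in> R \<and> u \<in> A \<and> v \<notin> A"
  using assms by (induction rule: rtrancl_induct) auto

text \<open>A subtree with \<open>Suc n\<close> vertices is grown inside \<open>G\<close>, and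
  \<open>R\<close> keeps the cells that are not yet used. As long as a vertex is missing,
  connectedness supplies an edge that leaves the subtree.\<close>

lemma partial_presentation:
  assumes h: "hairy_graph r G" and n: "n < card (vertices G)"
  shows "\<exists>t R. distinct (labs t) \<and> length (labs t) = Suc n \<and> (\<exists>e. orel m d G e (body t @ R))"
  using n
proof (induction n)
  case 0
  then obtain v where "v \<in> vertices G" by fastforce
  then obtain k where "vcell v k \<in> set G" by (auto simp: vertices_conv)
  then obtain A B where G: "G = A @ vcell v k # B" by (meson split_list)
  have "\<exists>e. orel m d G e (body (LT v k []) @ (A @ B))" by (rule orel_mset) (simp add: G)
  then show ?case by (intro exI[of _ "LT v k []"] exI[of _ "A @ B"]) auto
next
  case (Suc n)
  then obtain t R e where t: "distinct (labs t)" "length (labs t) = Suc n" "orel m d G e (body t @ R)"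
    by auto
  have vc: "vcell x k \<in> set G \<longleftrightarrow> vcell x k \<in> set (body t @ R)" for x k using orel_adj[OF t(3)] by blast
  have sub: "set (labs t) \<subseteq> vertices G" using vc vcell_body_labs by (fastforce simp: vertices_conv)
  have "card (set (labs t)) = Suc n" using t by (simp add: distinct_card)
  then obtain y where y: "y \<in> vertices G" "y \<notin> set (labs t)" using Suc.prems sub by (metis less_irrefl subsetI subset_antisym)
  have "card (graph_components (vertices G) (edges G)) = 1" using h by (simp add: hairy_graph_def)
  from components_one_imp[OF this _ y(1), of "root t"] sub
  have "(root t, y) \<in> {(x, y). adj G x y}\<^sup>*" unfolding set_edges using root_in_labs by blast
  from rtrancl_crossing[OF this root_in_labs y(2)] obtain a w
    where aw: "adj G a w" "a \<in> set (labs t)" "w \<notin> set (labs t)" by blast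
  have "adj (body t @ R) a w" using aw(1) orel_adj[OF t(3)] by blast
  moreover have "\<not> adj (body t) a w" using adj_body[of t a w] aw(3) by blast
  ultimately have "adj R a w" by simp
  then obtain C where C: "C = Edge a w \<or> C = Edge w a" "C \<in> set R" by (auto simp: adj_def)
  then obtain A B where R: "R = A @ C # B" by (meson split_list)
  have "w \<in> vertices G"
  proof -
    have "(a, w) \<in> set (edges G) \<or> (w, a) \<in> set (edges G)" using aw(1) set_edges[of G] by auto
    then show ?thesis using h by (auto simp: hairy_graph_def)
  qed
  then obtain k where "vcell w k \<in> set (body t @ R)" using vc by (auto simp: vertices_conv)
  then have "vcell w k \<in> set (A @ B)" using vcell_body_labs[of w t] aw(3) R C(1) by auto
  then obtain A' B' where AB: "A @ B = A' @ vcell w k # B'" by (meson split_list)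
  have "mset (A @ B) = mset (A' @ vcell w k # B')" using AB by simp
  then have m1: "mset (body t @ R) = mset ((body t) @ C # vcell w k # (A' @ B'))" using R by simp
  have "\<exists>e. orel m d (body t @ R) e (body t @ C # vcell w k # (A' @ B'))" by (rule orel_mset[OF m1])
  moreover have "\<exists>e. orel m d (body t @ C # vcell w k # (A' @ B')) e (body t @ Edge a w # vcell w k # (A' @ B'))"
    using C(1) orel.start orel_flip1 by fast
  ultimately have o1: "\<exists>e. orel m d G e (body t @ Edge a w # vcell w k # (A' @ B'))"
    using t(3) orel_ex_trans by blast
  obtain t' where t': "distinct (labs t')" "set (labs t') = insert w (set (labs t))"
    "\<exists>e. orel m d (body t @ [Edge a w, vcell w k]) e (body t')"
    using graft[OF aw(2,3) t(1)] by blast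
  have "\<exists>e. orel m d (body t @ Edge a w # vcell w k # (A' @ B')) e (body t' @ (A' @ B'))"
    using t'(3) orel_context[of m d "body t @ [Edge a w, vcell w k]" _ "body t'" "[]" "A' @ B'"] by fastforce
  then have "\<exists>e. orel m d G e (body t' @ (A' @ B'))" using o1 orel_ex_trans by blast
  moreover have "length (labs t') = Suc (Suc n)"
    using t' t aw(3) by (metis card_insert_disjoint distinct_card finite_set)
  ultimately show ?case using t'(1) by blast
qed

lemma card_vertices: "distinct (internals G @ externals G) \<Longrightarrow> card (vertices G) = length (internals G) + length (externals G)"
  unfolding vertices_def by (simp add: card_Un_disjoint distinct_card)

text \<open>In genus zero a graph with \<open>N\<close> vertices has \<open>2 N - 1\<close> cells,
  just as many as the listing of a tree on all these vertices. So the spanning tree leaves no cell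
  over.\<close>

lemma rooted_presentation:
  assumes h: "hairy_graph r G" and g: "genus G = 0"
  shows "\<exists>t e. distinct (labs t) \<and> orel m d G e (body t)"
proof -
  have "card (vertices G) = length (internals G) + length (externals G)"
    using h card_vertices by (auto simp: hairy_graph_def)
  moreover have "length (edges G) + 1 = card (vertices G)"
    using g h by (simp add: genus_def first_betti_def hairy_graph_def)
  moreover have "length (externals G) > 0" using h by (simp add: hairy_graph_def)
  ultimately have lG: "length G + 1 = 2 * card (vertices G)" "card (vertices G) > 0"
    using length_cells[of G] by linarith+
  obtain t R e where t: "distinct (labs t)" "length (labs t) = card (vertices G)" "orel m d G e (body t @ R)"
    using partial_presentation[OF h, of "card (vertices G) - 1" m d] lG(2) by auto
  have "length (body t @ R) = length G" using orel_invariants[OF t(3)] by simp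
  then have "length R = 0" using length_body[of t] t(2) lG(1) unfolding length_append by linarith
  then have "R = []" by simp
  then show ?thesis using t by auto
qed

section \<open>Valence conditions on trees\<close>

fun kind_ok :: "nat \<Rightarrow> nat option \<Rightarrow> nat \<Rightarrow> bool" where
  "kind_ok r None n \<longleftrightarrow> n \<ge> 3"
| "kind_ok r (Some i) n \<longleftrightarrow> n = 1 \<and> i \<in> {1..r}"

lemma hairy_kind_ok:
  assumes "hairy_graph r G" "vcell x k \<in> set G"
  shows "kind_ok r k (valence G x)"
proof (cases k)
  case None
  then have "x \<in> set (internals G)" using assms(2) by (force simp: internals_def split: cell.splits)
  then show ?thesis using assms(1) None by (simp add: hairy_graph_def)
next
  case (Some i)
  then have "x \<in> set (externals G)" "i \<in> set (hair_colours G)"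
    using assms(2) by (force simp: externals_def hair_colours_def split: cell.splits)+
  then show ?thesis using assms(1) Some by (auto simp: hairy_graph_def)
qed

lemma valence_concat: "valence (concat (map f ts)) x = (\<Sum>t\<leftarrow>ts. valence (f t) x)"
  by (induction ts) auto

lemma valence_outside: "x \<notin> set (labs t) \<Longrightarrow> valence (body t) x = 0"
proof (induction t)
  case (LT v k ts)
  then show ?case by (auto simp: valence_concat sum_list_eq_0_iff)
qed

lemma valence_root:
  assumes "distinct (labs (LT v k ts))"
  shows "valence (body (LT v k ts)) v = length ts"
proof -
  have "valence (stem v t) v = 1" if "t \<in> set ts" for t
  proof -
    have "v \<notin> set (labs t)" using assms that by auto
    moreover from this have "root t \<noteq> v" by auto
    ultimately show ?thesis using valence_outside by simp
  qed
  then have "map (\<lambda>t. valence (stem v t) v) ts = map (\<lambda>_. 1) ts" by (intro map_cong) auto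
  then show ?thesis by (simp add: valence_concat sum_list_triv del: map_eq_conv valence_simps(2))
qed

lemma valence_child:
  assumes "distinct (labs (LT v k ts))" "t \<in> set ts" "x \<in> set (labs t)"
  shows "valence (body (LT v k ts)) x = valence (body t) x + (if x = root t then 1 else 0)"
proof -
  obtain A B where ts: "ts = A @ t # B" using assms(2) by (meson split_list)
  have "x \<noteq> v" using assms by auto
  have "valence (stem v u) x = 0" if "u \<in> set (A @ B)" for u
  proof -
    have "x \<notin> set (labs u)" using assms ts that by auto
    moreover from this have "root u \<noteq> x" by auto
    ultimately show ?thesis using valence_outside \<open>x \<noteq> v\<close> by simp
  qed
  then have "(\<Sum>u\<leftarrow>A. valence (stem v u) x) = 0" "(\<Sum>u\<leftarrow>B. valence (stem v u) x) = 0"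
    by (auto simp: sum_list_eq_0_iff simp del: valence_simps(2))
  then show ?thesis using ts \<open>x \<noteq> v\<close> by (auto simp: valence_concat)
qed

text \<open>The additional 1 at the root is the stem, which is not a cell of
  \<open>body t\<close>.\<close>

lemma shape_pwf:
  assumes "distinct (labs t)"
    "\<And>x k. vcell x k \<in> set (body t) \<Longrightarrow> kind_ok r k (valence (body t) x + (if x = root t then 1 else 0))"
  shows "pwf r (shape t)"
  using assms
proof (induction t)
  case (LT v k ts)
  have "pwf r (shape t)" if t: "t \<in> set ts" for t
  proof (rule LT.IH[OF t])
    show "distinct (labs t)" using LT.prems(1) t by (auto simp: distinct_concat_iff)
    fix x k' assume x: "vcell x k' \<in> set (body t)"
    then have "x \<in> set (labs t)" using vcell_body_labs by metis
    moreover from this have "x \<noteq> v" using LT.prems(1) t by auto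
    moreover have "vcell x k' \<in> set (body (LT v k ts))" using x t by auto
    ultimately show "kind_ok r k' (valence (body t) x + (if x = root t then 1 else 0))"
      using LT.prems(2)[of x k'] valence_child[OF LT.prems(1) t, of x] by simp
  qed
  moreover have "kind_ok r k (Suc (length ts))"
    using LT.prems(2)[of v k] valence_root[OF LT.prems(1)] by simp
  ultimately show ?case by (cases k) (auto simp: pwf_PN)
qed

lemma pwf_kind_ok:
  "pwf r (shape t) \<Longrightarrow> distinct (labs t) \<Longrightarrow> vcell x k \<in> set (body t) \<Longrightarrow>
    kind_ok r k (valence (body t) x + (if x = root t then 1 else 0))"
proof (induction t)
  case (LT v k' ts)
  have ch: "\<forall>t\<in>set ts. pwf r (shape t)" and ok: "kind_ok r k' (Suc (length ts))"
    using LT.prems(1) by (cases k'; auto simp: pwf_PN)+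
  show ?case
  proof (cases "vcell x k = vcell v k'")
    case True
    then show ?thesis using ok valence_root[OF LT.prems(2)] by simp
  next
    case False
    then obtain t where t: "t \<in> set ts" "vcell x k \<in> set (body t)" using LT.prems(3) by auto
    then have "x \<in> set (labs t)" using vcell_body_labs by metis
    moreover from this have "x \<noteq> v" using LT.prems(2) t by auto
    moreover have "kind_ok r k (valence (body t) x + (if x = root t then 1 else 0))"
      using LT.IH[OF t(1) _ _ t(2)] ch t(1) LT.prems(2) by (auto simp: distinct_concat_iff)
    ultimately show ?thesis using valence_child[OF LT.prems(2) t(1), of x] by simp
  qed
qed

primrec pleaves :: "ptree \<Rightarrow> nat multiset" where
  "pleaves (PN k M) = (case k of None \<Rightarrow> {#} | Some i \<Rightarrow> {#i#}) + (\<Sum>\<^sub># (image_mset pleaves M))"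

fun cleaves :: "cform \<Rightarrow> nat multiset" where
  "cleaves (VC M) = (\<Sum>\<^sub># (image_mset pleaves M))"
| "cleaves (EC M) = (\<Sum>\<^sub># (image_mset pleaves M))"

lemma hair_colours_body: "mset (hair_colours (body t)) = pleaves (shape t)"
proof (induction t)
  case (LT v k ts)
  then have "mset (hair_colours (concat (map (stem v) ts))) = (\<Sum>\<^sub># (image_mset pleaves (mset (map shape ts))))"
    by (induction ts) auto
  then show ?case by (cases k) simp_all
qed

lemma pres_invariants:
  assumes "pres m d r G e c"
  shows "mset (hair_colours G) = cleaves c \<and> graph_degree m d G = cdegree m d c"
  using assms
proof cases
  case (vertex v ts e1)
  have "mset (hair_colours G) = pleaves (shape (LT v None ts))"
    using orel_invariants[OF vertex(4)] hair_colours_body by metis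
  moreover have "graph_degree m d G = pdegree m d (shape (LT v None ts)) - (int d - 1)"
    using orel_invariants[OF vertex(4)] graph_degree_body by metis
  ultimately show ?thesis unfolding vertex(2) by simp
next
  case (edge t u e1)
  show ?thesis
    using orel_invariants[OF edge(4)] hair_colours_body[of t] hair_colours_body[of u]
      graph_degree_body[of m d t] graph_degree_body[of m d u]
    unfolding edge(2) by simp
qed

section \<open>Hairy graphs realizing a given form\<close>

lemma pwf_pleaves: "pwf r T \<Longrightarrow> pleaves T \<noteq> {#}"
proof (induction rule: pwf.induct)
  case (2 M)
  then obtain T where "T \<in># M" by fastforce
  then obtain N where "M = add_mset T N" by (meson multi_member_split)
  with 2 \<open>T \<in># M\<close> show ?case by auto
qed simp

lemma body_connected: "x \<in> set (labs t) \<Longrightarrow> (root t, x) \<in> {(x, y). adj (body t) x y}\<^sup>*"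
proof (induction t)
  case (LT v k ts)
  show ?case
  proof (cases "x = v")
    case False
    then obtain t where t: "t \<in> set ts" "x \<in> set (labs t)" using LT.prems by auto
    have "adj (body (LT v k ts)) y z" if "adj (body t) y z" for y z
      using t(1) that by auto
    then have "{(x, y). adj (body t) x y} \<subseteq> {(x, y). adj (body (LT v k ts)) x y}" by auto
    then have "(root t, x) \<in> {(x, y). adj (body (LT v k ts)) x y}\<^sup>*"
      using LT.IH[OF t] rtrancl_mono by blast
    moreover have "adj (body (LT v k ts)) v (root t)" using t(1) by auto
    ultimately show ?thesis by (auto intro: converse_rtrancl_into_rtrancl)
  qed simp
qed

lemma vertices_body: "vertices (body t) = set (labs t)"
  by (simp add: vertices_conv vcell_body_labs[symmetric])

lemma cells_body: "mset (internals (body t) @ externals (body t)) = mset (labs t)"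
proof (induction t)
  case (LT v k ts)
  then have "mset (internals (concat (map (stem v) ts)) @ externals (concat (map (stem v) ts))) = mset (concat (map labs ts))"
    by (induction ts) (auto simp: add_ac)
  then show ?case by (cases k) simp_all
qed

lemma hairy_body:
  assumes dis: "distinct (labs t)" and ext: "externals (body t) \<noteq> []"
    and ok: "\<And>x k. vcell x k \<in> set (body t) \<Longrightarrow> kind_ok r k (valence (body t) x)"
  shows "hairy_graph r (body t)" "genus (body t) = 0"
proof -
  have d: "distinct (internals (body t) @ externals (body t))"
    using dis cells_body[of t] mset_eq_imp_distinct_iff by blast
  have comp: "card (graph_components (vertices (body t)) (edges (body t))) = 1"
  proof (rule components_oneI)
    show "vertices (body t) \<noteq> {}" unfolding vertices_body by (cases t) simp
    fix x y assume "x \<in> vertices (body t)" "y \<in> vertices (body t)"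
    then have xy: "(root t, x) \<in> {(x, y). adj (body t) x y}\<^sup>*" "(root t, y) \<in> {(x, y). adj (body t) x y}\<^sup>*"
      unfolding vertices_body by (simp_all only: body_connected)
    have "sym {(x, y). adj (body t) x y}" by (auto simp: sym_def adj_sym)
    then have "(x, root t) \<in> {(x, y). adj (body t) x y}\<^sup>*" using xy(1) by (meson sym_rtrancl symD)
    then show "(x, y) \<in> (set (edges (body t)) \<union> (set (edges (body t)))\<inverse>)\<^sup>*"
      unfolding set_edges using xy(2) by (rule rtrancl_trans)
  qed
  have "v \<in> vertices (body t) \<and> w \<in> vertices (body t)" if "(v, w) \<in> set (edges (body t))" for v w
    using that set_edges[of "body t"] adj_body[of t v w] unfolding vertices_body by auto
  moreover have "i \<in> {1..r}" if i: "i \<in> set (hair_colours (body t))" for i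
  proof -
    obtain v where "External v i \<in> set (body t)" using i unfolding set_hair_colours by blast
    then show ?thesis using ok[of v "Some i"] by simp
  qed
  moreover have "valence (body t) v = 1" if v: "v \<in> set (externals (body t))" for v
  proof -
    have "\<exists>i. External v i \<in> set (body t)" using v by (auto simp: externals_def split: cell.splits)
    then obtain i where "External v i \<in> set (body t)" ..
    then show ?thesis using ok[of v "Some i"] by simp
  qed
  moreover have "valence (body t) v \<ge> 3" if "v \<in> set (internals (body t))" for v
  proof -
    have "Internal v \<in> set (body t)" using that by (auto simp: internals_def split: cell.splits)
    then show ?thesis using ok[of v None] by simp
  qed
  ultimately show "hairy_graph r (body t)"
    unfolding hairy_graph_def using d comp ext by auto
  have "card (vertices (body t)) = length (labs t)" unfolding vertices_body using dis by (simp add: distinct_card)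
  moreover have "length (internals (body t)) + length (externals (body t)) = length (labs t)"
    using arg_cong[OF cells_body[of t], of size] by simp
  ultimately show "genus (body t) = 0"
    using length_cells[of "body t"] length_body[of t] comp by (simp add: genus_def first_betti_def)
qed

text \<open>Gluing keeps the edges and the connectedness and turns all external vertices into one,
  so the Betti number rises from zero by the number of identifications.\<close>

lemma complexity_genus_zero:
  assumes h: "hairy_graph r G" and g: "genus G = 0"
  shows "complexity G = int (length (externals G)) - 1"
proof -
  have dis: "distinct (internals G)" "set (internals G) \<inter> set (externals G) = {}" "externals G \<noteq> []"
    "distinct (internals G @ externals G)"
    using h by (auto simp: hairy_graph_def)
  let ?V = "glue G ` vertices G" and ?E = "map (map_prod (glue G) (glue G)) (edges G)"
  have V: "?V = insert None (Some ` set (internals G))"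
    using dis(2,3) by (force simp: vertices_def glue_def image_iff)
  have "card (graph_components ?V ?E) = 1"
  proof (rule components_oneI)
    fix x y assume "x \<in> ?V" "y \<in> ?V"
    then obtain a b where ab: "a \<in> vertices G" "b \<in> vertices G" "x = glue G a" "y = glue G b" by blast
    have "card (graph_components (vertices G) (edges G)) = 1" using h by (simp add: hairy_graph_def)
    from components_one_imp[OF this ab(1,2)] have "(a, b) \<in> (set (edges G) \<union> (set (edges G))\<inverse>)\<^sup>*" .
    then have "(glue G a, glue G b) \<in> (set ?E \<union> (set ?E)\<inverse>)\<^sup>*"
    proof (induction rule: rtrancl_induct)
      case (step y z)
      then have "(glue G y, glue G z) \<in> set ?E \<union> (set ?E)\<inverse>" by force
      with step.IH show ?case by (rule rtrancl_into_rtrancl)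
    qed simp
    then show "(x, y) \<in> (set ?E \<union> (set ?E)\<inverse>)\<^sup>*" using ab by simp
  qed (use V in simp)
  moreover have "card ?V = Suc (length (internals G))"
    unfolding V using dis(1) by (simp add: card_image distinct_card)
  moreover have "int (length (edges G)) + 1 = int (length (internals G)) + int (length (externals G))"
    using g h card_vertices[OF dis(4)] by (simp add: genus_def first_betti_def hairy_graph_def)
  ultimately show ?thesis by (simp add: complexity_def first_betti_def)
qed

text \<open>The lower bound \<open>n\<close> on the labels is what the induction needs to give
  siblings disjoint sets of labels.\<close>

lemma labelled_tree_exists:
  "\<exists>t :: nat ltree. shape t = T \<and> distinct (labs t) \<and> (\<forall>x\<in>set (labs t). n \<le> x)"
proof (induction T arbitrary: n)
  case (PN k M)
  obtain Ts where Ts: "mset Ts = M" using ex_mset by blast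
  have "\<exists>ts :: nat ltree list. map shape ts = Ts \<and> distinct (concat (map labs ts)) \<and> (\<forall>x\<in>set (concat (map labs ts)). n \<le> x)"
    if "\<forall>T\<in>set Ts. T \<in># M" for n
    using that
  proof (induction Ts arbitrary: n)
    case (Cons T Ts)
    from PN[of T n] Cons.prems obtain t :: "nat ltree"
      where t: "shape t = T" "distinct (labs t)" "\<forall>x\<in>set (labs t). n \<le> x" by auto
    define n' where "n' = Suc (Max (set (labs t)))"
    from Cons.IH[of "max n n'"] Cons.prems obtain ts :: "nat ltree list" where
      ts: "map shape ts = Ts" "distinct (concat (map labs ts))" "\<forall>x\<in>set (concat (map labs ts)). max n n' \<le> x" by auto
    have "x < n'" if "x \<in> set (labs t)" for x using that by (simp add: n'_def less_Suc_eq_le)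
    then have "set (labs t) \<inter> set (concat (map labs ts)) = {}" using ts(3) by fastforce
    then show ?case using t ts by (intro exI[of _ "t # ts"]) auto
  qed simp
  from this[of "Suc n"] Ts obtain ts :: "nat ltree list" where
    ts: "map shape ts = Ts" "distinct (concat (map labs ts))" "\<forall>x\<in>set (concat (map labs ts)). Suc n \<le> x"
    by auto
  have "shape (LT n k ts) = PN k M" using ts(1) Ts by (simp only: shape.simps)
  moreover have "distinct (labs (LT n k ts))" "\<forall>x\<in>set (labs (LT n k ts)). n \<le> x"
    using ts(2,3) by fastforce+
  ultimately show ?case by blast
qed

lemma kind_ok_node:
  assumes dis: "distinct (labs (LT v k ts))" and "\<forall>t\<in>set ts. pwf r (shape t)" "kind_ok r k (length ts)"
    "vcell x k' \<in> set (body (LT v k ts))"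
  shows "kind_ok r k' (valence (body (LT v k ts)) x)"
proof (cases "vcell x k' = vcell v k")
  case True
  then show ?thesis using valence_root[OF dis] assms(3) by simp
next
  case False
  then obtain t where t: "t \<in> set ts" "vcell x k' \<in> set (body t)" using assms(4) by auto
  then have "x \<in> set (labs t)" using vcell_body_labs by metis
  then show ?thesis
    using pwf_kind_ok[OF _ _ t(2)] assms(2) t(1) dis valence_child[OF dis t(1), of x]
    by (auto simp: distinct_concat_iff)
qed

lemma externals_body:
  assumes "t \<in> set ts" "pwf r (shape t)"
  shows "externals (body (LT v k ts)) \<noteq> []"
proof -
  have "hair_colours (body t) \<noteq> []"
    using pwf_pleaves[OF assms(2)] hair_colours_body[of t] by auto
  then have "hair_colours (body (LT v k ts)) \<noteq> []"
    using assms(1) by (cases k) (auto simp: hair_colours_def)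
  then show ?thesis using length_hair_colours by (metis length_0_conv)
qed

lemma cform_realized:
  assumes "cwf r c"
  shows "\<exists>G e. pres m d r G e c \<and> hairy_graph r G \<and> genus G = 0"
proof (cases c)
  case (VC M)
  obtain t :: "nat ltree" where t: "shape t = PN None M" "distinct (labs t)"
    using labelled_tree_exists by blast
  obtain v ts where t': "t = LT v None ts" using t(1) by (cases t) auto
  have M: "mset (map shape ts) = M" using t(1) t' by simp
  have dis: "distinct (labs (LT v None ts))" using t(2) t' by simp
  have "cwf r (VC (mset (map shape ts)))" using assms VC M by simp
  from pres.vertex[OF dis orel.start this] have p: "\<exists>e. pres m d r (body t) e c" using M VC t' by auto
  have ch: "\<forall>t\<in>set ts. pwf r (shape t)" "kind_ok r None (length ts)" using assms VC M by auto
  then obtain u where "u \<in> set ts" by (cases ts) auto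
  then have "externals (body (LT v None ts)) \<noteq> []" using externals_body[of u ts r v None] ch(1) by blast
  from hairy_body[OF dis this kind_ok_node[OF dis ch]] p t' show ?thesis by blast
next
  case (EC M)
  have "size M = 2" using assms EC by simp
  then obtain T N where "M = add_mset T N" "size N = 1" by (cases M) auto
  then obtain U where M: "M = {#T, U#}" using size_1_singleton_mset by blast
  obtain t :: "nat ltree" where t: "shape t = T" "distinct (labs t)"
    using labelled_tree_exists by blast
  obtain u :: "nat ltree" where u: "shape u = U" "distinct (labs u)" "\<forall>x\<in>set (labs u). Suc (Max (set (labs t))) \<le> x"
    using labelled_tree_exists by blast
  have "x \<le> Max (set (labs t))" if "x \<in> set (labs t)" for x using that by simp
  then have "set (labs t) \<inter> set (labs u) = {}" using u(3) by (metis disjoint_iff not_less_eq_eq)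
  then have dis: "distinct (labs t @ labs u)" using t(2) u(2) by simp
  obtain v k ts where t': "t = LT v k ts" by (cases t) auto
  \<comment> \<open>The two halves joined by the central edge form a rooted tree when
    \<open>u\<close> becomes a child of the root of \<open>t\<close>, so \<open>hairy_body\<close>
    applies here too.\<close>
  let ?t = "LT v k (ts @ [u])"
  have dis': "distinct (labs ?t)" using dis t' by auto
  have "\<exists>e. orel m d (body ?t) e (edge_body t u)" by (rule orel_mset) (simp add: t')
  then obtain e where e: "orel m d (body ?t) e (edge_body t u)" by blast
  have c: "c = EC {#shape t, shape u#}" using EC M t(1) u(1) by simp
  have cw: "cwf r (EC {#shape t, shape u#})" using assms unfolding c .
  from pres.edge[OF dis e this] have p: "\<exists>e. pres m d r (body ?t) e c"
    unfolding c by (rule exI)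
  have "shape t \<in># {#shape t, shape u#}" "shape u \<in># {#shape t, shape u#}" by simp_all
  then have w: "pwf r (shape t)" "pwf r (shape u)" using cw unfolding cwf.simps by blast+
  then have ch: "\<forall>t\<in>set (ts @ [u]). pwf r (shape t)" "kind_ok r k (length (ts @ [u]))"
    unfolding t' by (cases k; auto simp: pwf_PN)+
  have "externals (body ?t) \<noteq> []" using externals_body[of u "ts @ [u]" r v k] w(2) by simp
  from hairy_body[OF dis' this kind_ok_node[OF dis' ch]] p show ?thesis by blast
qed

lemma two_max_insert2: "\<forall>T\<in>#M. height T \<le> h \<Longrightarrow> M = add_mset T (add_mset U N) \<Longrightarrow> height T = h \<Longrightarrow> height U = h \<Longrightarrow> two_max M"
  unfolding two_max_def by (intro exI[of _ h]) simp

text \<open>The rooting of minimal height is at a centre.\<close>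

lemma presentation_exists:
  assumes h: "hairy_graph r G" and g: "genus G = 0"
  shows "\<exists>e c. pres m d r G e c"
proof -
  define P where "P t \<longleftrightarrow> distinct (labs t) \<and> (\<exists>e. orel m d G e (body t))" for t
  have "\<exists>t. P t" using rooted_presentation[OF h g, of m d] by (auto simp: P_def)
  then obtain t where t: "P t" and min: "\<And>t'. P t' \<Longrightarrow> height (shape t) \<le> height (shape t')"
    using ex_has_least_nat[of P _ "\<lambda>t. height (shape t)"] by blast
  obtain v k ts where t': "t = LT v k ts" by (cases t) auto
  have dis: "distinct (labs (LT v k ts))" using t t' by (simp add: P_def)
  obtain e where o: "orel m d G e (body (LT v k ts))" using t t' by (auto simp: P_def)
  have val: "valence (body (LT v k ts)) x = valence G x" for x using orel_invariants[OF o] by blast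
  have ok: "kind_ok r k' (valence (body (LT v k ts)) x)" if "vcell x k' \<in> set (body (LT v k ts))" for x k'
    using that hairy_kind_ok[OF h, of x k'] orel_adj[OF o] val by simp
  have child: "pwf r (shape c)" if c: "c \<in> set ts" for c
  proof (rule shape_pwf)
    show "distinct (labs c)" using dis c by (auto simp: distinct_concat_iff)
    fix x k' assume x: "vcell x k' \<in> set (body c)"
    then have "x \<in> set (labs c)" using vcell_body_labs by metis
    moreover have "vcell x k' \<in> set (body (LT v k ts))" using x c by auto
    ultimately show "kind_ok r k' (valence (body c) x + (if x = root c then 1 else 0))"
      using ok[of x k'] valence_child[OF dis c, of x] by simp
  qed
  have okr: "kind_ok r k (length ts)" using ok[of v k] valence_root[OF dis] by simp
  show ?thesis
  proof (cases "two_max (mset (map shape ts))")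
    case True
    then obtain n where "size (filter_mset (\<lambda>T. height T = n) (mset (map shape ts))) \<ge> 2"
      unfolding two_max_def by blast
    then have "2 \<le> size (mset (map shape ts))" using size_filter_mset_lesseq le_trans by blast
    then have k: "k = None" "length ts \<ge> 3" using okr by (cases k; simp)+
    have "cwf r (VC (mset (map shape ts)))" using True k child by simp
    from pres.vertex[OF _ _ this] dis o show ?thesis unfolding k by blast
  next
    case False
    have "ts \<noteq> []" using okr by (cases k) auto
    then have "mset (map shape ts) \<noteq> {#}" by simp
    from height_attained[OF this, of k] obtain c where c: "c \<in> set ts"
      "height (shape (LT v k ts)) = Suc (height (shape c))" by auto
    obtain A B where ts: "ts = A @ c # B" using c(1) by (meson split_list)
    have le: "height (shape u) \<le> height (shape c)" if "u \<in> set ts" for u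
      using height_shape_child[OF that, of v k] c(2) by simp
    have lt: "height (shape u) < height (shape c)" if u: "u \<in> set (A @ B)" for u
    proof (rule ccontr)
      assume "\<not> ?thesis"
      then have eq: "height (shape u) = height (shape c)" using le[of u] u ts by auto
      obtain N where N: "mset (map shape (A @ B)) = add_mset (shape u) N"
        using u by (metis image_eqI mset_add set_map set_mset_mset)
      have "mset (map shape ts) = add_mset (shape c) (add_mset (shape u) N)" using ts N by simp
      from two_max_insert2[OF _ this HOL.refl eq] le False show False by auto
    qed
    obtain w k' us where c': "c = LT w k' us" by (cases c) auto
    \<comment> \<open>The child \<open>c\<close> is the only one of maximal height. The root moves
      to \<open>c\<close>: the remainder \<open>?b\<close> of the tree at \<open>v\<close> becomes a
      child of it.\<close>
    let ?b = "LT v k (A @ B)"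
    let ?t = "LT w k' (us @ [?b])"
    have "\<exists>e. orel m d (body (LT v k ts)) e (Edge v w # body c @ body ?b)"
      by (rule orel_mset) (simp add: ts c')
    moreover have "\<exists>e. orel m d (Edge v w # body c @ body ?b) e (Edge w v # body c @ body ?b)"
      using orel_flip1[of m d "[]" v w] by auto
    moreover have "\<exists>e. orel m d (Edge w v # body c @ body ?b) e (body ?t)"
      by (rule orel_mset) (simp add: c')
    ultimately have "\<exists>e. orel m d G e (body ?t)" using o orel_trans by blast
    moreover have "distinct (labs ?t)" using dis ts c' by auto
    ultimately have "P ?t" by (simp add: P_def)
    from min[OF this] have m1: "Suc (height (shape c)) \<le> height (shape ?t)" using c(2) t' by simp
    \<comment> \<open>Otherwise the rooting at \<open>c\<close> would be no higher than
      \<open>c\<close> itself, below the minimal height, which is one more than that of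
      \<open>c\<close>.\<close>
    have "\<not> height (shape ?b) < height (shape c)"
    proof
      assume *: "height (shape ?b) < height (shape c)"
      have "height (shape u) < height (shape c)" if "u \<in> set us" for u
        using height_shape_child[OF that, of w k'] c' by simp
      with * have "height (shape ?t) < Suc (height (shape c))"
        unfolding shape.simps[of w k' "us @ [?b]"] height_less_iff by auto
      with m1 show False by simp
    qed
    moreover have "height (shape ?b) < Suc (height (shape c))"
      unfolding shape.simps[of v k "A @ B"] height_less_iff using lt by auto
    ultimately have hb: "height (shape ?b) = height (shape c)" by simp
    have disb: "distinct (labs ?b @ labs c)" using dis ts by auto
    have "\<exists>e. orel m d (body (LT v k ts)) e (edge_body ?b c)"
      by (rule orel_mset) (simp add: ts)
    then obtain e' where e': "orel m d (body (LT v k ts)) e' (edge_body ?b c)" by blast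
    have "pwf r (shape ?b)"
    proof (rule shape_pwf)
      show "distinct (labs ?b)" using disb by auto
      fix x k'' assume x: "vcell x k'' \<in> set (body ?b)"
      then have xb: "x \<in> set (labs ?b)" using vcell_body_labs by metis
      then have "x \<notin> set (labs c)" using disb by auto
      moreover from this have "root c \<noteq> x" by auto
      moreover have "valence (body (LT v k ts)) x = valence (edge_body ?b c) x"
        using orel_invariants[OF e'] by simp
      ultimately have "valence (body (LT v k ts)) x = valence (body ?b) x + (if x = v then 1 else 0)"
        using valence_outside[of x c] by (simp del: body.simps)
      moreover have "vcell x k'' \<in> set (body (LT v k ts))" using x ts by auto
      ultimately show "kind_ok r k'' (valence (body ?b) x + (if x = root ?b then 1 else 0))"
        using ok[of x k''] by simp
    qed
    then have "cwf r (EC {#shape ?b, shape c#})" using child[OF c(1)] hb by (auto simp del: shape.simps)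
    from pres.edge[OF disb orel_trans[OF e' o] this] show ?thesis by blast
  qed
qed

section \<open>Dimensions of quotients\<close>

definition lin_ext :: "('a \<Rightarrow> rat) \<Rightarrow> ('a \<Rightarrow>\<^sub>0 rat) \<Rightarrow> rat" where
  "lin_ext f v = (\<Sum>x\<in>Poly_Mapping.keys v. Poly_Mapping.lookup v x * f x)"

lemma lin_ext_superset:
  "finite S \<Longrightarrow> Poly_Mapping.keys v \<subseteq> S \<Longrightarrow> lin_ext f v = (\<Sum>x\<in>S. Poly_Mapping.lookup v x * f x)"
  unfolding lin_ext_def by (rule sum.mono_neutral_left) (auto simp: in_keys_iff)

lemma lin_ext_add: "lin_ext f (v + w) = lin_ext f v + lin_ext f w"
proof -
  let ?S = "Poly_Mapping.keys v \<union> Poly_Mapping.keys w"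
  have "Poly_Mapping.keys (v + w) \<subseteq> ?S" by (rule Poly_Mapping.keys_add)
  then show ?thesis
    by (subst (1 2 3) lin_ext_superset[of ?S]) (auto simp: lookup_add algebra_simps sum.distrib)
qed

lemma lin_ext_qscale: "lin_ext f (qscale a v) = a * lin_ext f v"
proof -
  have "Poly_Mapping.keys (qscale a v) \<subseteq> Poly_Mapping.keys v" by (auto simp: in_keys_iff)
  then show ?thesis
    by (subst (1 2) lin_ext_superset[of "Poly_Mapping.keys v"]) (auto simp: sum_distrib_left algebra_simps)
qed

lemma gen_inject [simp]: "gen x = gen y \<longleftrightarrow> x = y"
  by (metis lookup_single_eq lookup_single_not_eq one_neq_zero)

lemma lin_ext_gen [simp]: "lin_ext f (gen x) = f x"
  by (simp add: lin_ext_def)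

lemma lin_ext_zero [simp]: "lin_ext f 0 = 0"
  by (simp add: lin_ext_def)

lemma lin_ext_sum: "lin_ext f (\<Sum>b\<in>B. g b) = (\<Sum>b\<in>B. lin_ext f (g b))"
  by (induction B rule: infinite_finite_induct) (simp_all add: lin_ext_add)

lemma lin_ext_diff: "lin_ext f (v - w) = lin_ext f v - lin_ext f w"
proof -
  have "lin_ext f (v - w) + lin_ext f w = lin_ext f v" by (simp flip: lin_ext_add)
  then show ?thesis by simp
qed

lemma lin_ext_span:
  assumes "v \<in> free_rat.span R" "\<And>w. w \<in> R \<Longrightarrow> lin_ext f w = 0"
  shows "lin_ext f v = 0"
  using assms(1)
  by (induction rule: free_rat.span_induct_alt) (auto simp: lin_ext_add lin_ext_qscale assms(2))

text \<open>A criterion by dual bases: the functionals \<open>f c\<close> vanish on the relations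
  and separate the representatives, and every generator is a multiple of a representative modulo the
  relations.\<close>

lemma quotient_dim_eq_card:
  fixes X :: "'a set" and C :: "'c set"
  assumes fin: "finite C"
    and rep: "\<And>c. c \<in> C \<Longrightarrow> rep c \<in> X"
    and kills: "\<And>c w. c \<in> C \<Longrightarrow> w \<in> R \<Longrightarrow> lin_ext (f c) w = 0"
    and dual: "\<And>c c'. c \<in> C \<Longrightarrow> c' \<in> C \<Longrightarrow> f c (rep c') = (if c = c' then 1 else 0)"
    and gens: "\<And>x. x \<in> X \<Longrightarrow> gen x \<in> free_rat.span R \<or>
      (\<exists>c\<in>C. \<exists>a. gen x - qscale a (gen (rep c)) \<in> free_rat.span R)"
  shows "quotient_dim {gen x | x. x \<in> X} R = card C"
proof -
  let ?U = "{gen x | x. x \<in> X}"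
  interpret pair: vector_space_pair "qscale :: rat \<Rightarrow> ('a \<Rightarrow>\<^sub>0 rat) \<Rightarrow> _" "qscale :: rat \<Rightarrow> ('a \<Rightarrow>\<^sub>0 rat) \<Rightarrow> _"
    by unfold_locales
  \<comment> \<open>The projection onto the span of the representatives that has the functionals as
    coordinates. It vanishes on \<open>span R\<close>.\<close>
  define T where "T v = (\<Sum>c\<in>C. qscale (lin_ext (f c) v) (gen (rep c)))" for v
  define Q where "Q B \<longleftrightarrow> B \<subseteq> free_rat.span ?U \<and>
                   free_rat.independent B \<and> free_rat.span B \<inter> free_rat.span R = {0} \<and>
                   free_rat.span ?U \<subseteq> free_rat.span (B \<union> R)" for B
  let ?B = "(\<lambda>c. gen (rep c)) ` C"
  have spR: "lin_ext (f c) v = 0" if "c \<in> C" "v \<in> free_rat.span R" for c v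
    using lin_ext_span[OF that(2)] kills[OF that(1)] .
  have lT: "Vector_Spaces.linear qscale qscale T"
  proof unfold_locales
    show "T (v + w) = T v + T w" for v w
      by (simp add: T_def lin_ext_add free_rat.scale_left_distrib sum.distrib)
    show "T (qscale a v) = qscale a (T v)" for a v
      by (simp add: T_def lin_ext_qscale free_rat.scale_sum_right)
  qed
  have TR: "T v = 0" if "v \<in> free_rat.span R" for v
    using that by (simp add: T_def spR)
  have inj: "inj_on rep C" using dual by (metis inj_onI zero_neq_one)
  have Trep: "T (gen (rep c)) = gen (rep c)" if c: "c \<in> C" for c
  proof -
    have "T (gen (rep c)) = (\<Sum>c'\<in>C. if c' = c then gen (rep c') else 0)"
      unfolding T_def using dual[OF _ c] by (intro sum.cong) auto
    then show ?thesis using fin c by simp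
  qed
  have Tsp: "T v = v" if "v \<in> free_rat.span ?B" for v
  proof (rule pair.linear_eq_on[OF lT _ that])
    show "Vector_Spaces.linear qscale qscale (\<lambda>v::'a \<Rightarrow>\<^sub>0 rat. v)" by unfold_locales auto
  qed (use Trep in auto)
  have TinB: "T v \<in> free_rat.span ?B" for v
    unfolding T_def by (intro free_rat.span_sum free_rat.span_scale free_rat.span_base) auto
  have TU: "v - T v \<in> free_rat.span R" if "v \<in> free_rat.span ?U" for v
    using that
  proof (induction rule: free_rat.span_induct_alt)
    case base
    show ?case using pair.linear_0[OF lT] free_rat.span_zero by simp
  next
    case (step a x v)
    have *: "x - T x \<in> free_rat.span R"
    proof -
      from step obtain y where y: "x = gen y" "y \<in> X" by auto
      from gens[OF y(2)] show ?thesis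
      proof
        assume "gen y \<in> free_rat.span R"
        then show ?thesis using TR y by simp
      next
        assume "\<exists>c\<in>C. \<exists>a. gen y - qscale a (gen (rep c)) \<in> free_rat.span R"
        then obtain c b where c: "c \<in> C" "gen y - qscale b (gen (rep c)) \<in> free_rat.span R" by blast
        have "T (gen y) - qscale b (T (gen (rep c))) = 0"
          using TR[OF c(2)] by (simp add: pair.linear_diff[OF lT] pair.linear_scale[OF lT])
        then have "T (gen y) = qscale b (gen (rep c))" using Trep[OF c(1)] by simp
        then show ?thesis using c(2) y by simp
      qed
    qed
    have "qscale a x + v - T (qscale a x + v) = qscale a (x - T x) + (v - T v)"
      by (simp add: pair.linear_add[OF lT] pair.linear_scale[OF lT] free_rat.scale_right_diff_distrib)
    then show ?case using * step.IH by (metis free_rat.span_add free_rat.span_scale)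
  qed
  have indB: "free_rat.independent ?B"
    unfolding free_rat.dependent_finite[OF finite_imageI[OF fin]]
  proof safe
    fix u c assume z: "(\<Sum>v\<in>?B. qscale (u v) v) = 0" and c: "c \<in> C" "u (gen (rep c)) \<noteq> 0"
    have "inj_on (\<lambda>c. gen (rep c)) C"
      using inj by (auto simp: inj_on_def)
    then have "(\<Sum>c'\<in>C. qscale (u (gen (rep c'))) (gen (rep c'))) = 0" using z by (simp add: sum.reindex)
    then have "lin_ext (f c) (\<Sum>c'\<in>C. qscale (u (gen (rep c'))) (gen (rep c'))) = 0" by simp
    then have "(\<Sum>c'\<in>C. u (gen (rep c')) * f c (rep c')) = 0" by (simp add: lin_ext_sum lin_ext_qscale)
    moreover have "(\<Sum>c'\<in>C. u (gen (rep c')) * f c (rep c')) = (\<Sum>c'\<in>C. if c' = c then u (gen (rep c')) else 0)"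
      using dual[OF c(1)] by (intro sum.cong) auto
    ultimately show False using fin c by simp
  qed
  have Q0: "Q ?B"
    unfolding Q_def
  proof (intro conjI)
    show sub: "?B \<subseteq> free_rat.span ?U" using rep by (auto intro!: free_rat.span_base)
    show "free_rat.span ?B \<inter> free_rat.span R = {0}"
      using Tsp TR free_rat.span_zero by (auto, metis)
    show "free_rat.span ?U \<subseteq> free_rat.span (?B \<union> R)"
    proof
      fix v assume "v \<in> free_rat.span ?U"
      then have "v - T v \<in> free_rat.span R" by (rule TU)
      then have "v - T v \<in> free_rat.span (?B \<union> R)" "T v \<in> free_rat.span (?B \<union> R)"
        using TinB free_rat.span_mono[of R "?B \<union> R"] free_rat.span_mono[of ?B "?B \<union> R"] by blast+
      from free_rat.span_add[OF this] show "v \<in> free_rat.span (?B \<union> R)" by simp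
    qed
  qed (rule indB)
  have cardB: "card ?B = card C"
    using inj by (intro card_image) (auto simp: inj_on_def)
  \<comment> \<open>The definition of \<open>quotient_dim\<close> chooses \<open>B\<close>
    arbitrarily, so every admissible \<open>B\<close> is compared with the representatives. On
    \<open>span B\<close> the map \<open>T\<close> is injective, as its kernel in
    \<open>span U\<close> lies in \<open>span R\<close>; its image is all of the span of the
    representatives.\<close>
  have "card B = card C" if "Q B" for B
  proof -
    have injT: "inj_on T (free_rat.span B)"
    proof (rule inj_onI)
      fix v w assume vw: "v \<in> free_rat.span B" "w \<in> free_rat.span B" "T v = T w"
      then have d: "v - w \<in> free_rat.span B" by (simp add: free_rat.span_diff)
      have "free_rat.span B \<subseteq> free_rat.span ?U"
        using that free_rat.span_mono[of B "free_rat.span ?U"] unfolding Q_def free_rat.span_span by blast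
      then have "(v - w) - T (v - w) \<in> free_rat.span R" using TU d by blast
      moreover have "T (v - w) = 0" using vw by (simp add: pair.linear_diff[OF lT])
      ultimately have "v - w \<in> free_rat.span B \<inter> free_rat.span R" using d by simp
      then have "v - w = 0" using that unfolding Q_def by (metis singletonD)
      then show "v = w" by simp
    qed
    have ind: "free_rat.independent (T ` B)"
      using pair.linear_independent_injective_image[OF lT _ injT] that by (simp add: Q_def)
    have "T ` B \<subseteq> free_rat.span ?B" using TinB by (intro image_subsetI)
    from free_rat.independent_span_bound[OF finite_imageI[OF fin] ind this]
    have 1: "finite (T ` B)" "card (T ` B) \<le> card ?B" by auto
    have iB: "inj_on T B" using injT free_rat.span_superset by (rule inj_on_subset)
    have "?B \<subseteq> free_rat.span (T ` B)"
    proof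
      fix v assume v: "v \<in> ?B"
      have "?B \<subseteq> free_rat.span ?U" using Q0 by (simp only: Q_def)
      moreover have "free_rat.span ?U \<subseteq> free_rat.span (B \<union> R)" using that by (simp only: Q_def)
      ultimately have "v \<in> free_rat.span (B \<union> R)" using v by (meson subsetD)
      then have "T v \<in> T ` free_rat.span (B \<union> R)" by blast
      also have "\<dots> = free_rat.span (T ` B \<union> T ` R)"
        by (simp add: pair.linear_span_image[OF lT, symmetric] image_Un)
      also have "\<dots> \<subseteq> free_rat.span (insert 0 (T ` B))"
        using TR free_rat.span_base by (intro free_rat.span_mono) blast
      also have "\<dots> = free_rat.span (T ` B)" by (rule free_rat.span_insert_0)
      finally show "v \<in> free_rat.span (T ` B)" using Tsp v free_rat.span_base by metis
    qed
    from free_rat.independent_span_bound[OF 1(1) indB this] have "card ?B \<le> card (T ` B)" by blast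
    then show ?thesis using 1(2) cardB card_image[OF iB] by simp
  qed
  moreover have "quotient_dim ?U R = card (SOME B. Q B)" unfolding quotient_dim_def Q_def ..
  moreover have "Q (SOME B. Q B)" using Q0 by (rule someI)
  ultimately show ?thesis by simp
qed

section \<open>The Euler characteristic as a signed count of forms\<close>

lemma sum_mset_ge_member: "T \<in># M \<Longrightarrow> f T \<le> (\<Sum>\<^sub># (image_mset f M) :: nat)"
  by (metis image_mset_add_mset le_add1 multi_member_split sum_mset.add_mset)

lemma size_sum_mset: "size (\<Sum>\<^sub># (image_mset f M) :: 'b multiset) = (\<Sum>\<^sub># (image_mset (\<lambda>T. size (f T)) M))"
  by (induction M) auto

lemma finite_bounded_multisets: "finite A \<Longrightarrow> finite {M. set_mset M \<subseteq> A \<and> size M \<le> n}"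
proof -
  assume "finite A"
  then have "finite (mset ` {xs. set xs \<subseteq> A \<and> length xs \<le> n})"
    by (intro finite_imageI finite_lists_length_le)
  moreover have "{M. set_mset M \<subseteq> A \<and> size M \<le> n} \<subseteq> mset ` {xs. set xs \<subseteq> A \<and> length xs \<le> n}"
    by (auto simp: image_iff) (metis ex_mset set_mset_mset size_mset)
  ultimately show ?thesis by (rule rev_finite_subset)
qed

lemma size_le_leaves:
  "(\<And>T. T \<in># M \<Longrightarrow> pwf r T) \<Longrightarrow> size M \<le> size (\<Sum>\<^sub># (image_mset pleaves M))"
proof (induction M)
  case (add T M)
  have "size (pleaves T) > 0" using add.prems[of T] pwf_pleaves[of r T] by (simp add: nonempty_has_size)
  then show ?case using add by simp
qed simp

text \<open>Each branch of an internal vertex has a sibling, which has a leaf. So the branches have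
  strictly fewer leaves than the tree, and the induction runs over the number of leaves.\<close>

lemma finite_planted: "finite {T. pwf r T \<and> size (pleaves T) \<le> n}"
proof (induction n)
  case 0
  have "{T. pwf r T \<and> size (pleaves T) \<le> 0} = {}" using pwf_pleaves by fastforce
  then show ?case by (simp only: finite.emptyI)
next
  case (Suc n)
  let ?A = "{T. pwf r T \<and> size (pleaves T) \<le> n}"
  have "{T. pwf r T \<and> size (pleaves T) \<le> Suc n} \<subseteq>
    (\<lambda>i. PN (Some i) {#}) ` {1..r} \<union> PN None ` {M. set_mset M \<subseteq> ?A \<and> size M \<le> Suc n}"
  proof
    fix T assume "T \<in> {T. pwf r T \<and> size (pleaves T) \<le> Suc n}"
    then have T: "pwf r T" "size (pleaves T) \<le> Suc n" by auto
    from T(1) show "T \<in> (\<lambda>i. PN (Some i) {#}) ` {1..r} \<union> PN None ` {M. set_mset M \<subseteq> ?A \<and> size M \<le> Suc n}"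
    proof cases
      case (2 M)
      have s: "size (\<Sum>\<^sub># (image_mset pleaves M)) \<le> Suc n" using T(2) 2(1) by simp
      have "size (pleaves U) \<le> n" if "U \<in># M" for U
      proof -
        from multi_member_split[OF \<open>U \<in># M\<close>] obtain N where N: "M = add_mset U N" by blast
        then have "size N \<ge> 1" using 2(3) by simp
        moreover have "size N \<le> size (\<Sum>\<^sub># (image_mset pleaves N))" using 2(2) N by (intro size_le_leaves) auto
        ultimately show ?thesis using s N by simp
      qed
      moreover have "size M \<le> Suc n" using size_le_leaves[of M r] 2(2) s by simp
      ultimately show ?thesis using 2 by auto
    qed auto
  qed
  moreover have "finite \<dots>" using finite_bounded_multisets[OF Suc] by simp
  ultimately show ?case by (rule finite_subset)
qed

lemma finite_cforms: "finite {c. cwf r c \<and> size (cleaves c) = n}"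
proof -
  let ?A = "{T. pwf r T \<and> size (pleaves T) \<le> n}"
  let ?B = "{M. set_mset M \<subseteq> ?A \<and> size M \<le> n}"
  have *: "M \<in> ?B" if M: "\<forall>T\<in>#M. pwf r T" "size (\<Sum>\<^sub># (image_mset pleaves M)) = n" for M
  proof -
    have "size (pleaves T) \<le> n" if "T \<in># M" for T
      using sum_mset_ge_member[OF that, of "\<lambda>T. size (pleaves T)"] M(2) unfolding size_sum_mset by simp
    then show ?thesis using size_le_leaves[of M r] M by auto
  qed
  have "{c. cwf r c \<and> size (cleaves c) = n} \<subseteq> VC ` ?B \<union> EC ` ?B"
  proof
    fix c assume "c \<in> {c. cwf r c \<and> size (cleaves c) = n}"
    then have c: "cwf r c" "size (cleaves c) = n" by auto
    show "c \<in> VC ` ?B \<union> EC ` ?B"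
    proof (cases c)
      case (VC M)
      then have "M \<in> ?B" using c by (intro *) simp_all
      then show ?thesis using VC by blast
    next
      case (EC M)
      then have "M \<in> ?B" using c by (intro *) simp_all
      then show ?thesis using EC by blast
    qed
  qed
  moreover have "finite (VC ` ?B \<union> EC ` ?B)"
    using finite_bounded_multisets[OF finite_planted[of r n], of n] by simp
  ultimately show ?thesis by (rule finite_subset)
qed

text \<open>The functional belonging to the form \<open>c\<close>. The description is meaningful for
  good \<open>c\<close>, where \<open>pres_unique\<close> makes the sign unique; on graphs with
  another form, or with none, the value is 0.\<close>

definition form_value :: "(nat \<Rightarrow> nat) \<Rightarrow> nat \<Rightarrow> nat \<Rightarrow> cform \<Rightarrow> ograph \<Rightarrow> rat" where
  "form_value m d r c G = (if \<exists>e. pres m d r G e c then THE e. pres m d r G e c else 0)"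

lemma form_value_eq: "pres m d r G e c \<Longrightarrow> cgood m d c \<Longrightarrow> form_value m d r c G = e"
  unfolding form_value_def using pres_unique by (metis the_equality)

lemma form_value_zero: "\<not> (\<exists>e. pres m d r G e c) \<Longrightarrow> form_value m d r c G = 0"
  by (simp add: form_value_def)

lemma form_value_orel:
  assumes "orel m d G a G'" "cgood m d c"
  shows "form_value m d r c G' = a * form_value m d r c G"
proof (cases "\<exists>e. pres m d r G e c")
  case True
  then obtain e where "pres m d r G e c" by blast
  with pres_orel[OF this assms(1)] show ?thesis using form_value_eq assms(2) by metis
next
  case False
  then have "\<not> (\<exists>e. pres m d r G' e c)" using pres_orel[OF _ orel_sym[OF assms(1)]] by blast
  with False show ?thesis by (simp add: form_value_zero)
qed

lemma map_cell_inverse: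
  assumes "hairy_graph r G" "inj_on f (vertices G)"
  shows "map (map_cell (inv_into (vertices G) f)) (map (map_cell f) G) = G"
proof -
  have "map_cell (inv_into (vertices G) f) (map_cell f c) = c" if c: "c \<in> set G" for c
  proof -
    have "set_cell c \<subseteq> vertices G"
    proof (cases c)
      case (Edge v w)
      then have "(v, w) \<in> set (edges G)" using c by (force simp: edges_def)
      then show ?thesis using Edge assms(1) by (auto simp: hairy_graph_def)
    next
      case (Internal v)
      then show ?thesis using c by (force simp: vertices_def internals_def)
    next
      case (External v i)
      then show ?thesis using c by (force simp: vertices_def externals_def)
    qed
    then have "map_cell (inv_into (vertices G) f \<circ> f) c = map_cell id c"
      using assms(2) by (intro cell.map_cong) auto
    then show ?thesis by (simp add: cell.map_comp cell.map_id)
  qed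
  then show ?thesis by (simp add: map_idI)
qed

lemma vertices_map: "vertices (map (map_cell f) G) = f ` vertices G"
proof -
  have "vertices (map (map_cell f) G) = {v. \<exists>k. vcell v k \<in> map_cell f ` set G}"
    by (simp add: vertices_conv)
  also have "\<dots> = f ` {v. \<exists>k. vcell v k \<in> set G}"
  proof (intro equalityI subsetI)
    fix v assume "v \<in> {v. \<exists>k. vcell v k \<in> map_cell f ` set G}"
    then obtain k c where c: "vcell v k = map_cell f c" "c \<in> set G" by auto
    show "v \<in> f ` {v. \<exists>k. vcell v k \<in> set G}"
    proof (cases c)
      case (Internal w)
      then have "vcell w None \<in> set G" "v = f w" using c by (cases k; simp)+
      then show ?thesis by blast
    next
      case (External w i)
      then have "vcell w (Some i) \<in> set G" "v = f w" using c by (cases k; simp)+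
      then show ?thesis by blast
    qed (use c in simp)
  next
    fix v assume "v \<in> f ` {v. \<exists>k. vcell v k \<in> set G}"
    then obtain w k where "v = f w" "vcell w k \<in> set G" by auto
    then have "vcell v k \<in> map_cell f ` set G" by (metis image_eqI map_vcell)
    then show "v \<in> {v. \<exists>k. vcell v k \<in> map_cell f ` set G}" by blast
  qed
  finally show ?thesis by (simp add: vertices_conv)
qed

text \<open>The value 0 has to be transported as well, so presentations are also pulled back along
  the inverse relabelling.\<close>

lemma form_value_map:
  assumes "hairy_graph r' G" "inj_on f (vertices G)" "cgood m d c"
  shows "form_value m d r c (map (map_cell f) G) = form_value m d r c G"
proof (cases "\<exists>e. pres m d r G e c")
  case True
  then show ?thesis using pres_map[OF _ assms(2)] form_value_eq assms(3) by metis
next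
  case False
  have "inj_on (inv_into (vertices G) f) (vertices (map (map_cell f) G))"
    unfolding vertices_map by (rule inj_on_inv_into) simp
  from pres_map[OF _ this] have "\<not> (\<exists>e. pres m d r (map (map_cell f) G) e c)"
    using False map_cell_inverse[OF assms(1,2)] by metis
  with False show ?thesis by (simp add: form_value_zero)
qed

lemma orel_flip_update:
  assumes "k < length G" "G ! k = Edge v w"
  shows "orel m d G ((- 1) ^ d) (G[k := Edge w v])"
  using orel_flip1[of m d "take k G" v w "drop (Suc k) G"] assms
  by (simp add: id_take_nth_drop[symmetric] upd_conv_take_nth_drop) (metis id_take_nth_drop)

lemma form_value_kills:
  assumes "w \<in> graph_relations r m d" "cgood m d c"
  shows "lin_ext (form_value m d r c) w = 0"
  using assms(1) unfolding graph_relations_def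
proof (elim UnE CollectE exE conjE)
  fix G f assume "w = gen (map (map_cell f) G) - gen G" "hairy_graph r G" "inj_on f (vertices G)"
  then show ?thesis using form_value_map assms(2) by (simp add: lin_ext_diff)
next
  fix G k v w' assume "w = gen (G[k := Edge w' v]) - qscale ((- 1) ^ d) (gen G)" "k < length G" "G ! k = Edge v w'"
  then show ?thesis using form_value_orel[OF orel_flip_update assms(2)]
    by (simp add: lin_ext_diff lin_ext_qscale)
next
  fix G \<pi> assume "w = gen (permute_list \<pi> G) - qscale (koszul_sign m d G \<pi>) (gen G)" "\<pi> permutes {..<length G}"
  then show ?thesis using form_value_orel[OF kperm_orel[OF kperm_permute_list] assms(2)]
    by (simp add: lin_ext_diff lin_ext_qscale)
qed

lemma graph_components_conv:
  "graph_components V (edges G) = V // {(v, w). v \<in> V \<and> w \<in> V \<and> (v, w) \<in> {(x, y). adj G x y}\<^sup>*}"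
  unfolding graph_components_def set_edges ..

lemma edges_in_vertices:
  "(\<forall>(v, w) \<in> set (edges G). v \<in> V \<and> w \<in> V) \<longleftrightarrow> (\<forall>v w. adj G v w \<longrightarrow> v \<in> V \<and> w \<in> V)"
proof -
  have "adj G v w \<longleftrightarrow> (v, w) \<in> set (edges G) \<or> (w, v) \<in> set (edges G)" for v w
    using set_edges[of G] by auto
  then show ?thesis by auto
qed

lemma orel_vertex_lists:
  "orel m d L e M \<Longrightarrow> mset (internals M) = mset (internals L) \<and> mset (externals M) = mset (externals L)"
proof (induction rule: orel.induct)
  case (swap L e A x y B)
  then show ?case by (cases x; cases y) (auto simp: add_ac add_mset_commute)
qed auto

lemma orel_hairy:
  assumes "orel m d L e M" "hairy_graph r L"
  shows "hairy_graph r M"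
proof -
  have l: "mset (internals M) = mset (internals L)" "mset (externals M) = mset (externals L)"
    using orel_vertex_lists[OF assms(1)] by auto
  have "mset (internals M @ externals M) = mset (internals L @ externals L)" using l by simp
  then have 1: "distinct (internals M @ externals M) = distinct (internals L @ externals L)"
    by (rule mset_eq_imp_distinct_iff)
  have 2: "set (internals M) = set (internals L)" "set (externals M) = set (externals L)"
    "set (hair_colours M) = set (hair_colours L)"
    using l orel_invariants[OF assms(1)] mset_eq_setD by blast+
  then have 3: "vertices M = vertices L" by (simp add: vertices_def)
  have 4: "adj M = adj L" using orel_adj[OF assms(1)] by (intro ext) simp
  have 5: "valence M = valence L" using orel_invariants[OF assms(1)] by (intro ext) simp
  have 6: "externals M \<noteq> [] \<longleftrightarrow> externals L \<noteq> []" using l(2) by auto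
  show ?thesis using assms(2)
    unfolding hairy_graph_def edges_in_vertices graph_components_conv 1 2 3 4 5 6 .
qed

text \<open>Each step of \<open>orel\<close> is matched with one of the generating relations of the
  complex, and the errors are added up.\<close>

lemma orel_relation:
  assumes "orel m d L e M" "hairy_graph r L" "simple_list L"
  shows "gen M - qscale e (gen L) \<in> free_rat.span (graph_relations r m d)"
  using assms
proof (induction rule: orel.induct)
  case (start L)
  then show ?case using free_rat.span_zero by simp
next
  case (swap L e A x y B)
  let ?M = "A @ x # y # B" and ?N = "A @ y # x # B" and ?k = "kz (odd_cell m d) x y"
  have h: "hairy_graph r ?M" using orel_hairy swap by blast
  have sm: "simple_list ?M" using orel_list_sign swap by blast
  have "mset ?N = mset ?M" by simp
  \<comment> \<open>This permutation need not be a transposition. Its Koszul sign is nevertheless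
    the expected one, since \<open>orel_unique\<close> leaves no choice for a simple list.\<close>
  then obtain \<pi> where \<pi>: "\<pi> permutes {..<length ?M}" "permute_list \<pi> ?M = ?N"
    by (rule mset_eq_permutation)
  have "orel m d ?M (koszul_sign m d ?M \<pi>) ?N"
    using kperm_orel[OF kperm_permute_list[OF \<pi>(1)]] unfolding \<pi>(2) .
  then have k: "koszul_sign m d ?M \<pi> = ?k" using orel_unique orel_swap1 sm by blast
  have "gen (permute_list \<pi> ?M) - qscale (koszul_sign m d ?M \<pi>) (gen ?M) \<in> graph_relations r m d"
    unfolding graph_relations_def using h \<pi>(1) by blast
  then have "gen ?N - qscale ?k (gen ?M) \<in> free_rat.span (graph_relations r m d)"
    unfolding \<pi>(2) k by (rule free_rat.span_base)
  from free_rat.span_add[OF this free_rat.span_scale[OF swap.IH[OF swap.prems], of ?k]]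
  show ?case by (simp add: free_rat.scale_right_diff_distrib mult.commute)
next
  case (flip L e A v w B)
  let ?M = "A @ Edge v w # B" and ?N = "A @ Edge w v # B"
  have h: "hairy_graph r ?M" using orel_hairy flip by blast
  have k: "length A < length ?M" "?M ! length A = Edge v w" by simp_all
  have "gen (?M[length A := Edge w v]) - qscale ((- 1) ^ d) (gen ?M) \<in> graph_relations r m d"
    unfolding graph_relations_def using h k by blast
  moreover have "?M[length A := Edge w v] = ?N" by simp
  ultimately have "gen ?N - qscale ((- 1) ^ d) (gen ?M) \<in> free_rat.span (graph_relations r m d)"
    using free_rat.span_base by metis
  from free_rat.span_add[OF this free_rat.span_scale[OF flip.IH[OF flip.prems], of "(- 1) ^ d"]]
  show ?case by (simp add: free_rat.scale_right_diff_distrib mult.commute)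
qed

lemma pres_cwf: "pres m d r G e c \<Longrightarrow> cwf r c"
  by (erule pres.cases) blast+

lemma pres_simple: "pres m d r G e c \<Longrightarrow> simple_list G"
proof (erule pres.cases)
  fix v ts e1
  assume "distinct (labs (LT v None ts))" "orel m d G e1 (body (LT v None ts))"
  then show ?thesis using orel_list_sign[OF orel_sym simple_list_body] by blast
next
  fix t u e1
  assume "distinct (labs t @ labs u)" "orel m d G e1 (edge_body t u)"
  then show ?thesis using orel_list_sign[OF orel_sym simple_list_edge_body] by blast
qed

lemma pres_sign_square: "pres m d r G e c \<Longrightarrow> e * e = 1"
proof (erule pres.cases)
  fix v ts e1
  assume "e = e1 * osign m d (LT v None ts)" "orel m d G e1 (body (LT v None ts))"
  then have "e * e = (e1 * e1) * (osign m d (LT v None ts) * osign m d (LT v None ts))"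
    by (simp only: mult_ac)
  then show ?thesis using orel_square[OF \<open>orel m d G e1 (body (LT v None ts))\<close>] unfolding osign_square by simp
next
  fix t u e1
  assume e: "e = e1 * (osign m d t * osign m d u * esign m d (shape t) (shape u))" and o: "orel m d G e1 (edge_body t u)"
  have "e * e = (e1 * e1) * (osign m d t * osign m d t) * (osign m d u * osign m d u) *
      (esign m d (shape t) (shape u) * esign m d (shape t) (shape u))"
    unfolding e by (simp only: mult_ac)
  then show ?thesis using orel_square[OF o] by (simp add: esign_def)
qed

definition forms :: "nat \<Rightarrow> (nat \<Rightarrow> nat) \<Rightarrow> nat \<Rightarrow> (nat \<Rightarrow>\<^sub>0 nat) \<Rightarrow> nat \<Rightarrow> cform set" where
  "forms r m d s n = {c. cwf r c \<and> cgood m d c \<and> count (cleaves c) = Poly_Mapping.lookup s \<and> size (cleaves c) = n}"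

lemma finite_forms: "finite (forms r m d s n)"
  by (rule finite_subset[OF _ finite_cforms[of r n]]) (auto simp: forms_def)

lemma pres_degrees:
  assumes "pres m d r G e c" "hairy_graph r G" "genus G = 0"
  shows "hodge_degree G = count (cleaves c)" "complexity G = int (size (cleaves c)) - 1"
proof -
  have m: "mset (hair_colours G) = cleaves c" using pres_invariants[OF assms(1)] by blast
  show "hodge_degree G = count (cleaves c)"
    unfolding hodge_degree_def by (intro ext) (simp flip: m add: count_mset)
  show "complexity G = int (size (cleaves c)) - 1"
    using complexity_genus_zero[OF assms(2,3)] length_hair_colours[of G] by (simp flip: m)
qed

text \<open>Good forms index a basis: \<open>form_value\<close> provides the dual functionals, and
  graphs with a bad form vanish. The index is \<open>Suc t\<close> because the complexity is the
  number of leaves minus one.\<close>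

lemma complex_dim_eq_card:
  "complex_dim r m d 0 s t j = card {c \<in> forms r m d s (Suc t). cdegree m d c = j}"
proof -
  let ?C = "{c \<in> forms r m d s (Suc t). cdegree m d c = j}"
  let ?R = "graph_relations r m d"
  define X :: "ograph set" where "X = {G. hairy_graph r G \<and> genus G = int 0 \<and>
          hodge_degree G = Poly_Mapping.lookup s \<and> complexity G = int t \<and> graph_degree m d G = j}"
  define rep where "rep c = (SOME G. \<exists>e. pres m d r G e c \<and> hairy_graph r G \<and> genus G = 0)" for c
  have rep: "\<exists>e. pres m d r (rep c) e c \<and> hairy_graph r (rep c) \<and> genus (rep c) = 0" if "c \<in> ?C" for c
  proof -
    have "cwf r c" using that by (simp add: forms_def)
    from someI_ex[OF cform_realized[OF this]] show ?thesis unfolding rep_def .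
  qed
  \<comment> \<open>The factor is the value at \<open>rep c\<close>, a sign whose square is 1, so
    that \<open>f c\<close> takes the value 1 there.\<close>
  define f where "f c G = form_value m d r c (rep c) * form_value m d r c G" for c G
  have lin_f: "lin_ext (f c) w = form_value m d r c (rep c) * lin_ext (form_value m d r c) w" for c w
    unfolding f_def lin_ext_def by (simp add: sum_distrib_left mult_ac)
  have "quotient_dim {gen G | G. G \<in> X} ?R = card ?C"
  proof (rule quotient_dim_eq_card[where f = f and rep = rep])
    show "finite ?C" using finite_forms[of r m d s "Suc t"] by simp
    show "rep c \<in> X" if c: "c \<in> ?C" for c
    proof -
      obtain e where e: "pres m d r (rep c) e c" "hairy_graph r (rep c)" "genus (rep c) = 0" using rep[OF c] by blast
      show ?thesis using e pres_degrees[OF e] pres_invariants[OF e(1)] c by (simp add: X_def forms_def)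
    qed
    show "lin_ext (f c) w = 0" if "c \<in> ?C" "w \<in> ?R" for c w
      using form_value_kills[OF that(2), of c] that(1) by (simp add: lin_f forms_def)
    show "f c (rep c') = (if c = c' then 1 else 0)" if c: "c \<in> ?C" "c' \<in> ?C" for c c'
    proof -
      obtain e e' where e: "pres m d r (rep c) e c" "pres m d r (rep c') e' c'" using rep c by blast
      have g: "cgood m d c" using c by (simp add: forms_def)
      show ?thesis
      proof (cases "c = c'")
        case True
        then show ?thesis using form_value_eq[OF e(1) g] pres_sign_square[OF e(1)] by (simp add: f_def)
      next
        case False
        then have "\<not> (\<exists>e. pres m d r (rep c') e c)" using pres_unique e(2) by blast
        then show ?thesis using False by (simp add: f_def form_value_zero)
      qed
    qed
    show "gen G \<in> free_rat.span ?R \<or> (\<exists>c\<in>?C. \<exists>a. gen G - qscale a (gen (rep c)) \<in> free_rat.span ?R)"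
      if "G \<in> X" for G
    proof -
      have G: "hairy_graph r G" "genus G = 0" using that by (auto simp: X_def)
      obtain e c where p: "pres m d r G e c" using presentation_exists[OF G] by blast
      have sm: "simple_list G" using pres_simple[OF p] .
      show ?thesis
      proof (cases "cgood m d c")
        case True
        have "c \<in> ?C"
          using True pres_cwf[OF p] pres_degrees[OF p G] pres_invariants[OF p] that by (simp add: X_def forms_def)
        obtain e' where e': "pres m d r (rep c) e' c" "hairy_graph r (rep c)" using rep[OF \<open>c \<in> ?C\<close>] by blast
        obtain h a where h: "inj_on h (vertices (rep c))" "orel m d (map (map_cell h) (rep c)) a G"
          using pres_related[OF e'(1) p] by blast
        let ?H = "map (map_cell h) (rep c)"
        have 1: "gen ?H - gen (rep c) \<in> free_rat.span ?R"
          unfolding graph_relations_def using e'(2) h(1) by (intro free_rat.span_base) blast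
        have 2: "gen ?H - qscale a (gen G) \<in> free_rat.span ?R"
          by (rule orel_relation[OF orel_sym[OF h(2)] G(1) sm])
        have "qscale a (gen ?H - gen (rep c)) - qscale a (gen ?H - qscale a (gen G)) \<in> free_rat.span ?R"
          by (rule free_rat.span_diff[OF free_rat.span_scale[OF 1] free_rat.span_scale[OF 2]])
        moreover have "qscale a (gen ?H - gen (rep c)) - qscale a (gen ?H - qscale a (gen G)) = gen G - qscale a (gen (rep c))"
          using orel_square[OF h(2)] by (simp add: free_rat.scale_right_diff_distrib)
        ultimately show ?thesis using \<open>c \<in> ?C\<close> by auto
      next
        case False
        obtain h where h: "inj_on h (vertices G)" "orel m d (map (map_cell h) G) (- 1) G"
          using pres_bad[OF p False] by blast
        let ?H = "map (map_cell h) G"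
        have 1: "gen ?H - gen G \<in> free_rat.span ?R"
          unfolding graph_relations_def using G(1) h(1) by (intro free_rat.span_base) blast
        have 2: "gen ?H - qscale (- 1) (gen G) \<in> free_rat.span ?R"
          by (rule orel_relation[OF orel_sym[OF h(2)] G(1) sm])
        \<comment> \<open>Both the sum and the difference of the two generators are relations, hence
          so is twice \<open>gen G\<close>, and 2 is invertible.\<close>
        have "qscale (1 / 2) ((gen ?H - qscale (- 1) (gen G)) - (gen ?H - gen G)) \<in> free_rat.span ?R"
          by (rule free_rat.span_scale[OF free_rat.span_diff[OF 2 1]])
        moreover have "qscale (1 / 2) ((gen ?H - qscale (- 1) (gen G)) - (gen ?H - gen G)) = gen G"
          by (intro poly_mapping_eqI) (simp add: lookup_minus lookup_add)
        ultimately show ?thesis by simp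
      qed
    qed
  qed
  moreover have "{gen G | G. G \<in> X} = {gen G | G :: ograph. hairy_graph r G \<and> genus G = int 0 \<and>
          hodge_degree G = Poly_Mapping.lookup s \<and> complexity G = int t \<and> graph_degree m d G = j}"
    by (simp add: X_def)
  ultimately show ?thesis unfolding complex_dim_def by simp
qed

lemma euler_char_eq_sum:
  "euler_char r m d 0 s t = (\<Sum>c\<in>forms r m d s (Suc t). (- 1) powi cdegree m d c)"
proof -
  let ?F = "forms r m d s (Suc t)"
  have fin: "finite ?F" by (rule finite_forms)
  have J: "{j. complex_dim r m d 0 s t j \<noteq> 0} = cdegree m d ` ?F"
    unfolding complex_dim_eq_card using fin by (auto simp: card_eq_0_iff)
  have "(\<Sum>c\<in>?F. (- 1 :: rat) powi cdegree m d c) =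
    (\<Sum>j\<in>cdegree m d ` ?F. \<Sum>c\<in>{c \<in> ?F. cdegree m d c = j}. (- 1) powi cdegree m d c)"
    by (rule sum.image_gen[OF fin])
  also have "\<dots> = (\<Sum>j\<in>cdegree m d ` ?F. (- 1) powi j * of_nat (complex_dim r m d 0 s t j))"
    unfolding complex_dim_eq_card by (intro sum.cong) auto
  finally show ?thesis unfolding euler_char_def J by simp
qed

section \<open>Logarithms of power series\<close>

lemma const_poly_add: "const_poly (a + b) = const_poly a + const_poly b"
  by (rule single_add)

lemma const_poly_mult: "const_poly (a * b) = const_poly a * const_poly b"
  by (simp add: mult_single)

lemma const_poly_uminus: "const_poly (- a) = - const_poly a"
  by (rule single_uminus)

lemma const_poly_of_nat: "const_poly (of_nat n) = of_nat n"
  by (induction n) (simp_all add: const_poly_add)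

abbreviation (input) ln_series :: "xpoly fps" where
  "ln_series \<equiv> Abs_fps (\<lambda>n. const_poly (fps_nth (fps_ln 1) n))"

lemma deriv_ln_series: "(1 + fps_X) * fps_deriv ln_series = 1"
proof -
  have c: "fps_nth (fps_deriv ln_series) n = const_poly ((- 1) ^ n)" for n
  proof -
    have "fps_nth (fps_deriv ln_series) n = of_nat (Suc n) * const_poly ((- 1) ^ n / of_nat (Suc n))"
      by (simp add: fps_ln_nth del: of_nat_Suc)
    also have "\<dots> = const_poly (of_nat (Suc n) * ((- 1) ^ n / of_nat (Suc n)))"
      by (simp only: const_poly_mult const_poly_of_nat)
    finally show ?thesis by (simp del: of_nat_Suc)
  qed
  show ?thesis
  proof (rule fps_ext)
    fix n
    show "fps_nth ((1 + fps_X) * fps_deriv ln_series) n = fps_nth 1 n"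
      by (cases n) (simp_all add: distrib_right c const_poly_uminus del: fps_deriv_nth)
  qed
qed

lemma deriv_ln_one_plus:
  assumes "fps_nth f 0 = 0"
  shows "(1 + f) * fps_deriv (ln_one_plus f) = fps_deriv f"
proof -
  have "fps_deriv (ln_one_plus f) = (fps_deriv ln_series oo f) * fps_deriv f"
    unfolding ln_one_plus_def by (rule fps_compose_deriv[OF assms])
  moreover have "(1 + f) * (fps_deriv ln_series oo f) = 1"
  proof -
    have "((1 + fps_X) * fps_deriv ln_series) oo f = ((1 + fps_X) oo f) * (fps_deriv ln_series oo f)"
      by (rule fps_compose_mult_distrib[OF assms])
    moreover have "(1 + fps_X) oo f = 1 + f" using assms by (simp add: fps_compose_add_distrib fps_X_fps_compose_startby0)
    ultimately show ?thesis unfolding deriv_ln_series by simp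
  qed
  ultimately show ?thesis by (simp flip: mult.assoc)
qed

lemma ln_one_plus_0 [simp]: "fps_nth (ln_one_plus f) 0 = 0"
  by (simp add: ln_one_plus_def fps_compose_nth)

definition fps_log :: "xpoly fps \<Rightarrow> xpoly fps" where
  "fps_log A = ln_one_plus (A - 1)"

text \<open>Both sides have constant term zero, and their derivatives agree because
  \<open>C * fps_deriv (fps_log C) = fps_deriv C\<close> whenever \<open>C\<close> has constant term
  1.\<close>

lemma fps_log_mult:
  assumes "fps_nth A 0 = 1" "fps_nth B 0 = 1"
  shows "fps_log (A * B) = fps_log A + fps_log B"
proof -
  have d: "C * fps_deriv (fps_log C) = fps_deriv C" if "fps_nth C 0 = 1" for C
    using deriv_ln_one_plus[of "C - 1"] that by (simp add: fps_log_def)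
  have "(A * B) * fps_deriv (fps_log (A * B)) = fps_deriv A * B + A * fps_deriv B"
    using d[of "A * B"] assms by (simp add: mult.commute)
  also have "\<dots> = (A * B) * (fps_deriv (fps_log A) + fps_deriv (fps_log B))"
    using d[OF assms(1)] d[OF assms(2)] by (simp add: algebra_simps)
  finally have eq: "(A * B) * fps_deriv (fps_log (A * B)) = (A * B) * (fps_deriv (fps_log A) + fps_deriv (fps_log B))" .
  have "fps_nth (A * B) 0 \<noteq> 0" using assms by simp
  then have "A * B \<noteq> 0" by (metis fps_zero_nth)
  with eq have "fps_deriv (fps_log (A * B)) = fps_deriv (fps_log A + fps_log B)"
    by (simp only: mult_cancel_left fps_deriv_add) simp
  then show ?thesis by (subst (asm) fps_deriv_eq_iff) (simp add: fps_log_def)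
qed

lemma fps_log_1 [simp]: "fps_log 1 = 0"
  by (simp add: fps_log_def ln_one_plus_def fps_eq_iff fps_compose_nth fps_ln_nth power_0_left)

lemma fps_log_prod:
  "finite I \<Longrightarrow> (\<And>i. i \<in> I \<Longrightarrow> fps_nth (A i) 0 = 1) \<Longrightarrow>
    fps_log (\<Prod>i\<in>I. A i) = (\<Sum>i\<in>I. fps_log (A i)) \<and> fps_nth (\<Prod>i\<in>I. A i) 0 = 1"
  by (induction I rule: finite_induct) (auto simp: fps_log_mult)

lemma fps_log_below:
  assumes "\<And>k. k \<le> n \<Longrightarrow> fps_nth A k = (if k = 0 then 1 else 0)"
  shows "fps_nth (fps_log A) n = 0"
proof -
  have "fps_nth ((A - 1) ^ i) n = 0" if "i > 0" for i
  proof (cases "A = 1")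
    case False
    then have "subdegree (A - 1) > n"
      using assms by (intro subdegree_greaterI) auto
    then have "n < i * subdegree (A - 1)" using that by (metis less_le_trans mult_le_mono1 One_nat_def Suc_leI mult_1)
    then show ?thesis by (rule fps_pow_nth_below_subdegree)
  qed (use that in \<open>simp add: power_0_left\<close>)
  then show ?thesis
    unfolding fps_log_def ln_one_plus_def fps_compose_nth
    by (intro sum.neutral) (auto simp: fps_ln_nth)
qed

lemma monomial_power: "(fps_const c * fps_X ^ k) ^ i = fps_const (c ^ i) * fps_X ^ (k * i)" for c :: "'a::comm_ring_1"
  by (simp add: power_mult_distrib fps_const_power power_mult)

text \<open>The series of \<open>ln (1 - y)\<close> at \<open>y = c X^k\<close>: for
  \<open>n = k * j\<close> its coefficient \<open>1 / j\<close> is written as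
  \<open>k / n\<close>.\<close>

lemma fps_log_monomial:
  assumes "k > 0"
  shows "fps_nth (fps_log (1 - fps_const c * fps_X ^ k)) n =
     (if n > 0 \<and> k dvd n then - const_poly (of_nat k / of_nat n) * c ^ (n div k) else 0)"
proof -
  let ?a = "\<lambda>i. const_poly (fps_nth (fps_ln 1) i)"
  have p: "fps_nth ((- (fps_const c * fps_X ^ k)) ^ i) n = (if n = k * i then (- 1) ^ i * c ^ i else 0)" for i
  proof -
    have "- (fps_const c * fps_X ^ k) = fps_const (- c) * fps_X ^ k"
      by (simp flip: fps_const_neg)
    then have e: "(- (fps_const c * fps_X ^ k)) ^ i = fps_const ((- c) ^ i) * fps_X ^ (k * i)"
      by (simp only: monomial_power)
    show ?thesis unfolding e by (simp add: power_minus[of c] del: fps_const_power)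
  qed
  have "fps_nth (fps_log (1 - fps_const c * fps_X ^ k)) n = (\<Sum>i = 0..n. ?a i * (if n = k * i then (- 1) ^ i * c ^ i else 0))"
    unfolding fps_log_def ln_one_plus_def fps_compose_nth using p by simp
  also have "\<dots> = (if n > 0 \<and> k dvd n then - const_poly (of_nat k / of_nat n) * c ^ (n div k) else 0)"
  proof (cases "k dvd n")
    case False
    then show ?thesis by (auto intro!: sum.neutral)
  next
    case True
    then obtain j where j: "n = k * j" by blast
    have "(\<Sum>i = 0..n. ?a i * (if n = k * i then (- 1) ^ i * c ^ i else 0)) =
      (\<Sum>i = 0..n. if i = j then ?a i * ((- 1) ^ i * c ^ i) else 0)"
      using j assms by (intro sum.cong) auto
    also have "\<dots> = ?a j * ((- 1) ^ j * c ^ j)" using j assms by simp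
    also have "\<dots> = (if n > 0 \<and> k dvd n then - const_poly (of_nat k / of_nat n) * c ^ (n div k) else 0)"
    proof (cases j)
      case (Suc i)
      have "?a j = (- 1) ^ i * const_poly (1 / of_nat j)"
      proof -
        have "(- 1 :: xpoly) ^ i = const_poly ((- 1) ^ i)"
          by (induction i) (simp_all add: const_poly_uminus)
        then show ?thesis using Suc by (simp add: fps_ln_nth flip: const_poly_mult)
      qed
      moreover have "(1 :: rat) / of_nat j = of_nat k / of_nat n" using j assms by simp
      moreover have "(- 1 :: xpoly) ^ i * (- 1) ^ j = - 1" using Suc by (simp flip: power_add)
      ultimately have "?a j * ((- 1) ^ j * c ^ j) = - const_poly (of_nat k / of_nat n) * c ^ j"
        by (metis (no_types, opaque_lifting) mult.assoc mult.commute mult_minus1 mult_minus_left)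
      then show ?thesis using j assms Suc by simp
    qed (use j in \<open>simp add: fps_ln_nth\<close>)
    finally show ?thesis .
  qed
  finally show ?thesis .
qed

section \<open>The Moebius function and the logarithmic series\<close>

lemma moebius_mu_mult_prime:
  assumes "prime p" "\<not> p dvd l" "l > 0"
  shows "moebius_mu (p * l) = - moebius_mu l"
proof -
  have c: "coprime p l" using assms by (simp add: prime_imp_coprime)
  have "squarefree (p * l) \<longleftrightarrow> squarefree l"
    using squarefree_mult_coprime[OF c squarefree_prime[OF assms(1)]] squarefree_multD(2)[of p l] by blast
  moreover have "prime_factors (p * l) = insert p (prime_factors l)"
    using assms by (simp add: prime_factors_product prime_prime_factors)
  moreover have "p \<notin> prime_factors l" using assms by auto
  ultimately show ?thesis by (simp add: moebius_mu_def)
qed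

text \<open>For a prime \<open>p\<close> dividing \<open>q\<close>, multiplication by
  \<open>p\<close> pairs the squarefree divisors prime to \<open>p\<close> with those divisible by
  \<open>p\<close>, and the paired values cancel.\<close>

lemma sum_moebius_mu: 
  assumes "q > 0"
  shows "(\<Sum>l | l dvd q. moebius_mu l) = (if q = 1 then 1 else 0)"
proof (cases "q = 1")
  case True
  then show ?thesis by (simp add: moebius_mu_def)
next
  case False
  then obtain p where p: "prime p" "p dvd q" using prime_factor_nat by blast
  let ?A = "{l. l dvd q \<and> squarefree l \<and> \<not> p dvd l}" and ?B = "{l. l dvd q \<and> squarefree l \<and> p dvd l}"
  have fin: "finite {l. l dvd q}" using assms by simp
  have finA: "finite ?A" "finite ?B" using fin by (auto intro: finite_subset)
  have im: "?B = (*) p ` ?A"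
  proof (intro equalityI subsetI)
    fix l assume l: "l \<in> ?B"
    then obtain k where k: "l = p * k" by blast
    have "\<not> p dvd k"
    proof
      assume "p dvd k"
      then have "p\<^sup>2 dvd l" using k by (simp add: power2_eq_square mult_dvd_mono)
      then show False using l p(1) by (auto simp: squarefree_def)
    qed
    moreover have "squarefree k" using l k by (auto dest: squarefree_multD)
    moreover have "k dvd q" using l k dvd_mult_right by blast
    ultimately show "l \<in> (*) p ` ?A" using k by blast
  next
    fix l assume "l \<in> (*) p ` ?A"
    then obtain k where k: "l = p * k" "k dvd q" "squarefree k" "\<not> p dvd k" by blast
    have "coprime p k" using p(1) k(4) by (simp add: prime_imp_coprime)
    then show "l \<in> ?B"
      using k p divides_mult[of p q k] squarefree_mult_coprime[OF _ squarefree_prime[OF p(1)]] by auto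
  qed
  have "(\<Sum>l | l dvd q. moebius_mu l) = (\<Sum>l\<in>?A \<union> ?B. moebius_mu l)"
    using fin by (intro sum.mono_neutral_right) (auto simp: moebius_mu_def)
  also have "\<dots> = (\<Sum>l\<in>?A. moebius_mu l) + (\<Sum>l\<in>?B. moebius_mu l)"
    using finA by (intro sum.union_disjoint) auto
  also have "(\<Sum>l\<in>?B. moebius_mu l) = (\<Sum>l\<in>?A. moebius_mu (p * l))"
    unfolding im using p(1) by (subst sum.reindex) (auto simp: inj_on_def)
  also have "\<dots> = (\<Sum>l\<in>?A. - moebius_mu l)"
    using p(1) assms by (intro sum.cong refl moebius_mu_mult_prime) (auto intro: dvd_pos_nat)
  finally show ?thesis using False by (simp add: sum_negf)
qed

text \<open>The assumption says that the term for \<open>l\<close> starts in degree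
  \<open>l\<close>. This yields the convergence and cuts the sum for the coefficient
  \<open>n\<close> off at \<open>l = n\<close>.\<close>

lemma log_series_nth:
  assumes "\<And>l n. l > 0 \<Longrightarrow> n < l \<Longrightarrow>
     fps_nth (ln_one_plus (- ((- 1) ^ d * fps_X ^ l * fps_const (signed_power_sum r m l)))) n = 0"
  shows "fps_nth (log_series r m d) n = (\<Sum>l = 1..n. const_poly (moebius_mu l / of_nat l) *
     fps_nth (ln_one_plus (- ((- 1) ^ d * fps_X ^ l * fps_const (signed_power_sum r m l)))) n)"
proof -
  define t where "t l = fps_const (const_poly (moebius_mu l / of_nat l)) *
        ln_one_plus (- ((- 1) ^ d * fps_X ^ l * fps_const (signed_power_sum r m l)))" for l
  define G where "G = Abs_fps (\<lambda>n. \<Sum>l = 1..n. fps_nth (t l) n)"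
  have t0: "fps_nth (t l) n = 0" if "l > 0" "n < l" for l n using assms[OF that] by (simp add: t_def)
  have "(\<lambda>n. t (Suc n)) sums G"
    unfolding sums_def
  proof (rule tendsto_fpsI)
    fix n
    have "fps_nth (\<Sum>i<k. t (Suc i)) n = fps_nth G n" if "k \<ge> n" for k
    proof -
      have "fps_nth (\<Sum>i<k. t (Suc i)) n = (\<Sum>l = 1..k. fps_nth (t l) n)"
        by (simp add: fps_sum_nth sum.shift_bounds_Suc_ivl[symmetric] atLeast0LessThan[symmetric] atLeastLessThanSuc_atLeastAtMost)
      also have "\<dots> = (\<Sum>l = 1..n. fps_nth (t l) n)"
        using that t0 by (intro sum.mono_neutral_right) auto
      finally show ?thesis by (simp add: G_def)
    qed
    then show "eventually (\<lambda>k. fps_nth (\<Sum>i<k. t (Suc i)) n = fps_nth G n) sequentially"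
      by (auto simp: eventually_at_top_linorder)
  qed
  then have "log_series r m d = G" unfolding log_series_def Let_def t_def by (rule sums_unique[symmetric])
  then show ?thesis by (simp add: G_def t_def)
qed

section \<open>Generating functions\<close>

definition mexp :: "nat multiset \<Rightarrow> (nat \<Rightarrow>\<^sub>0 nat)" where
  "mexp A = Abs_poly_mapping (count A)"

lemma lookup_mexp [simp]: "Poly_Mapping.lookup (mexp A) = count A"
  unfolding mexp_def by (rule Abs_poly_mapping_inverse) (simp flip: set_mset_def add: count_eq_zero_iff)

lemma mexp_add: "mexp (A + B) = mexp A + mexp B"
  by (rule poly_mapping_eqI) (simp add: lookup_add)

definition mon :: "nat multiset \<Rightarrow> xpoly" where
  "mon A = Poly_Mapping.single (mexp A) 1"

lemma mon_add: "mon (A + B) = mon A * mon B"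
  by (simp add: mon_def mexp_add mult_single)

lemma mon_empty [simp]: "mon {#} = 1"
proof -
  have "mexp {#} = 0" by (rule poly_mapping_eqI) simp
  then show ?thesis by (simp add: mon_def)
qed

lemma mon_single: "mon {#i#} = xvar i"
proof -
  have "mexp {#i#} = Poly_Mapping.single i 1" by (rule poly_mapping_eqI) (simp add: lookup_single when_def)
  then show ?thesis by (simp add: mon_def xvar_def)
qed

definition psgn :: "int \<Rightarrow> xpoly" where
  "psgn k = (if odd k then - 1 else 1)"

lemma psgn_add: "psgn (a + b) = psgn a * psgn b"
  by (auto simp: psgn_def)

lemma psgn_minus: "psgn (- a) = psgn a"
  by (simp add: psgn_def)

lemma psgn_of_nat: "psgn (int n) = (- 1) ^ n"
  by (simp add: psgn_def)

definition gf :: "('a \<Rightarrow> nat) \<Rightarrow> ('a \<Rightarrow> xpoly) \<Rightarrow> 'a set \<Rightarrow> xpoly fps" where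
  "gf sz w A = Abs_fps (\<lambda>n. \<Sum>a | a \<in> A \<and> sz a = n. w a)"

text \<open>A sum over an infinite fibre would take the default value 0 in \<open>gf\<close>, and
  additivity and multiplicativity would fail.\<close>

definition finite_fibres :: "('a \<Rightarrow> nat) \<Rightarrow> 'a set \<Rightarrow> bool" where
  "finite_fibres sz A \<longleftrightarrow> (\<forall>n. finite {a. a \<in> A \<and> sz a = n})"

lemma finite_fibres_subset: "finite_fibres sz B \<Longrightarrow> A \<subseteq> B \<Longrightarrow> finite_fibres sz A"
  unfolding finite_fibres_def
proof
  fix n assume "\<forall>n. finite {a. a \<in> B \<and> sz a = n}" "A \<subseteq> B"
  then show "finite {a. a \<in> A \<and> sz a = n}" by (auto intro: finite_subset[of _ "{a. a \<in> B \<and> sz a = n}"])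
qed

lemma gf_nth: "fps_nth (gf sz w A) n = (\<Sum>a | a \<in> A \<and> sz a = n. w a)"
  by (simp add: gf_def)

lemma gf_nth_cong:
  "(\<And>a. sz a = n \<Longrightarrow> a \<in> A \<longleftrightarrow> a \<in> B) \<Longrightarrow> fps_nth (gf sz w A) n = fps_nth (gf sz w B) n"
  unfolding gf_nth by (rule sum.cong) auto

lemma gf_empty [simp]: "gf sz w {} = 0"
  by (simp add: gf_def fps_eq_iff)

lemma gf_single: "gf sz w {a} = fps_const (w a) * fps_X ^ sz a"
proof (rule fps_ext)
  fix n
  have "{b. b \<in> {a} \<and> sz b = n} = (if sz a = n then {a} else {})" by auto
  then show "fps_nth (gf sz w {a}) n = fps_nth (fps_const (w a) * fps_X ^ sz a) n"
    by (simp add: gf_nth)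
qed

lemma gf_Un:
  assumes "A \<inter> B = {}" "finite_fibres sz A" "finite_fibres sz B"
  shows "gf sz w (A \<union> B) = gf sz w A + gf sz w B"
proof (rule fps_ext)
  fix n
  have "{a. a \<in> A \<union> B \<and> sz a = n} = {a. a \<in> A \<and> sz a = n} \<union> {a. a \<in> B \<and> sz a = n}" by auto
  then show "fps_nth (gf sz w (A \<union> B)) n = fps_nth (gf sz w A + gf sz w B) n"
    using assms by (simp add: gf_nth finite_fibres_def) (subst sum.union_disjoint; auto)
qed

lemma gf_image:
  assumes "inj_on h A" "\<And>a. a \<in> A \<Longrightarrow> sz' (h a) = sz a" "\<And>a. a \<in> A \<Longrightarrow> w' (h a) = c * w a"
  shows "gf sz' w' (h ` A) = fps_const c * gf sz w A"
proof (rule fps_ext)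
  fix n
  have "{b. b \<in> h ` A \<and> sz' b = n} = h ` {a. a \<in> A \<and> sz a = n}" using assms(2) by auto
  then have "fps_nth (gf sz' w' (h ` A)) n = (\<Sum>a | a \<in> A \<and> sz a = n. w' (h a))"
    unfolding gf_nth using assms(1) by (simp add: sum.reindex inj_on_subset[of h A])
  also have "\<dots> = (\<Sum>a | a \<in> A \<and> sz a = n. c * w a)" using assms(3) by (intro sum.cong) auto
  finally show "fps_nth (gf sz' w' (h ` A)) n = fps_nth (fps_const c * gf sz w A) n"
    by (simp add: gf_nth sum_distrib_left)
qed

lemma gf_Times:
  assumes "finite_fibres sz A" "finite_fibres sz' B"
  shows "gf (\<lambda>(a, b). sz a + sz' b) (\<lambda>(a, b). w a * w' b) (A \<times> B) = gf sz w A * gf sz' w' B"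
proof (rule fps_ext)
  fix n
  let ?A = "\<lambda>k. {a. a \<in> A \<and> sz a = k}" and ?B = "\<lambda>k. {b. b \<in> B \<and> sz' b = k}"
  have "{p. p \<in> A \<times> B \<and> (case p of (a, b) \<Rightarrow> sz a + sz' b) = n} = (\<Union>k\<in>{0..n}. ?A k \<times> ?B (n - k))"
    by auto
  then have "fps_nth (gf (\<lambda>(a, b). sz a + sz' b) (\<lambda>(a, b). w a * w' b) (A \<times> B)) n =
      (\<Sum>p\<in>(\<Union>k\<in>{0..n}. ?A k \<times> ?B (n - k)). case p of (a, b) \<Rightarrow> w a * w' b)"
    by (simp add: gf_nth)
  also have "\<dots> = (\<Sum>k = 0..n. \<Sum>p\<in>?A k \<times> ?B (n - k). case p of (a, b) \<Rightarrow> w a * w' b)"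
    using assms by (intro sum.UNION_disjoint) (auto simp: finite_fibres_def)
  also have "\<dots> = (\<Sum>k = 0..n. (\<Sum>a\<in>?A k. w a) * (\<Sum>b\<in>?B (n - k). w' b))"
    by (simp add: sum_product sum.cartesian_product)
  finally show "fps_nth (gf (\<lambda>(a, b). sz a + sz' b) (\<lambda>(a, b). w a * w' b) (A \<times> B)) n =
      fps_nth (gf sz w A * gf sz' w' B) n"
    by (simp add: fps_mult_nth gf_nth)
qed

text \<open>Because of this bound, coefficients of the series of trees of bounded height become
  stationary: degree \<open>n\<close> involves no height beyond \<open>n\<close>.\<close>

lemma height_less_leaves: "pwf r T \<Longrightarrow> height T < size (pleaves T)"
proof (induction rule: pwf.induct)
  case (1 i)
  then show ?case by (simp add: height.simps)
next
  case inner: (2 M)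
  have "height U < size (\<Sum>\<^sub># (image_mset pleaves M)) - 1" if "U \<in># M" for U
  proof -
    from multi_member_split[OF \<open>U \<in># M\<close>] obtain N where N: "M = add_mset U N" by blast
    then have "size N \<ge> 1" using inner.hyps(2) by simp
    moreover have "size N \<le> size (\<Sum>\<^sub># (image_mset pleaves N))" using inner.hyps(1) N by (intro size_le_leaves) auto
    ultimately show ?thesis using inner.IH[OF that] N by simp
  qed
  moreover have "size (\<Sum>\<^sub># (image_mset pleaves M)) \<ge> 2" using size_le_leaves[of M r] inner.hyps by simp
  ultimately have "height (PN None M) < Suc (size (\<Sum>\<^sub># (image_mset pleaves M)) - 1)"
    unfolding height_less_iff by blast
  then show ?case using \<open>size (\<Sum>\<^sub># (image_mset pleaves M)) \<ge> 2\<close> by simp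
qed

text \<open>
  The weights are raised to the power \<open>l\<close>, and the sizes are multiplied by \<open>l\<close>, because the
  recursion is needed after the substitutions \<open>u \<mapsto> u ^ l\<close>, \<open>x i \<mapsto> x i ^ l\<close> that leave the signs
  unchanged.
\<close>

context
  fixes r d l :: nat and m :: "nat \<Rightarrow> nat"
  assumes l_pos: "l > 0"
begin

definition tsize :: "ptree \<Rightarrow> nat" where
  "tsize T = l * size (pleaves T)"

definition tweight :: "ptree \<Rightarrow> xpoly" where
  "tweight T = psgn (pdegree m d T) * mon (pleaves T) ^ l"

definition msize :: "ptree multiset \<Rightarrow> nat" where
  "msize M = l * size (\<Sum>\<^sub># (image_mset pleaves M))"

definition mweight :: "ptree multiset \<Rightarrow> xpoly" where
  "mweight M = psgn (\<Sum>\<^sub># (image_mset (pdegree m d) M)) * mon (\<Sum>\<^sub># (image_mset pleaves M)) ^ l"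

definition trees :: "ptree set" where
  "trees = {T. pwf r T \<and> pgood m d T}"

definition trees_below :: "nat \<Rightarrow> ptree set" where
  "trees_below h = {T. pwf r T \<and> pgood m d T \<and> height T < h}"

text \<open>With \<open>mweight\<close>, the series of \<open>mults A\<close> is the plethystic
  exponential of that of \<open>A\<close>, in the signed sense: odd trees behave like exterior
  variables and even trees like symmetric ones.\<close>

definition mults :: "ptree set \<Rightarrow> ptree multiset set" where
  "mults A = {M. set_mset M \<subseteq> A \<and> no_odd_repeat (podd m d) M}"

abbreviation "tgf \<equiv> gf tsize tweight"
abbreviation "mgf \<equiv> gf msize mweight"

lemma msize_simps [simp]:
  "msize {#} = 0" "msize {#T#} = tsize T" "msize (add_mset T M) = tsize T + msize M"
  "msize (M + N) = msize M + msize N"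
  by (simp_all add: msize_def tsize_def algebra_simps)

lemma mweight_simps:
  "mweight {#} = 1" "mweight (add_mset T M) = tweight T * mweight M" "mweight (M + N) = mweight M * mweight N"
  by (simp_all add: mweight_def tweight_def psgn_add mon_add power_mult_distrib) (simp add: psgn_def)

lemma mweight_single [simp]: "mweight {#T#} = tweight T"
  by (simp add: mweight_simps)

lemma trees_below_subset: "trees_below h \<subseteq> trees"
  by (auto simp: trees_below_def trees_def)

lemma finite_fibres_trees: "finite_fibres tsize trees"
  unfolding finite_fibres_def
proof
  fix n
  have "{T. T \<in> trees \<and> tsize T = n} \<subseteq> {T. pwf r T \<and> size (pleaves T) \<le> n}"
    using l_pos by (auto simp: trees_def tsize_def)
  then show "finite {T. T \<in> trees \<and> tsize T = n}" using finite_planted finite_subset by blast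
qed

lemma factor_le: "l * k \<le> h \<Longrightarrow> k \<le> h"
  using l_pos by (cases l) auto

lemma member_leaves: "T \<in># M \<Longrightarrow> size (pleaves T) \<le> size (\<Sum>\<^sub># (image_mset pleaves M))"
  using sum_mset_ge_member[of T M "\<lambda>T. size (pleaves T)"] unfolding size_sum_mset .

lemma finite_fibres_mults: "finite_fibres msize {M. set_mset M \<subseteq> trees}"
  unfolding finite_fibres_def
proof
  fix n
  have "{M. M \<in> {M. set_mset M \<subseteq> trees} \<and> msize M = n} \<subseteq>
     {M. set_mset M \<subseteq> {T. pwf r T \<and> size (pleaves T) \<le> n} \<and> size M \<le> n}"
  proof
    fix M assume "M \<in> {M. M \<in> {M. set_mset M \<subseteq> trees} \<and> msize M = n}"
    then have M: "\<And>T. T \<in># M \<Longrightarrow> pwf r T" "l * size (\<Sum>\<^sub># (image_mset pleaves M)) = n"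
      by (auto simp: trees_def msize_def)
    have le: "size (\<Sum>\<^sub># (image_mset pleaves M)) \<le> n" by (rule factor_le) (simp only: M(2))
    have "size M \<le> n" using size_le_leaves[OF M(1)] le by (meson le_trans)
    moreover have "size (pleaves T) \<le> n" if "T \<in># M" for T using member_leaves[OF that] le by simp
    ultimately show "M \<in> {M. set_mset M \<subseteq> {T. pwf r T \<and> size (pleaves T) \<le> n} \<and> size M \<le> n}"
      using M(1) by auto
  qed
  then show "finite {M. M \<in> {M. set_mset M \<subseteq> trees} \<and> msize M = n}"
    using finite_bounded_multisets[OF finite_planted] finite_subset by blast
qed

lemma tfin: "A \<subseteq> trees \<Longrightarrow> finite_fibres tsize A"
  using finite_fibres_subset[OF finite_fibres_trees] .

lemma mfin: "(\<And>M. M \<in> X \<Longrightarrow> set_mset M \<subseteq> trees) \<Longrightarrow> finite_fibres msize X"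
  by (rule finite_fibres_subset[OF finite_fibres_mults]) auto

lemma mgf_plus:
  assumes "A \<inter> B = {}" "A \<subseteq> trees" "B \<subseteq> trees"
    "\<And>M. M \<in> X \<Longrightarrow> set_mset M \<subseteq> A" "\<And>M. M \<in> Y \<Longrightarrow> set_mset M \<subseteq> B"
  shows "mgf ((\<lambda>(M, N). M + N) ` (X \<times> Y)) = mgf X * mgf Y"
proof -
  have "inj_on (\<lambda>(M, N). M + N) (X \<times> Y)"
  proof (rule inj_onI, clarify)
    fix M N M' N' assume *: "M \<in> X" "N \<in> Y" "M' \<in> X" "N' \<in> Y" "M + N = M' + N'"
    have f: "filter_mset (\<lambda>T. T \<in> A) (K + L) = K" if "K \<in> X" "L \<in> Y" for K L
    proof -
      have "filter_mset (\<lambda>T. T \<in> A) K = K" using assms(4)[OF that(1)] by (auto simp: filter_mset_eq_conv)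
      moreover have "filter_mset (\<lambda>T. T \<in> A) L = {#}" using assms(1,5) that(2) by (auto simp: filter_mset_eq_conv)
      ultimately show ?thesis by simp
    qed
    have "M = M'" using f *(1-4) *(5) by metis
    then show "M = M' \<and> N = N'" using *(5) by simp
  qed
  then have "mgf ((\<lambda>(M, N). M + N) ` (X \<times> Y)) =
     fps_const 1 * gf (\<lambda>(M, N). msize M + msize N) (\<lambda>(M, N). mweight M * mweight N) (X \<times> Y)"
    by (intro gf_image) (auto simp: mweight_simps)
  also have "\<dots> = mgf X * mgf Y"
  proof -
    have "finite_fibres msize X" "finite_fibres msize Y"
      using assms(2-5) by (intro mfin; blast)+
    then show ?thesis by (simp add: gf_Times)
  qed
  finally show ?thesis .
qed

lemma no_odd_repeat_plus:
  assumes "set_mset M \<inter> set_mset N = {}"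
  shows "no_odd_repeat od (M + N) \<longleftrightarrow> no_odd_repeat od M \<and> no_odd_repeat od N"
proof -
  have "count M x = 0 \<or> count N x = 0" for x
    using assms by (metis disjoint_iff count_eq_zero_iff)
  then have "count M x + count N x \<le> 1 \<longleftrightarrow> count M x \<le> 1 \<and> count N x \<le> 1" for x
    by (metis add.commute add_0 zero_le)
  then show ?thesis by (auto simp: no_odd_repeat_def)
qed

text \<open>A multiset over a disjoint union splits into its two parts. The predicate on the part in
  \<open>B\<close> will be the requirement of two branches of maximal height.\<close>

lemma mults_plus:
  assumes "A \<inter> B = {}"
  shows "(\<lambda>(M, N). M + N) ` (mults A \<times> {N \<in> mults B. P N}) =
    {M \<in> mults (A \<union> B). P (filter_mset (\<lambda>T. T \<in> B) M)}"
proof (intro equalityI subsetI)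
  fix K assume "K \<in> (\<lambda>(M, N). M + N) ` (mults A \<times> {N \<in> mults B. P N})"
  then obtain M N where K: "K = M + N" "M \<in> mults A" "N \<in> mults B" "P N" by auto
  have "set_mset M \<inter> set_mset N = {}" using K assms by (auto simp: mults_def)
  moreover have "filter_mset (\<lambda>T. T \<in> B) M = {#}" "filter_mset (\<lambda>T. T \<in> B) N = N"
    using K(2,3) assms by (auto simp: mults_def filter_mset_eq_conv)
  then have "filter_mset (\<lambda>T. T \<in> B) K = N" using K(1) by (metis add_0 filter_union_mset)
  ultimately show "K \<in> {M \<in> mults (A \<union> B). P (filter_mset (\<lambda>T. T \<in> B) M)}"
    using K by (auto simp: mults_def no_odd_repeat_plus)
next
  fix K assume K: "K \<in> {M \<in> mults (A \<union> B). P (filter_mset (\<lambda>T. T \<in> B) M)}"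
  let ?M = "filter_mset (\<lambda>T. T \<notin> B) K" and ?N = "filter_mset (\<lambda>T. T \<in> B) K"
  have eq: "K = ?M + ?N" by (metis add.commute multiset_partition)
  have "no_odd_repeat (podd m d) (?M + ?N)" using K eq by (simp add: mults_def)
  then have "no_odd_repeat (podd m d) ?M" "no_odd_repeat (podd m d) ?N"
    by (subst (asm) no_odd_repeat_plus; auto)+
  then have "(?M, ?N) \<in> mults A \<times> {N \<in> mults B. P N}" using K by (auto simp: mults_def)
  then show "K \<in> (\<lambda>(M, N). M + N) ` (mults A \<times> {N \<in> mults B. P N})"
    using eq by (metis (no_types, lifting) case_prod_conv image_eqI)
qed

lemma mgf_mults_plus:
  assumes "A \<inter> B = {}" "A \<subseteq> trees" "B \<subseteq> trees"
  shows "mgf {M \<in> mults (A \<union> B). P (filter_mset (\<lambda>T. T \<in> B) M)} = mgf (mults A) * mgf {N \<in> mults B. P N}"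
  unfolding mults_plus[OF assms(1), symmetric]
  by (rule mgf_plus[OF assms]) (auto simp: mults_def)

lemma mgf_mults_Un:
  assumes "A \<inter> B = {}" "A \<subseteq> trees" "B \<subseteq> trees"
  shows "mgf (mults (A \<union> B)) = mgf (mults A) * mgf (mults B)"
  using mgf_mults_plus[OF assms, of "\<lambda>_. True"] by simp

lemma mgf_size_split:
  assumes "A \<subseteq> trees"
  shows "mgf (mults A) = 1 + tgf A + mgf {M \<in> mults A. size M \<ge> 2}"
proof -
  have split: "mults A = ({{#}} \<union> (\<lambda>T. {#T#}) ` A) \<union> {M \<in> mults A. size M \<ge> 2}"
  proof (intro equalityI subsetI)
    fix M assume M: "M \<in> mults A"
    consider "size M = 0" | "size M = 1" | "size M \<ge> 2" by linarith
    then show "M \<in> ({{#}} \<union> (\<lambda>T. {#T#}) ` A) \<union> {M \<in> mults A. size M \<ge> 2}"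
    proof cases
      case 2
      then obtain T where "M = {#T#}" using size_1_singleton_mset by blast
      then show ?thesis using M by (auto simp: mults_def)
    qed (use M in auto)
  qed (auto simp: mults_def no_odd_repeat_def)
  have 1: "finite_fibres msize {{#}}" "finite_fibres msize ((\<lambda>T. {#T#}) ` A)"
    "finite_fibres msize {M \<in> mults A. size M \<ge> 2}" "finite_fibres msize ({{#}} \<union> (\<lambda>T. {#T#}) ` A)"
    using assms by (auto intro!: mfin simp: mults_def)
  have "mgf ((\<lambda>T. {#T#}) ` A) = fps_const 1 * tgf A" by (rule gf_image) (auto simp: inj_on_def)
  moreover have "mgf {{#}} = 1" by (simp add: gf_single mweight_simps)
  ultimately have "mgf ({{#}} \<union> (\<lambda>T. {#T#}) ` A) = 1 + tgf A"
    using 1 by (subst gf_Un) auto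
  then show ?thesis
    by (subst split, subst gf_Un) (use 1 in auto)
qed

text \<open>So \<open>1 + ell\<close> is the argument of the logarithm with index \<open>l\<close>
  in the theorem. The outer minus sign comes from the degree \<open>d - 1\<close> of the stem of a
  leaf.\<close>

definition ell :: "xpoly fps" where
  "ell = - ((- 1) ^ d * fps_X ^ l * fps_const (signed_power_sum r m l))"

lemma gf_leaves: "tgf ((\<lambda>i. PN (Some i) {#}) ` {1..r}) = ell"
proof -
  have "tgf ((\<lambda>i. PN (Some i) {#}) ` {1..r}) = fps_const (- ((- 1) ^ d)) * gf (\<lambda>i. l) (\<lambda>i. (- 1) ^ m i * xvar i ^ l) {1..r}"
  proof (rule gf_image)
    show "tweight (PN (Some i) {#}) = - ((- 1) ^ d) * ((- 1) ^ m i * xvar i ^ l)" for i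
    proof -
      have "psgn (int d - 1 - int (m i)) = - ((- 1) ^ d * (- 1) ^ m i)"
        using psgn_add[of "int d" "- 1 - int (m i)"] psgn_add[of "- 1" "- int (m i)"]
        by (simp add: psgn_minus psgn_of_nat) (simp add: psgn_def)
      then show ?thesis by (simp add: tweight_def mon_single)
    qed
  qed (auto simp: inj_on_def tsize_def)
  also have "gf (\<lambda>i. l) (\<lambda>i. (- 1) ^ m i * xvar i ^ l) {1..r} = fps_X ^ l * fps_const (signed_power_sum r m l)"
    by (rule fps_ext) (auto simp: gf_nth signed_power_sum_def intro!: sum.cong)
  also have "fps_const (- ((- 1) ^ d)) * (fps_X ^ l * fps_const (signed_power_sum r m l)) = ell"
    by (simp add: ell_def fps_const_power[symmetric] flip: fps_const_neg fps_const_1_eq_1)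
  finally show ?thesis .
qed

abbreviation "tgf_below h \<equiv> tgf (trees_below h)"

lemma trees_below_0: "trees_below 0 = {}"
  by (simp add: trees_below_def)

lemma trees_below_Suc:
  "trees_below (Suc h) = (\<lambda>i. PN (Some i) {#}) ` {1..r} \<union> PN None ` {M \<in> mults (trees_below h). size M \<ge> 2}"
proof (intro equalityI subsetI)
  fix T assume "T \<in> trees_below (Suc h)"
  then have T: "pwf r T" "pgood m d T" "height T < Suc h" by (auto simp: trees_below_def)
  from T(1) show "T \<in> (\<lambda>i. PN (Some i) {#}) ` {1..r} \<union> PN None ` {M \<in> mults (trees_below h). size M \<ge> 2}"
  proof cases
    case (2 M)
    have "\<forall>U\<in>#M. height U < h" using T(3) unfolding 2(1) height_less_iff .
    then have "M \<in> mults (trees_below h)" using 2 T(2) by (auto simp: mults_def trees_below_def)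
    then show ?thesis using 2 by blast
  qed auto
next
  fix T assume "T \<in> (\<lambda>i. PN (Some i) {#}) ` {1..r} \<union> PN None ` {M \<in> mults (trees_below h). size M \<ge> 2}"
  then show "T \<in> trees_below (Suc h)"
  proof
    assume "T \<in> (\<lambda>i. PN (Some i) {#}) ` {1..r}"
    then show ?thesis by (auto simp: trees_below_def pwf_PN no_odd_repeat_def height.simps)
  next
    assume "T \<in> PN None ` {M \<in> mults (trees_below h). size M \<ge> 2}"
    then obtain M where M: "T = PN None M" "M \<in> mults (trees_below h)" "size M \<ge> 2" by blast
    have "height T < Suc h" unfolding M(1) height_less_iff using M(2) by (auto simp: mults_def trees_below_def)
    then show ?thesis using M by (auto simp: trees_below_def pwf_PN mults_def)
  qed
qed

lemma tgf_below_rec: "tgf_below (Suc h) = ell - (mgf (mults (trees_below h)) - 1 - tgf_below h)"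
proof -
  let ?L = "(\<lambda>i. PN (Some i) {#}) ` {1..r}" and ?M = "{M \<in> mults (trees_below h). size M \<ge> 2}"
  have "?L \<union> PN None ` ?M \<subseteq> trees" using trees_below_subset[of "Suc h"] unfolding trees_below_Suc .
  then have "tgf_below (Suc h) = tgf ?L + tgf (PN None ` ?M)"
    unfolding trees_below_Suc by (intro gf_Un) (auto intro!: tfin)
  also have "tgf (PN None ` ?M) = fps_const (- 1) * mgf ?M"
  proof (rule gf_image)
    show "tweight (PN None M) = - 1 * mweight M" for M
      using psgn_add[of "- 1" "\<Sum>\<^sub># (image_mset (pdegree m d) M)"]
      by (simp add: tweight_def mweight_def) (simp add: psgn_def)
  qed (auto simp: inj_on_def tsize_def msize_def)
  also have "mgf ?M = mgf (mults (trees_below h)) - 1 - tgf_below h"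
    using mgf_size_split[OF trees_below_subset] by simp
  finally show ?thesis unfolding gf_leaves by (simp flip: fps_const_neg)
qed

lemma tgf_stable: "n \<le> h \<Longrightarrow> fps_nth (tgf_below h) n = fps_nth (tgf trees) n"
proof (rule gf_nth_cong)
  fix T assume "n \<le> h" "tsize T = n"
  then have "l * size (pleaves T) \<le> h" by (simp add: tsize_def)
  then have "size (pleaves T) \<le> h" by (rule factor_le)
  then show "T \<in> trees_below h \<longleftrightarrow> T \<in> trees"
    using height_less_leaves[of r T] by (auto simp: trees_below_def trees_def)
qed

lemma mults_stable:
  assumes "n \<le> h" "msize M = n"
  shows "set_mset M \<subseteq> trees_below h \<longleftrightarrow> set_mset M \<subseteq> trees"
proof
  have "l * size (\<Sum>\<^sub># (image_mset pleaves M)) \<le> h" using assms by (simp add: msize_def)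
  then have le: "size (\<Sum>\<^sub># (image_mset pleaves M)) \<le> h" by (rule factor_le)
  assume M: "set_mset M \<subseteq> trees"
  show "set_mset M \<subseteq> trees_below h"
  proof
    fix T assume "T \<in># M"
    then have "T \<in> trees" "size (pleaves T) \<le> h" using M member_leaves le by fastforce+
    then show "T \<in> trees_below h" using height_less_leaves[of r T] by (auto simp: trees_below_def trees_def)
  qed
qed (use trees_below_subset in blast)

text \<open>In degree \<open>n\<close> the series for the heights below \<open>n\<close> and below
  \<open>Suc n\<close> both agree with the limit, and their difference drops out of the
  recursion.\<close>

lemma mgf_trees: "mgf (mults trees) = 1 + ell"
proof (rule fps_ext)
  fix n
  have "fps_nth (mgf (mults trees)) n = fps_nth (mgf (mults (trees_below n))) n"
    using mults_stable[of n n] by (intro gf_nth_cong) (auto simp: mults_def)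
  also have "mgf (mults (trees_below n)) = 1 + ell + tgf_below n - tgf_below (Suc n)" using tgf_below_rec[of n] by simp
  finally show "fps_nth (mgf (mults trees)) n = fps_nth (1 + ell) n"
    by (simp add: tgf_stable)
qed

text \<open>Two distinct trees form one unordered pair, which lies in both sets, and two ordered
  pairs. A repeated tree lies in the first set if it is even and in the second if it is odd. So each
  ordered pair is counted once.\<close>

lemma sum_of_squares:
  assumes "Q \<subseteq> trees"
  shows "mgf {M \<in> mults Q. size M = 2} + mgf {M. set_mset M \<subseteq> Q \<and> size M = 2 \<and> no_odd_repeat (\<lambda>T. \<not> podd m d T) M}
     = tgf Q * tgf Q"
proof -
  let ?D = "\<lambda>S. (\<lambda>T. {#T, T#}) ` {T \<in> Q. S T}"
  let ?N = "(\<lambda>(T, U). {#T, U#}) ` {(T, U). T \<in> Q \<and> U \<in> Q \<and> T \<noteq> U \<and> lt0 T U}"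
  have lt: "T \<noteq> U \<Longrightarrow> lt0 T U = (\<not> lt0 U T)" for T U :: ptree
    by (rule tournament_lt0[unfolded tournament_def, rule_format])
  have sz2: "\<exists>T U. M = {#T, U#}" if M: "size M = 2" for M :: "ptree multiset"
  proof -
    obtain T N where "M = add_mset T N" "size N = 1" using M by (cases M) auto
    then show ?thesis using size_1_singleton_mset by blast
  qed
  have split: "{M. set_mset M \<subseteq> Q \<and> size M = 2 \<and> no_odd_repeat S M} = ?D (\<lambda>T. \<not> S T) \<union> ?N" for S
  proof (intro equalityI subsetI)
    fix M assume M: "M \<in> {M. set_mset M \<subseteq> Q \<and> size M = 2 \<and> no_odd_repeat S M}"
    then have sM: "size M = 2" "set_mset M \<subseteq> Q" by simp_all
    from sz2[OF sM(1)] obtain T U where "M = {#T, U#}" by blast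
    then have TU: "M = {#T, U#}" "T \<in> Q" "U \<in> Q" using sM(2) by simp_all
    show "M \<in> ?D (\<lambda>T. \<not> S T) \<union> ?N"
    proof (cases "T = U")
      case True
      then have "\<not> S T" using M TU by (auto simp: no_odd_repeat_def split: if_splits)
      then show ?thesis using TU True by blast
    next
      case False
      then have "(T, U) \<in> {(T, U). T \<in> Q \<and> U \<in> Q \<and> T \<noteq> U \<and> lt0 T U} \<or> (U, T) \<in> {(T, U). T \<in> Q \<and> U \<in> Q \<and> T \<noteq> U \<and> lt0 T U}"
        using lt[OF False] TU by auto
      then show ?thesis
      proof
        assume "(T, U) \<in> {(T, U). T \<in> Q \<and> U \<in> Q \<and> T \<noteq> U \<and> lt0 T U}"
        then show ?thesis using TU(1) by (intro UnI2 image_eqI[of _ _ "(T, U)"]) simp_all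
      next
        assume "(U, T) \<in> {(T, U). T \<in> Q \<and> U \<in> Q \<and> T \<noteq> U \<and> lt0 T U}"
        then show ?thesis using TU(1) by (intro UnI2 image_eqI[of _ _ "(U, T)"]) (simp_all add: add_mset_commute)
      qed
    qed
  qed (auto simp: no_odd_repeat_def)
  have fin: "finite_fibres msize (?D S)" "finite_fibres msize ?N" for S
    using assms by (auto intro!: mfin)
  have pfin: "finite_fibres (\<lambda>(T, U). tsize T + tsize U) X" if "X \<subseteq> Q \<times> Q" for X
    unfolding finite_fibres_def
  proof
    fix n
    have "{p. p \<in> X \<and> (case p of (T, U) \<Rightarrow> tsize T + tsize U) = n} \<subseteq>
       (\<Union>k\<in>{0..n}. {T. T \<in> Q \<and> tsize T = k}) \<times> (\<Union>k\<in>{0..n}. {T. T \<in> Q \<and> tsize T = k})" using that by auto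
    moreover have "finite \<dots>" using tfin[OF assms] by (auto simp: finite_fibres_def)
    ultimately show "finite {p. p \<in> X \<and> (case p of (T, U) \<Rightarrow> tsize T + tsize U) = n}" by (rule finite_subset)
  qed
  let ?g = "gf (\<lambda>(T, U). tsize T + tsize U) (\<lambda>(T, U). tweight T * tweight U)"
  let ?Lt = "{(T, U). T \<in> Q \<and> U \<in> Q \<and> T \<noteq> U \<and> lt0 T U}"
  let ?Gt = "(\<lambda>(T, U). (U, T)) ` ?Lt"
  let ?Eq = "\<lambda>S. (\<lambda>T. (T, T)) ` {T \<in> Q. S T}"
  have N: "mgf ?N = fps_const 1 * ?g ?Lt"
  proof (rule gf_image)
    show "inj_on (\<lambda>(T, U). {#T, U#}) ?Lt"
    proof (rule inj_onI, clarify)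
      fix T U T' U' :: ptree
      assume *: "T \<noteq> U" "lt0 T U" "T' \<noteq> U'" "lt0 T' U'" "{#T, U#} = {#T', U'#}"
      from *(5) have "T = T' \<and> U = U' \<or> T = U' \<and> U = T'" by (auto simp: add_eq_conv_ex)
      then show "T = T' \<and> U = U'" using * lt by blast
    qed
  qed (auto simp: mweight_simps)
  have D: "mgf (?D S) = fps_const 1 * ?g (?Eq S)" for S
  proof -
    have "mgf (?D S) = fps_const 1 * gf (\<lambda>T. tsize T + tsize T) (\<lambda>T. tweight T * tweight T) {T \<in> Q. S T}"
      by (rule gf_image) (auto simp: inj_on_def mweight_simps dest!: arg_cong[of _ _ set_mset])
    moreover have "?g (?Eq S) = fps_const 1 * gf (\<lambda>T. tsize T + tsize T) (\<lambda>T. tweight T * tweight T) {T \<in> Q. S T}"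
      by (rule gf_image) (auto simp: inj_on_def)
    ultimately show ?thesis by simp
  qed
  have G: "?g ?Gt = fps_const 1 * ?g ?Lt"
    by (rule gf_image) (auto simp: inj_on_def)
  have prod: "Q \<times> Q = ((?Eq (podd m d) \<union> ?Eq (\<lambda>T. \<not> podd m d T)) \<union> ?Lt) \<union> ?Gt"
  proof (intro equalityI subsetI)
    fix p assume "p \<in> Q \<times> Q"
    then obtain T U where p: "p = (T, U)" "T \<in> Q" "U \<in> Q" by auto
    then show "p \<in> ((?Eq (podd m d) \<union> ?Eq (\<lambda>T. \<not> podd m d T)) \<union> ?Lt) \<union> ?Gt"
      using lt[of T U] by (cases "T = U"; cases "lt0 T U"; cases "podd m d T") (auto simp: image_iff)
  qed auto
  have disj: "?Eq (podd m d) \<inter> ?Eq (\<lambda>T. \<not> podd m d T) = {}"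
    "(?Eq (podd m d) \<union> ?Eq (\<lambda>T. \<not> podd m d T)) \<inter> ?Lt = {}"
    "((?Eq (podd m d) \<union> ?Eq (\<lambda>T. \<not> podd m d T)) \<union> ?Lt) \<inter> ?Gt = {}"
    using lt by auto
  have "tgf Q * tgf Q = ?g (Q \<times> Q)" using tfin[OF assms] by (simp add: gf_Times)
  also have "\<dots> = ?g (?Eq (podd m d)) + ?g (?Eq (\<lambda>T. \<not> podd m d T)) + ?g ?Lt + ?g ?Gt"
    unfolding prod using disj by (subst gf_Un | force intro!: pfin)+
  finally have P: "tgf Q * tgf Q = ?g (?Eq (podd m d)) + ?g (?Eq (\<lambda>T. \<not> podd m d T)) + ?g ?Lt + ?g ?Lt"
    using G by simp
  have M: "mgf {M. set_mset M \<subseteq> Q \<and> size M = 2 \<and> no_odd_repeat S M} = ?g (?Eq (\<lambda>T. \<not> S T)) + ?g ?Lt" for S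
  proof -
    have "?D (\<lambda>T. \<not> S T) \<inter> ?N = {}" by (auto dest!: arg_cong[of _ _ set_mset])
    then show ?thesis unfolding split using fin D N by (subst gf_Un) simp_all
  qed
  have "{M \<in> mults Q. size M = 2} = {M. set_mset M \<subseteq> Q \<and> size M = 2 \<and> no_odd_repeat (podd m d) M}"
    by (auto simp: mults_def)
  then show ?thesis using M[of "podd m d"] M[of "\<lambda>T. \<not> podd m d T"] P by simp
qed

section \<open>Centred forms of bounded height\<close>

definition csize :: "cform \<Rightarrow> nat" where
  "csize c = l * size (cleaves c)"

definition cweight :: "cform \<Rightarrow> xpoly" where
  "cweight c = psgn (cdegree m d c) * mon (cleaves c) ^ l"

definition even_pairs :: "ptree set \<Rightarrow> ptree multiset set" where
  "even_pairs A = {M. set_mset M \<subseteq> A \<and> size M = 2 \<and> no_odd_repeat (\<lambda>T. \<not> podd m d T) M}"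

definition vertex_forms :: "nat \<Rightarrow> ptree multiset set" where
  "vertex_forms h = {M \<in> mults (trees_below h). size M \<ge> 3 \<and> two_max M}"

definition edge_forms :: "nat \<Rightarrow> ptree multiset set" where
  "edge_forms h = {M \<in> even_pairs (trees_below h). \<forall>T\<in>#M. \<forall>U\<in>#M. height T = height U}"

definition level :: "nat \<Rightarrow> ptree set" where
  "level h = {T. pwf r T \<and> pgood m d T \<and> height T = h}"

lemma level_simps:
  "trees_below (Suc h) = trees_below h \<union> level h" "trees_below h \<inter> level h = {}" "level h \<subseteq> trees"
  by (auto simp: trees_below_def level_def trees_def)

lemma tgf_below_Suc: "tgf_below (Suc h) = tgf_below h + tgf (level h)"
  unfolding level_simps(1)
  by (rule gf_Un[OF level_simps(2)]) (simp_all add: tfin level_simps trees_below_subset)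

lemma level_filter:
  assumes "set_mset M \<subseteq> trees_below (Suc h)"
  shows "filter_mset (\<lambda>T. T \<in> level h) M = filter_mset (\<lambda>T. height T = h) M"
  using assms by (intro filter_mset_cong) (auto simp: level_def trees_below_def)

text \<open>The maximum attained twice is either the top height \<open>h\<close> or lower; in the
  latter case no branch reaches the top level.\<close>

lemma two_max_below_Suc:
  assumes "set_mset M \<subseteq> trees_below (Suc h)"
  shows "two_max M \<longleftrightarrow> size (filter_mset (\<lambda>T. T \<in> level h) M) \<ge> 2 \<or> (set_mset M \<subseteq> trees_below h \<and> two_max M)"
proof
  assume "two_max M"
  then obtain k where k: "\<forall>T\<in>#M. height T \<le> k" "size (filter_mset (\<lambda>T. height T = k) M) \<ge> 2"
    by (auto simp: two_max_def)
  then have "filter_mset (\<lambda>T. height T = k) M \<noteq> {#}" by fastforce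
  then obtain T where "T \<in># M" "height T = k" by (auto simp: filter_mset_eq_mempty_iff)
  then have "k < Suc h" using assms by (auto simp: trees_below_def)
  then consider "k = h" | "k < h" by linarith
  then show "size (filter_mset (\<lambda>T. T \<in> level h) M) \<ge> 2 \<or> (set_mset M \<subseteq> trees_below h \<and> two_max M)"
  proof cases
    case 1 then show ?thesis using k level_filter[OF assms] by simp
  next
    case 2
    then have "set_mset M \<subseteq> trees_below h" using k(1) assms by (fastforce simp: trees_below_def)
    then show ?thesis using \<open>two_max M\<close> by simp
  qed
next
  assume "size (filter_mset (\<lambda>T. T \<in> level h) M) \<ge> 2 \<or> (set_mset M \<subseteq> trees_below h \<and> two_max M)"
  then show "two_max M"
  proof
    assume "size (filter_mset (\<lambda>T. T \<in> level h) M) \<ge> 2"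
    moreover have "\<forall>T\<in>#M. height T \<le> h" using assms by (auto simp: trees_below_def)
    ultimately show ?thesis using level_filter[OF assms] by (auto simp: two_max_def)
  qed simp
qed

lemma vertex_forms_Suc:
  "vertex_forms (Suc h) = vertex_forms h \<union>
     {M \<in> mults (trees_below (Suc h)). size M \<ge> 3 \<and> size (filter_mset (\<lambda>T. T \<in> level h) M) \<ge> 2}"
proof -
  have "mults (trees_below h) \<subseteq> mults (trees_below (Suc h))" by (auto simp: mults_def level_simps(1))
  then show ?thesis
    unfolding vertex_forms_def using two_max_below_Suc[of _ h] by (auto simp: mults_def)
qed

lemma no_level:
  "set_mset M \<subseteq> trees_below h \<Longrightarrow> filter_mset (\<lambda>T. T \<in> level h) M = {#}"
  using level_simps(2)[of h] by (auto simp: filter_mset_eq_mempty_iff)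

lemma edge_forms_Suc: "edge_forms (Suc h) = edge_forms h \<union> even_pairs (level h)"
proof (intro equalityI subsetI)
  fix M assume "M \<in> edge_forms (Suc h)"
  then have M: "set_mset M \<subseteq> trees_below (Suc h)" "size M = 2" "no_odd_repeat (\<lambda>T. \<not> podd m d T) M"
    "\<forall>T\<in>#M. \<forall>U\<in>#M. height T = height U" unfolding edge_forms_def even_pairs_def by blast+
  have "M \<noteq> {#}" using M(2) by auto
  then obtain T where T: "T \<in># M" by blast
  have hT: "height U = height T" if "U \<in># M" for U using M(4) T that by blast
  have "height T < Suc h" using M(1) T by (auto simp: trees_below_def)
  then consider "height T = h" | "height T < h" by linarith
  then show "M \<in> edge_forms h \<union> even_pairs (level h)"
  proof cases
    case 1
    have "set_mset M \<subseteq> level h"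
    proof
      fix U assume "U \<in># M"
      with M(1) hT[of U] 1 show "U \<in> level h" by (auto simp: trees_below_def level_def)
    qed
    then show ?thesis using M(2,3) by (simp add: even_pairs_def)
  next
    case 2
    have "set_mset M \<subseteq> trees_below h"
    proof
      fix U assume "U \<in># M"
      with M(1) hT[of U] 2 show "U \<in> trees_below h" by (auto simp: trees_below_def)
    qed
    then show ?thesis using M(2-4) unfolding edge_forms_def even_pairs_def by blast
  qed
next
  fix M assume "M \<in> edge_forms h \<union> even_pairs (level h)"
  then show "M \<in> edge_forms (Suc h)"
  proof
    assume "M \<in> even_pairs (level h)"
    then have M: "set_mset M \<subseteq> level h" "M \<in> even_pairs (trees_below (Suc h))"
      by (auto simp: even_pairs_def level_simps(1))
    have "height T = height U" if "T \<in># M" "U \<in># M" for T U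
    proof -
      have "height T = h" "height U = h" using M(1) that by (auto simp: level_def)
      then show ?thesis by simp
    qed
    with M(2) show ?thesis unfolding edge_forms_def by blast
  next
    assume "M \<in> edge_forms h"
    then show ?thesis unfolding edge_forms_def even_pairs_def level_simps(1) by blast
  qed
qed

text \<open>A new form has at least two branches of height \<open>h\<close> and any multiset of
  lower ones. Those with exactly two branches in all are subtracted, because the centre would have
  valence two.\<close>

lemma mgf_vertex_forms_Suc:
  "mgf (vertex_forms (Suc h)) = mgf (vertex_forms h) +
    (mgf (mults (trees_below h)) * (mgf (mults (level h)) - 1 - tgf (level h)) - mgf {M \<in> mults (level h). size M = 2})"
proof -
  let ?P = "\<lambda>M. size (filter_mset (\<lambda>T. T \<in> level h) M) \<ge> 2"
  let ?X = "{M \<in> mults (trees_below (Suc h)). size M \<ge> 3 \<and> ?P M}"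
  let ?H = "{M \<in> mults (level h). size M = 2}"
  have all: "M \<in> mults (trees_below (Suc h)) \<Longrightarrow> set_mset M \<subseteq> trees" for M
    using trees_below_subset by (auto simp: mults_def)
  have lv: "set_mset M \<subseteq> level h \<Longrightarrow> filter_mset (\<lambda>T. T \<in> level h) M = M" for M
    by (auto simp: filter_mset_eq_conv)
  have "{M \<in> mults (trees_below (Suc h)). ?P M} = ?X \<union> ?H"
  proof (intro equalityI subsetI)
    fix M assume M: "M \<in> {M \<in> mults (trees_below (Suc h)). ?P M}"
    show "M \<in> ?X \<union> ?H"
    proof (cases "size M \<ge> 3")
      case False
      have le: "size (filter_mset (\<lambda>T. T \<in> level h) M) \<le> size M" by (rule size_filter_mset_lesseq)
      have "M = filter_mset (\<lambda>T. T \<in> level h) M + filter_mset (\<lambda>T. T \<notin> level h) M"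
        by (rule multiset_partition)
      then have "size M = size (filter_mset (\<lambda>T. T \<in> level h) M) + size (filter_mset (\<lambda>T. T \<notin> level h) M)"
        by (metis size_union)
      then have "size (filter_mset (\<lambda>T. T \<notin> level h) M) = 0" "size M = 2"
        using False M by (simp_all only: mem_Collect_eq) linarith+
      then have "filter_mset (\<lambda>T. T \<notin> level h) M = {#}" by (simp only: size_eq_0_iff_empty)
      then have "\<forall>T\<in>#M. T \<in> level h" by simp
      then show ?thesis using M \<open>size M = 2\<close> by (auto simp: mults_def)
    qed (use M in auto)
  next
    fix M assume "M \<in> ?X \<union> ?H"
    then show "M \<in> {M \<in> mults (trees_below (Suc h)). ?P M}"
      using lv[of M] by (auto simp: mults_def level_simps(1))
  qed
  moreover have "mgf (?X \<union> ?H) = mgf ?X + mgf ?H"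
    using all level_simps(3) by (intro gf_Un mfin) (auto simp: mults_def)
  moreover have "mgf {M \<in> mults (trees_below (Suc h)). ?P M} =
      mgf (mults (trees_below h)) * mgf {N \<in> mults (level h). size N \<ge> 2}"
    unfolding level_simps(1)
    by (rule mgf_mults_plus[where P = "\<lambda>N. size N \<ge> 2", OF level_simps(2) trees_below_subset level_simps(3)])
  moreover have "mgf {N \<in> mults (level h). size N \<ge> 2} = mgf (mults (level h)) - 1 - tgf (level h)"
    using mgf_size_split[OF level_simps(3)] by simp
  moreover have "mgf (vertex_forms (Suc h)) = mgf (vertex_forms h) + mgf ?X"
    unfolding vertex_forms_Suc
  proof (rule gf_Un)
    show "vertex_forms h \<inter> ?X = {}"
    proof (rule ccontr)
      assume "\<not> ?thesis"
      then obtain M where M: "M \<in> vertex_forms h" "?P M" by blast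
      then have "set_mset M \<subseteq> trees_below h" by (simp add: vertex_forms_def mults_def)
      from no_level[OF this] M(2) show False by (simp only: size_empty)
    qed
    show "finite_fibres msize (vertex_forms h)"
      using trees_below_subset by (intro mfin) (auto simp: vertex_forms_def mults_def)
    show "finite_fibres msize ?X" using all by (intro mfin) auto
  qed
  ultimately show ?thesis by (simp add: algebra_simps)
qed

lemma mgf_edge_forms_Suc: "mgf (edge_forms (Suc h)) = mgf (edge_forms h) + mgf (even_pairs (level h))"
  unfolding edge_forms_Suc
proof (rule gf_Un)
  have "M = {#}" if "set_mset M \<subseteq> trees_below h" "set_mset M \<subseteq> level h" for M
    using that level_simps(2)[of h] by (metis Int_subset_iff set_mset_eq_empty_iff subset_empty)
  then show "edge_forms h \<inter> even_pairs (level h) = {}"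
    by (force simp: edge_forms_def even_pairs_def)
  show "finite_fibres msize (edge_forms h)" "finite_fibres msize (even_pairs (level h))"
    using trees_below_subset level_simps(3) by (intro mfin; fastforce simp: edge_forms_def even_pairs_def)+
qed

lemma forms_telescope:
  "mgf (vertex_forms h) - mgf (edge_forms h) = ell - tgf_below (Suc h) - ell * tgf_below h"
proof (induction h)
  case 0
  have e: "vertex_forms 0 = {}" "edge_forms 0 = {}" "mults {} = {{#}}"
    by (auto simp: vertex_forms_def edge_forms_def even_pairs_def mults_def trees_below_0 no_odd_repeat_def)
  have "mgf {{#}} = 1" by (simp add: gf_single mweight_simps)
  then have "tgf_below (Suc 0) = ell" using tgf_below_rec[of 0] by (simp add: trees_below_0 e)
  then show ?case by (simp add: e trees_below_0)
next
  case (Suc h)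
  define \<delta> S S' h2 e2 where "\<delta> = tgf (level h)" and "S = mgf (mults (trees_below h))"
    and "S' = mgf (mults (level h))" and "h2 = mgf {M \<in> mults (level h). size M = 2}"
    and "e2 = mgf (even_pairs (level h))"
  have 1: "S = 1 + ell + tgf_below h - tgf_below (Suc h)" using tgf_below_rec[of h] by (simp add: S_def)
  have "mgf (mults (trees_below (Suc h))) = S * S'"
    unfolding level_simps(1) S_def S'_def
    by (rule mgf_mults_Un[OF level_simps(2) trees_below_subset level_simps(3)])
  then have 2: "S * S' = 1 + ell + tgf_below (Suc h) - tgf_below (Suc (Suc h))" using tgf_below_rec[of "Suc h"] by simp
  have 3: "\<delta> = tgf_below (Suc h) - tgf_below h" using tgf_below_Suc[of h] by (simp add: \<delta>_def)
  have 4: "h2 + e2 = \<delta> * \<delta>"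
    using sum_of_squares[OF level_simps(3)[of h]] by (simp add: h2_def e2_def \<delta>_def even_pairs_def)
  \<comment> \<open>The excluded bivalent centres \<open>h2\<close> and the new edge centres
    \<open>e2\<close> enter only through their sum, which is the square from
    \<open>sum_of_squares\<close>.\<close>
  have "mgf (vertex_forms (Suc h)) - mgf (edge_forms (Suc h)) =
      (mgf (vertex_forms h) - mgf (edge_forms h)) + (S * S' - S - S * \<delta> - (h2 + e2))"
    unfolding mgf_vertex_forms_Suc mgf_edge_forms_Suc
    by (simp add: \<delta>_def S_def S'_def h2_def e2_def algebra_simps)
  also have "\<dots> = (ell - tgf_below (Suc h) - ell * tgf_below h) + (S * S' - S - S * \<delta> - \<delta> * \<delta>)"
    unfolding Suc 4 ..
  \<comment> \<open>As \<open>S = 1 + ell - \<delta>\<close>, one has \<open>S + S * \<delta> +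
    \<delta> * \<delta> = 1 + ell + ell * \<delta>\<close>: the square cancels the quadratic term of
    the product.\<close>
  also have "\<dots> = ell - tgf_below (Suc (Suc h)) - ell * tgf_below (Suc h)"
    unfolding 2 unfolding 1 3 by (simp add: algebra_simps)
  finally show ?case .
qed

lemma finite_fibres_cforms: "finite_fibres csize {c. cwf r c}"
  unfolding finite_fibres_def
proof
  fix n
  have "{c. c \<in> {c. cwf r c} \<and> csize c = n} \<subseteq> (\<Union>k\<in>{0..n}. {c. cwf r c \<and> size (cleaves c) = k})"
    using factor_le[of _ n] by (auto simp: csize_def)
  moreover have "finite \<dots>" using finite_cforms by auto
  ultimately show "finite {c. c \<in> {c. cwf r c} \<and> csize c = n}" by (rule finite_subset)
qed

text \<open>The coefficient \<open>n\<close> sees only branches of height less than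
  \<open>n\<close>, so \<open>forms_telescope\<close> at \<open>n\<close> suffices. The centre adds
  a sign to the weights of the branches: \<open>(-1)^d\<close> for a vertex and the opposite for an
  edge, whose degree \<open>d - 1\<close> is subtracted.\<close>

lemma gf_cforms:
  "gf csize cweight {c. cwf r c \<and> cgood m d c} = fps_const ((- 1) ^ d) * (ell - tgf trees - ell * tgf trees)"
proof (rule fps_ext)
  fix n
  let ?C = "VC ` vertex_forms n \<union> EC ` edge_forms n"
  have sz: "csize (VC M) = msize M" "csize (EC M) = msize M" for M by (simp_all add: csize_def msize_def)
  have "fps_nth (gf csize cweight {c. cwf r c \<and> cgood m d c}) n = fps_nth (gf csize cweight ?C) n"
  proof (rule gf_nth_cong)
    fix c assume n: "csize c = n"
    show "c \<in> {c. cwf r c \<and> cgood m d c} \<longleftrightarrow> c \<in> ?C"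
    proof (cases c)
      case (VC M)
      have "set_mset M \<subseteq> trees_below n \<longleftrightarrow> set_mset M \<subseteq> trees"
        using n sz VC by (intro mults_stable[of n]) auto
      then show ?thesis unfolding VC by (auto simp: vertex_forms_def mults_def trees_def)
    next
      case (EC M)
      have "set_mset M \<subseteq> trees_below n \<longleftrightarrow> set_mset M \<subseteq> trees"
        using n sz EC by (intro mults_stable[of n]) auto
      moreover have "EC M \<in> ?C \<longleftrightarrow> M \<in> edge_forms n" by blast
      moreover have "set_mset M \<subseteq> trees \<longleftrightarrow> (\<forall>T\<in>#M. pwf r T) \<and> (\<forall>T\<in>#M. pgood m d T)"
        by (auto simp: trees_def)
      ultimately show ?thesis
        unfolding EC mem_Collect_eq cwf.simps cgood.simps edge_forms_def even_pairs_def by blast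
    qed
  qed
  also have "gf csize cweight ?C = gf csize cweight (VC ` vertex_forms n) + gf csize cweight (EC ` edge_forms n)"
  proof (rule gf_Un)
    have "cwf r (VC M)" if "M \<in> vertex_forms n" for M
      using that unfolding vertex_forms_def mults_def trees_below_def cwf.simps by blast
    moreover have "cwf r (EC M)" if "M \<in> edge_forms n" for M
      using that unfolding edge_forms_def even_pairs_def trees_below_def cwf.simps by blast
    ultimately have "VC ` vertex_forms n \<subseteq> {c. cwf r c}" "EC ` edge_forms n \<subseteq> {c. cwf r c}"
      by blast+
    then show "finite_fibres csize (VC ` vertex_forms n)" "finite_fibres csize (EC ` edge_forms n)"
      using finite_fibres_subset[OF finite_fibres_cforms] by blast+
  qed auto
  also have "gf csize cweight (VC ` vertex_forms n) = fps_const ((- 1) ^ d) * mgf (vertex_forms n)"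
  proof (rule gf_image)
    show "cweight (VC M) = (- 1) ^ d * mweight M" for M
      using psgn_add[of "\<Sum>\<^sub># (image_mset (pdegree m d) M)" "- int d"]
      by (simp add: cweight_def mweight_def psgn_minus psgn_of_nat mult_ac)
  qed (auto simp: sz inj_on_def)
  also have "gf csize cweight (EC ` edge_forms n) = fps_const (- ((- 1) ^ d)) * mgf (edge_forms n)"
  proof (rule gf_image)
    have p: "psgn (1 - int d) = - ((- 1) ^ d)"
      using psgn_add[of 1 "- int d"] by (simp add: psgn_minus psgn_of_nat) (simp add: psgn_def)
    have e: "k - (int d - 1) = k + (1 - int d)" for k by simp
    show "cweight (EC M) = - ((- 1) ^ d) * mweight M" for M
      unfolding cweight_def mweight_def cdegree.simps cleaves.simps e psgn_add p by (simp add: mult_ac)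
  qed (auto simp: sz inj_on_def)
  also have "fps_const ((- 1) ^ d) * mgf (vertex_forms n) + fps_const (- ((- 1) ^ d)) * mgf (edge_forms n)
      = fps_const ((- 1) ^ d) * (ell - tgf_below (Suc n) - ell * tgf_below n)"
    unfolding forms_telescope[symmetric] by (simp add: algebra_simps flip: fps_const_neg)
  also have "fps_nth \<dots> n = fps_nth (fps_const ((- 1) ^ d) * (ell - tgf trees - ell * tgf trees)) n"
  proof -
    have "fps_nth (ell * tgf_below n) n = fps_nth (ell * tgf trees) n"
      unfolding fps_mult_nth by (intro sum.cong) (auto simp: tgf_stable)
    then show ?thesis by (simp add: tgf_stable)
  qed
  finally show "fps_nth (gf csize cweight {c. cwf r c \<and> cgood m d c}) n =
      fps_nth (fps_const ((- 1) ^ d) * (ell - tgf trees - ell * tgf trees)) n" .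
qed

text \<open>The multisets of copies of \<open>T\<close> have the series \<open>1 - ?W\<close> for
  odd \<open>T\<close> and its inverse, a geometric series, for even \<open>T\<close>. In both cases
  the logarithm is that of \<open>1 - ?W\<close> up to the sign of \<open>T\<close>.\<close>

lemma fps_log_single:
  assumes T: "T \<in> trees"
  shows "fps_nth (mgf (mults {T})) 0 = 1"
    "fps_nth (fps_log (mgf (mults {T}))) n = (if n > 0 \<and> tsize T dvd n
       then const_poly (of_nat (tsize T) / of_nat n) * psgn (pdegree m d T) * (mon (pleaves T) ^ l) ^ (n div tsize T) else 0)"
proof -
  let ?W = "fps_const (mon (pleaves T) ^ l) * fps_X ^ tsize T"
  have pos: "tsize T > 0"
    using T pwf_pleaves[of r T] l_pos by (simp add: trees_def tsize_def nonempty_has_size[symmetric])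
  have sub: "{T} \<subseteq> trees" using T by simp
  have one: "fps_nth (1 - ?W) 0 = 1" using pos by simp
  have "fps_nth (mgf (mults {T})) 0 = 1 \<and> fps_log (mgf (mults {T})) =
      fps_const (- psgn (pdegree m d T)) * fps_log (1 - ?W)"
  proof (cases "podd m d T")
    case True
    have "mults {T} = {{#}} \<union> {{#T#}}"
    proof (intro equalityI subsetI)
      fix M assume M: "M \<in> mults {T}"
      then have "M = replicate_mset (size M) T"
        by (metis (no_types, lifting) mem_Collect_eq mults_def set_mset_subset_singletonD)
      moreover have "count M T \<le> 1" using M True by (auto simp: mults_def no_odd_repeat_def)
      ultimately have "size M \<le> 1" by (metis count_replicate_mset)
      then consider "size M = 0" | "size M = 1" by linarith
      then show "M \<in> {{#}} \<union> {{#T#}}"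
        by cases (use \<open>M = replicate_mset (size M) T\<close> in auto)
    qed (auto simp: mults_def no_odd_repeat_def)
    then have "mgf (mults {T}) = mgf {{#}} + mgf {{#T#}}"
      using T by (simp only:) (intro gf_Un mfin; auto)
    also have "\<dots> = 1 - ?W"
      using True by (simp add: gf_single mweight_simps tweight_def psgn_def flip: fps_const_neg)
    finally show ?thesis using one True by (simp add: psgn_def)
  next
    case False
    have "mults {T} = {{#}} \<union> add_mset T ` mults {T}"
    proof (intro equalityI subsetI)
      fix M assume M: "M \<in> mults {T}"
      show "M \<in> {{#}} \<union> add_mset T ` mults {T}"
      proof (cases M)
        case (add U N)
        then have "U = T" "set_mset N \<subseteq> {T}" using M by (auto simp: mults_def)
        then have "N \<in> mults {T}" using False by (auto simp: mults_def no_odd_repeat_def count_eq_zero_iff subset_singleton_iff) (metis empty_iff le0 not_in_iff singletonD subsetD)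
        then show ?thesis using add \<open>U = T\<close> by blast
      qed simp
    next
      fix M assume M: "M \<in> {{#}} \<union> add_mset T ` mults {T}"
      have "count K x = 0" if "set_mset K \<subseteq> {T}" "podd m d x" for K x
        using that False by (metis count_eq_zero_iff singletonD subsetD)
      then show "M \<in> mults {T}" using M False by (auto simp: mults_def no_odd_repeat_def)
    qed
    then have "mgf (mults {T}) = mgf ({{#}} \<union> add_mset T ` mults {T})" by simp
    also have "\<dots> = mgf {{#}} + mgf (add_mset T ` mults {T})"
      using T by (intro gf_Un mfin) (auto simp: mults_def)
    also have "mgf (add_mset T ` mults {T}) = fps_const (tweight T) * gf (\<lambda>M. tsize T + msize M) mweight (mults {T})"
      by (rule gf_image) (auto simp: mweight_simps inj_on_def)
    also have "gf (\<lambda>M. tsize T + msize M) mweight (mults {T}) = fps_X ^ tsize T * mgf (mults {T})"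
    proof (rule fps_ext)
      fix n
      have "{M. M \<in> mults {T} \<and> tsize T + msize M = n} = (if n < tsize T then {} else {M. M \<in> mults {T} \<and> msize M = n - tsize T})"
        by auto
      then show "fps_nth (gf (\<lambda>M. tsize T + msize M) mweight (mults {T})) n = fps_nth (fps_X ^ tsize T * mgf (mults {T})) n"
        by (simp add: gf_nth fps_X_power_mult_nth)
    qed
    also have "mgf {{#}} = 1" by (simp add: gf_single mweight_simps)
    also have "tweight T = mon (pleaves T) ^ l" using False by (simp add: tweight_def psgn_def)
    finally have e: "mgf (mults {T}) = 1 + fps_const (mon (pleaves T) ^ l) * (fps_X ^ tsize T * mgf (mults {T}))" .
    have "mgf (mults {T}) * (1 - ?W) =
        mgf (mults {T}) - fps_const (mon (pleaves T) ^ l) * (fps_X ^ tsize T * mgf (mults {T}))"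
      by (simp only: algebra_simps mult_1_right mult_1_left)
    also have "\<dots> = 1" unfolding diff_eq_eq by (rule e)
    finally have eq: "mgf (mults {T}) * (1 - ?W) = 1" .
    have "fps_nth (mgf (mults {T}) * (1 - ?W)) 0 = fps_nth (mgf (mults {T})) 0"
      using pos by simp
    then have 0: "fps_nth (mgf (mults {T})) 0 = 1" unfolding eq by simp
    have "fps_log (mgf (mults {T})) + fps_log (1 - ?W) = 0"
      using fps_log_mult[OF 0 one] unfolding eq by simp
    then have "fps_log (mgf (mults {T})) = - fps_log (1 - ?W)" by (simp add: eq_neg_iff_add_eq_0)
    then show ?thesis using 0 False by (simp add: psgn_def flip: fps_const_neg)
  qed
  then have k: "fps_nth (mgf (mults {T})) 0 = 1"
    "fps_log (mgf (mults {T})) = fps_const (- psgn (pdegree m d T)) * fps_log (1 - ?W)" by blast+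
  show "fps_nth (mgf (mults {T})) 0 = 1" by (rule k(1))
  show "fps_nth (fps_log (mgf (mults {T}))) n = (if n > 0 \<and> tsize T dvd n
       then const_poly (of_nat (tsize T) / of_nat n) * psgn (pdegree m d T) * (mon (pleaves T) ^ l) ^ (n div tsize T) else 0)"
    unfolding k(2) fps_mult_left_const_nth fps_log_monomial[OF pos] by (simp add: mult_ac)
qed

lemma mgf_prod: "finite A \<Longrightarrow> A \<subseteq> trees \<Longrightarrow> mgf (mults A) = (\<Prod>T\<in>A. mgf (mults {T}))"
proof (induction A rule: finite_induct)
  case empty
  have "mults {} = {{#}}" by (auto simp: mults_def no_odd_repeat_def)
  then show ?case by (simp add: gf_single mweight_simps)
next
  case (insert T A)
  then have "mgf (mults ({T} \<union> A)) = mgf (mults {T}) * mgf (mults A)" by (intro mgf_mults_Un) auto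
  then show ?case using insert by simp
qed

text \<open>By \<open>mgf_trees\<close>, \<open>1 + ell\<close> is an infinite product over all
  planted trees. The factor for the trees with more than \<open>n\<close> leaves is 1 up to degree
  \<open>n\<close> and does not influence the coefficient, which leaves a finite product.\<close>

lemma fps_log_ell:
  "fps_nth (fps_log (1 + ell)) n =
     (\<Sum>T | T \<in> trees \<and> size (pleaves T) \<le> n. fps_nth (fps_log (mgf (mults {T}))) n)"
proof -
  let ?A = "{T. T \<in> trees \<and> size (pleaves T) \<le> n}" and ?B = "{T. T \<in> trees \<and> \<not> size (pleaves T) \<le> n}"
  have fin: "finite ?A" by (rule finite_subset[OF _ finite_planted[of r n]]) (auto simp: trees_def)
  have "trees = ?A \<union> ?B" by auto
  then have "mgf (mults trees) = mgf (mults ?A) * mgf (mults ?B)"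
    using mgf_mults_Un[of ?A ?B] by auto
  then have eq: "1 + ell = (\<Prod>T\<in>?A. mgf (mults {T})) * mgf (mults ?B)"
    using mgf_prod[OF fin] mgf_trees by auto
  have B: "fps_nth (mgf (mults ?B)) k = (if k = 0 then 1 else 0)" if "k \<le> n" for k
  proof -
    have "fps_nth (mgf (mults ?B)) k = fps_nth (mgf {{#}}) k"
    proof (rule gf_nth_cong)
      fix M assume k: "msize M = k"
      have "M = {#}" if "M \<in> mults ?B"
      proof (rule ccontr)
        assume "M \<noteq> {#}"
        then obtain T where "T \<in># M" by blast
        then have "n < size (pleaves T)" "size (pleaves T) \<le> size (\<Sum>\<^sub># (image_mset pleaves M))"
          using that member_leaves by (auto simp: mults_def)
        then have "n < k" using k factor_le[of "size (\<Sum>\<^sub># (image_mset pleaves M))" k] by (simp add: msize_def)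
        then show False using \<open>k \<le> n\<close> by simp
      qed
      then show "M \<in> mults ?B \<longleftrightarrow> M \<in> {{#}}" by (auto simp: mults_def no_odd_repeat_def)
    qed
    then show ?thesis by (simp add: gf_single mweight_simps)
  qed
  have prod: "fps_log (\<Prod>T\<in>?A. mgf (mults {T})) = (\<Sum>T\<in>?A. fps_log (mgf (mults {T})))"
    "fps_nth (\<Prod>T\<in>?A. mgf (mults {T})) 0 = 1"
    using fps_log_prod[OF fin, of "\<lambda>T. mgf (mults {T})"] fps_log_single(1) by auto
  have "fps_log (1 + ell) = (\<Sum>T\<in>?A. fps_log (mgf (mults {T}))) + fps_log (mgf (mults ?B))"
    unfolding eq using fps_log_mult[OF prod(2)] B[of 0] prod(1) by simp
  then show ?thesis using fps_log_below[of n "mgf (mults ?B)"] B by (simp add: fps_sum_nth)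
qed

end

section \<open>The generating function of the Euler characteristics\<close>

lemmas trees_eq = trees_def[OF zero_less_one]

lemma size_1 [simp]:
  "tsize 1 T = size (pleaves T)" "tsize (Suc 0) T = size (pleaves T)"
  "csize 1 c = size (cleaves c)" "csize (Suc 0) c = size (cleaves c)"
  using tsize_def[OF zero_less_one] csize_def[OF zero_less_one] by simp_all

text \<open>
  Moebius inversion of \<open>ln (1 + ell l) = (\<Sum>j. \<psi> (l * j) f / j)\<close>, where \<open>f\<close> is the generating
  function of planted trees and \<open>\<psi> k\<close> raises the variables to the power \<open>k\<close>: only \<open>j = l = 1\<close> survives.
\<close>

lemma moebius_inversion_term:
  assumes "s > 0" "n > 0"
  shows "(\<Sum>l = 1..n. const_poly (moebius_mu l / of_nat l) *
      (if n > 0 \<and> l * s dvd n then const_poly (of_nat (l * s) / of_nat n) * c * (a ^ l) ^ (n div (l * s)) else 0))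
    = (if s = n then c * a else 0)"
proof (cases "s dvd n")
  case False
  then have "\<not> l * s dvd n" for l by (metis dvd_mult_right)
  then show ?thesis using False by auto
next
  case True
  then obtain q where q: "n = s * q" by blast
  with assms have q0: "q > 0" by simp
  have "(\<Sum>l = 1..n. const_poly (moebius_mu l / of_nat l) *
      (if n > 0 \<and> l * s dvd n then const_poly (of_nat (l * s) / of_nat n) * c * (a ^ l) ^ (n div (l * s)) else 0))
    = (\<Sum>l = 1..n. if l dvd q then const_poly (moebius_mu l / of_nat q) * (c * a ^ q) else 0)"
  proof (rule sum.cong[OF refl])
    fix l assume l: "l \<in> {1..n}"
    have "l * s dvd n \<longleftrightarrow> l dvd q" using assms(1) by (simp add: q mult.commute)
    moreover have "const_poly (moebius_mu l / of_nat l) *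
        (const_poly (of_nat (l * s) / of_nat n) * c * (a ^ l) ^ (n div (l * s))) =
        const_poly (moebius_mu l / of_nat q) * (c * a ^ q)" if "l dvd q"
    proof -
      have "const_poly (moebius_mu l / of_nat l) * const_poly (of_nat (l * s) / of_nat n) =
          const_poly (moebius_mu l / of_nat q)"
        using l assms(1) by (simp add: q flip: const_poly_mult)
      moreover have "(a ^ l) ^ (n div (l * s)) = a ^ q"
        using that assms(1) by (simp add: q mult.commute[of l s] flip: power_mult)
      moreover have "x * (y * c * z) = (x * y) * (c * z)" for x y z :: xpoly by (simp only: mult_ac)
      ultimately show ?thesis by (simp only:)
    qed
    ultimately show "const_poly (moebius_mu l / of_nat l) *
      (if n > 0 \<and> l * s dvd n then const_poly (of_nat (l * s) / of_nat n) * c * (a ^ l) ^ (n div (l * s)) else 0) =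
      (if l dvd q then const_poly (moebius_mu l / of_nat q) * (c * a ^ q) else 0)"
      using assms(2) by simp
  qed
  also have "\<dots> = (\<Sum>l | l dvd q. const_poly (moebius_mu l / of_nat q) * (c * a ^ q))"
  proof (rule sum.mono_neutral_cong_right)
    show "{l. l dvd q} \<subseteq> {1..n}"
    proof
      fix l assume "l \<in> {l. l dvd q}"
      then have "l \<le> q" "l > 0" using q0 by (auto intro: dvd_imp_le dvd_pos_nat)
      moreover have "q \<le> n" using assms(1) q by simp
      ultimately show "l \<in> {1..n}" by simp
    qed
  qed auto
  also have "\<dots> = const_poly ((\<Sum>l | l dvd q. moebius_mu l) / of_nat q) * (c * a ^ q)"
  proof -
    have "const_poly (\<Sum>l\<in>A. g l) = (\<Sum>l\<in>A. const_poly (g l))" for g :: "nat \<Rightarrow> rat" and A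
      by (induction A rule: infinite_finite_induct) (simp_all add: const_poly_add)
    then show ?thesis by (simp add: sum_divide_distrib sum_distrib_right)
  qed
  also have "\<dots> = (if s = n then c * a else 0)"
    unfolding sum_moebius_mu[OF q0] using assms q by auto
  finally show ?thesis .
qed

text \<open>After each logarithm is expanded over trees and the sums are exchanged, the Moebius
  inversion takes place for each tree separately.\<close>

lemma log_series_eq_trees: "log_series r m d = gf (tsize 1) (tweight d 1 m) (trees r d m)"
proof (rule fps_ext)
  fix n
  have low: "fps_nth (fps_log (1 + ell r d l m)) k = 0" if "k < l" for k l
  proof (rule fps_log_below)
    fix j assume "j \<le> k"
    then have "j < l" using that by simp
    moreover have "ell r d l m = fps_X ^ l * (- ((- 1) ^ d * fps_const (signed_power_sum r m l)))"
      using that ell_def[of l r d m] by (simp add: mult_ac)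
    ultimately show "fps_nth (1 + ell r d l m) j = (if j = 0 then 1 else 0)"
      by (simp add: fps_X_power_mult_nth)
  qed
  have ln: "ln_one_plus (- ((- 1) ^ d * fps_X ^ l * fps_const (signed_power_sum r m l))) = fps_log (1 + ell r d l m)" if "l > 0" for l
    using ell_def[OF that, of r d m] by (simp add: fps_log_def)
  let ?A = "{T. T \<in> trees r d m \<and> size (pleaves T) \<le> n}"
  let ?t = "\<lambda>l T. if n > 0 \<and> l * size (pleaves T) dvd n then const_poly (of_nat (l * size (pleaves T)) / of_nat n) *
      psgn (pdegree m d T) * (mon (pleaves T) ^ l) ^ (n div (l * size (pleaves T))) else 0"
  have pos: "size (pleaves T) > 0" if "T \<in> trees r d m" for T
    using that pwf_pleaves[of r T] by (simp add: trees_eq nonempty_has_size[symmetric])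
  have "fps_nth (log_series r m d) n =
      (\<Sum>l = 1..n. const_poly (moebius_mu l / of_nat l) * fps_nth (fps_log (1 + ell r d l m)) n)"
  proof -
    have "fps_nth (log_series r m d) n = (\<Sum>l = 1..n. const_poly (moebius_mu l / of_nat l) *
       fps_nth (ln_one_plus (- ((- 1) ^ d * fps_X ^ l * fps_const (signed_power_sum r m l)))) n)"
      by (rule log_series_nth) (simp add: ln low)
    then show ?thesis by (simp add: ln)
  qed
  also have "\<dots> = (\<Sum>l = 1..n. \<Sum>T\<in>?A. const_poly (moebius_mu l / of_nat l) * ?t l T)"
  proof (rule sum.cong[OF refl])
    fix l assume "l \<in> {1..n}"
    then have l: "l > 0" by simp
    show "const_poly (moebius_mu l / of_nat l) * fps_nth (fps_log (1 + ell r d l m)) n =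
        (\<Sum>T\<in>?A. const_poly (moebius_mu l / of_nat l) * ?t l T)"
      unfolding fps_log_ell[OF l] sum_distrib_left
    proof (rule sum.cong[OF HOL.refl])
      fix T assume "T \<in> ?A"
      then have "T \<in> trees r d m" by simp
      from fps_log_single(2)[OF l this, of n] tsize_def[OF l, of T]
      show "const_poly (moebius_mu l / of_nat l) * fps_nth (fps_log (mgf d l m (mults d m {T}))) n =
          const_poly (moebius_mu l / of_nat l) * ?t l T" by (simp only:)
    qed
  qed
  also have "\<dots> = (\<Sum>T\<in>?A. \<Sum>l = 1..n. const_poly (moebius_mu l / of_nat l) * ?t l T)"
    by (rule sum.swap)
  also have "\<dots> = (\<Sum>T\<in>?A. if size (pleaves T) = n then psgn (pdegree m d T) * mon (pleaves T) else 0)"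
  proof (rule sum.cong[OF refl])
    fix T assume T: "T \<in> ?A"
    show "(\<Sum>l = 1..n. const_poly (moebius_mu l / of_nat l) * ?t l T) =
        (if size (pleaves T) = n then psgn (pdegree m d T) * mon (pleaves T) else 0)"
    proof (rule moebius_inversion_term)
      show "size (pleaves T) > 0" "n > 0" using T pos[of T] by auto
    qed
  qed
  also have "\<dots> = (\<Sum>T | T \<in> trees r d m \<and> size (pleaves T) = n. psgn (pdegree m d T) * mon (pleaves T))"
  proof (rule sum.mono_neutral_cong_right)
    show "finite ?A" by (rule finite_subset[OF _ finite_planted[of r n]]) (auto simp: trees_eq)
  qed auto
  also have "\<dots> = fps_nth (gf (tsize 1) (tweight d 1 m) (trees r d m)) n"
    by (simp add: gf_nth tweight_def[OF zero_less_one] del: One_nat_def)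
  finally show "fps_nth (log_series r m d) n = fps_nth (gf (tsize 1) (tweight d 1 m) (trees r d m)) n" .
qed

definition form_series :: "nat \<Rightarrow> (nat \<Rightarrow> nat) \<Rightarrow> nat \<Rightarrow> xpoly fps" where
  "form_series r m d = gf (csize 1) (cweight d 1 m) {c. cwf r c \<and> cgood m d c}"

text \<open>Ensures that division by \<open>u\<close> leaves no negative exponent.\<close>

lemma form_series_0: "fps_nth (form_series r m d) 0 = 0"
proof -
  have "fps_nth (gf (tsize 1) (tweight d 1 m) (trees r d m)) 0 = fps_nth (gf (tsize 1) (tweight d 1 m) {}) 0"
  proof (rule gf_nth_cong)
    fix T assume "tsize 1 T = 0"
    then show "T \<in> trees r d m \<longleftrightarrow> T \<in> {}"
      using pwf_pleaves[of r T] by (auto simp: trees_eq)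
  qed
  moreover have "fps_nth (ell r d 1 m) 0 = 0"
    by (simp add: ell_def[OF zero_less_one] del: One_nat_def)
  ultimately show ?thesis unfolding form_series_def gf_cforms[OF zero_less_one] by simp
qed

lemma fls_nth_sum: "fls_nth (\<Sum>x\<in>A. g x) k = (\<Sum>x\<in>A. fls_nth (g x) k)"
  by (induction A rule: infinite_finite_induct) simp_all

text \<open>Write \<open>p\<close> for the signed sum of the variables and \<open>f\<close> for the
  logarithmic series. For \<open>l = 1\<close> one has \<open>ell = - (-1)^d u p\<close>, so
  \<open>(-1)^d (ell - f - ell f) / u\<close> equals
  \<open>- p + (p - (-1)^d / u) f\<close>.\<close>

lemma target_series:
  "- fls_const (signed_power_sum r m 1)
    + (fls_const (signed_power_sum r m 1) - (- 1) ^ d * fls_X_inv) * fps_to_fls (log_series r m d)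
   = fls_X_inv * fps_to_fls (form_series r m d)"
proof -
  let ?f = "fps_to_fls (log_series r m d)" and ?p = "fls_const (signed_power_sum r m 1)"
  have sgn: "fls_const ((- 1 :: xpoly) ^ d) = (- 1) ^ d"
    by (cases "even d") simp_all
  have sq: "(- 1 :: xpoly fls) ^ d * (- 1) ^ d = 1" by (simp flip: power_add)
  have X: "fls_X_inv * (fls_X * g) = g" for g :: "xpoly fls"
    by (simp add: fls_X_times_conv_shift fls_X_inv_times_conv_shift)
  have ell: "fps_to_fls (ell r d 1 m) = - ((- 1) ^ d * (fls_X * ?p))"
    by (simp add: ell_def[OF zero_less_one] fls_times_fps_to_fls fps_to_fls_power mult.assoc del: One_nat_def)
  have "fls_X_inv * fps_to_fls (form_series r m d) =
      fls_X_inv * ((- 1) ^ d * (- ((- 1) ^ d * (fls_X * ?p)) - ?f + (- 1) ^ d * (fls_X * ?p) * ?f))"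
    unfolding form_series_def gf_cforms[OF zero_less_one] log_series_eq_trees[symmetric]
    by (simp add: fls_times_fps_to_fls sgn ell del: One_nat_def)
  also have "\<dots> = - (((- 1) ^ d * (- 1) ^ d) * (fls_X_inv * (fls_X * ?p))) - (- 1) ^ d * fls_X_inv * ?f +
      ((- 1) ^ d * (- 1) ^ d) * (fls_X_inv * (fls_X * (?p * ?f)))"
    by (simp only: algebra_simps mult_minus_left mult_minus_right)
  finally show ?thesis unfolding sq X by (simp add: algebra_simps)
qed

lemma cweight_1: "cweight d 1 m c = Poly_Mapping.single (mexp (cleaves c)) ((- 1) powi cdegree m d c)"
proof -
  have "psgn k * Poly_Mapping.single s 1 = Poly_Mapping.single s ((- 1) powi k)" for k s
    by (cases "even k") (simp_all add: psgn_def single_uminus power_int_minus_left)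
  then show ?thesis by (simp add: cweight_def[OF zero_less_one] mon_def del: One_nat_def)
qed

lemma forms_conv: "forms r m d s n =
    {c \<in> {c. c \<in> {c. cwf r c \<and> cgood m d c} \<and> csize 1 c = n}. mexp (cleaves c) = s}"
proof -
  have "count (cleaves c) = Poly_Mapping.lookup s \<longleftrightarrow> mexp (cleaves c) = s" for c
    by (metis lookup_mexp poly_mapping_eqI)
  then show ?thesis by (auto simp: forms_def)
qed

lemma single_sum: "Poly_Mapping.single s (\<Sum>c\<in>A. g c) = (\<Sum>c\<in>A. Poly_Mapping.single s (g c))"
  by (induction A rule: infinite_finite_induct) (simp_all add: single_add)

lemma cleaves_colours:
  assumes "cwf r c"
  shows "set_mset (cleaves c) \<subseteq> {1..r}"
proof -
  have T: "set_mset (pleaves T) \<subseteq> {1..r}" if "pwf r T" for T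
    using that by (induction rule: pwf.induct) auto
  show ?thesis
  proof (cases c)
    case (VC M)
    then have "\<forall>T\<in>#M. pwf r T" using assms unfolding VC cwf.simps by blast
    then show ?thesis using T unfolding VC by fastforce
  next
    case (EC M)
    then have "\<forall>T\<in>#M. pwf r T" using assms unfolding EC cwf.simps by blast
    then show ?thesis using T unfolding EC by fastforce
  qed
qed

text \<open>Euler characteristics at exponents without forms vanish, so any finite \<open>S\<close>
  containing the occurring exponents will do; the large finite index sets in the summability proof
  provide such an \<open>S\<close>.\<close>

lemma form_series_nth:
  assumes "finite S" "\<And>c. cwf r c \<Longrightarrow> cgood m d c \<Longrightarrow> size (cleaves c) = Suc t \<Longrightarrow> mexp (cleaves c) \<in> S"
  shows "(\<Sum>s\<in>S. Poly_Mapping.single s (euler_char r m d 0 s t)) = fps_nth (form_series r m d) (Suc t)"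
proof -
  let ?C = "{c. c \<in> {c. cwf r c \<and> cgood m d c} \<and> csize 1 c = Suc t}"
  have fin: "finite ?C"
    by (rule finite_subset[OF _ finite_cforms[of r "Suc t"]]) auto
  have "(\<Sum>s\<in>S. Poly_Mapping.single s (euler_char r m d 0 s t)) =
      (\<Sum>s\<in>S. \<Sum>c\<in>{c \<in> ?C. mexp (cleaves c) = s}. cweight d 1 m c)"
    unfolding euler_char_eq_sum forms_conv single_sum by (intro sum.cong refl) (simp only: cweight_1 mem_Collect_eq)
  also have "\<dots> = (\<Sum>c\<in>?C. cweight d 1 m c)"
    using fin assms by (intro sum.group) auto
  finally show ?thesis by (simp add: form_series_def gf_nth)
qed

text \<open>In the metric of Laurent series two series are close when they agree up to a high
  exponent, including all negative ones.\<close>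

lemma tendsto_flsI:
  fixes g :: "'a::group_add fls"
  assumes "\<And>n. eventually (\<lambda>x. \<forall>k\<le>int n. fls_nth (h x) k = fls_nth g k) F"
  shows "(h \<longlongrightarrow> g) F"
proof (rule tendstoI)
  fix e :: real assume "e > 0"
  then obtain n where "(1 / 2) ^ n < e" using real_arch_pow_inv[of e "1 / 2"] by auto
  then have n: "inverse (2 ^ n) < e" by (simp add: power_one_over inverse_eq_divide)
  have "dist a g < e" if a: "\<forall>k\<le>int n. fls_nth a k = fls_nth g k" for a
  proof (cases "a = g")
    case False
    have "int n < fls_subdegree (a - g)" using False a by (intro fls_subdegree_greaterI) auto
    then have "(2 :: real) ^ n \<le> 2 ^ nat (fls_subdegree (a - g))" by (intro power_increasing) auto
    then have "dist a g \<le> inverse (2 ^ n)"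
      using False \<open>int n < fls_subdegree (a - g)\<close> by (simp add: dist_fls_def le_imp_inverse_le)
    then show ?thesis using n by simp
  qed (use \<open>e > 0\<close> in simp)
  then show "eventually (\<lambda>x. dist (h x) g < e) F"
    using assms[of n] by (rule eventually_mono[rotated])
qed

theorem theorem2p5:
  fixes r d :: nat and m :: "nat \<Rightarrow> nat"
  assumes "r \<ge> 1"
    and "\<And>i. i \<in> {1..r} \<Longrightarrow> m i \<ge> 1"
    and "d \<ge> 2"
  shows "((\<lambda>(s, t). fls_const (Poly_Mapping.single s (euler_char r m d 0 s t)) * fls_X ^ t)
      has_sum
        (- fls_const (signed_power_sum r m 1)
         + (fls_const (signed_power_sum r m 1) - (- 1) ^ d * fls_X_inv)
           * fps_to_fls (log_series r m d)))
      ({s. Poly_Mapping.keys s \<subseteq> {1..r}} \<times> UNIV)"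
proof -
  let ?g = "\<lambda>(s, t). fls_const (Poly_Mapping.single s (euler_char r m d 0 s t)) * fls_X ^ t"
  let ?I = "{s. Poly_Mapping.keys s \<subseteq> {1..r}} \<times> (UNIV :: nat set)"
  let ?V = "fls_X_inv * fps_to_fls (form_series r m d)"
  let ?C = "\<lambda>t. {c. cwf r c \<and> size (cleaves c) = Suc t}"
  have V: "fls_nth ?V k = (if k < 0 then 0 else fps_nth (form_series r m d) (Suc (nat k)))" for k
  proof -
    have "fls_nth ?V k = (if k + 1 < 0 then 0 else fps_nth (form_series r m d) (nat (k + 1)))"
      by (simp add: fls_X_inv_times_conv_shift)
    moreover have "nat (k + 1) = Suc (nat k)" if "k \<ge> 0" using that by simp
    moreover have "k + 1 = 0" if "k < 0" "\<not> k + 1 < 0" using that by simp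
    ultimately show ?thesis using form_series_0[of r m d] by auto
  qed
  have g: "fls_nth (?g (s, t)) k = (if k = int t then Poly_Mapping.single s (euler_char r m d 0 s t) else 0)" for s t k
    by (simp add: fls_X_power_times_conv_shift fls_const_nth)
  have "(sum ?g \<longlongrightarrow> ?V) (finite_subsets_at_top ?I)"
  proof (rule tendsto_flsI)
    fix n
    \<comment> \<open>For each \<open>t\<close> there are finitely many forms with
      \<open>t + 1\<close> leaves, so \<open>B\<close> is a finite set of indices containing every
      nonzero contribution up to exponent \<open>n\<close>.\<close>
    define B where "B = (\<Union>t\<in>{0..n}. (\<lambda>c. (mexp (cleaves c), t)) ` ?C t)"
    have B1: "finite B" unfolding B_def using finite_cforms by auto
    have B2: "B \<subseteq> ?I"
    proof -
      have "Poly_Mapping.keys (mexp (cleaves c)) \<subseteq> {1..r}" if "cwf r c" for c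
        using cleaves_colours[OF that] by (auto simp: in_keys_iff)
      then show ?thesis by (auto simp: B_def)
    qed
    have eq: "fls_nth (sum ?g F) k = fls_nth ?V k" if F: "finite F" "B \<subseteq> F" and k: "k \<le> int n" for F k
    proof (cases "k < 0")
      case True
      then have "fls_nth (?g p) k = 0" for p using g[of "fst p" "snd p" k] by (cases p) auto
      then have "fls_nth (sum ?g F) k = (\<Sum>p\<in>F. 0)" unfolding fls_nth_sum by (intro sum.cong HOL.refl)
      then show ?thesis using True by (simp add: V)
    next
      case False
      then obtain t where t: "k = int t" "t \<le> n" using k by (metis nat_le_iff nat_0_le not_less)
      have "fls_nth (sum ?g F) k = (\<Sum>p\<in>F. if snd p = t then Poly_Mapping.single (fst p) (euler_char r m d 0 (fst p) t) else 0)"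
        unfolding fls_nth_sum t(1) using g by (intro sum.cong refl) (auto simp: case_prod_beta split: prod.splits)
      also have "\<dots> = (\<Sum>p\<in>{p \<in> F. snd p = t}. Poly_Mapping.single (fst p) (euler_char r m d 0 (fst p) t))"
        using F(1) by (simp add: sum.inter_filter)
      also have "\<dots> = (\<Sum>s\<in>fst ` {p \<in> F. snd p = t}. Poly_Mapping.single s (euler_char r m d 0 s t))"
        by (subst sum.reindex) (auto simp: inj_on_def)
      also have "\<dots> = fps_nth (form_series r m d) (Suc t)"
      proof (rule form_series_nth)
        show "finite (fst ` {p \<in> F. snd p = t})" using F(1) by simp
        fix c assume "cwf r c" "size (cleaves c) = Suc t"
        then have "(mexp (cleaves c), t) \<in> B"
          unfolding B_def using t(2) by (intro UN_I[of t] image_eqI[of _ _ c]) simp_all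
        then have "(mexp (cleaves c), t) \<in> F" using F(2) by blast
        then show "mexp (cleaves c) \<in> fst ` {p \<in> F. snd p = t}" by force
      qed
      finally show ?thesis using False t(1) by (simp add: V)
    qed
    show "eventually (\<lambda>F. \<forall>k\<le>int n. fls_nth (sum ?g F) k = fls_nth ?V k) (finite_subsets_at_top ?I)"
      unfolding eventually_finite_subsets_at_top
    proof (intro exI conjI allI impI)
      fix F k assume "finite F \<and> B \<subseteq> F \<and> F \<subseteq> ?I" "k \<le> int n"
      then show "fls_nth (sum ?g F) k = fls_nth ?V k" by (intro eq) simp_all
    qed (rule B1, rule B2)
  qed
  then show ?thesis unfolding has_sum_def target_series .
qed

end
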